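(* Let $n \ge 2$. Let $f : \mathbb{R}^n \to [0,\infty)$ be continuous with compact support, and let $K$ be a compact set in $\mathbb{R}^n$. Then for all $u \in \mathbb{S}^{n-1}$, $$|I(f)| \le |I(S_u f)| \quad\text{and}\quad |IK| \le |I(S_u K)|.$$
   Context: $|\cdot|_k$ is $k$-dimensional Hausdorff measure, $|\cdot|=|\cdot|_n$. For a non-negative, bounded, compactly supported Borel function $g$ on $\mathbb{R}^n$, $I(g)$ is the star-shaped set $\{ r \theta : \theta \in \mathbb{S}^{n-1}, 0 \le r \le \rho_{I(g)}(\theta)\}$ with $\rho_{I(g)}(\theta) = \int_{\theta^\perp} g(y)\,dy$; for compact $K$, $IK := I(1_K)$. For $u \in \mathbb{S}^{n-1}$ and a compact set $K$, the Steiner symmetral $S_u K$ is the (compact) set such that, for every $y$ in the orthogonal projection $P_{u^\perp}K$ of $K$ onto $u^\perp$, $S_uK \cap (y+\mathbb{R}u) = y + [-\ell_y,\ell_y]u$ with $\ell_y = \tfrac12 |K \cap (y+\mathbb{R}u)|_1$, and $S_uK\cap (y+\mathbb{R}u)=\emptyset$ for $y\in u^\perp \setminus P_{u^\perp}K$. For a function, $S_u f(x) := \int_0^\infty 1_{S_u\{f \ge t\}}(x)\,dt$. *)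

theory Defs
  imports "HOL-Analysis.Analysis"
begin

section \<open>Hausdorff measure\<close>

text \<open>
  The normalisation \<open>unit_ball_vol k / 2 ^ k\<close> makes the \<open>n\<close>-dimensional Hausdorff measure on an
  \<open>n\<close>-dimensional Euclidean space agree with Lebesgue measure. The empty set is treated separately
  so that it gets size \<open>0\<close> also for \<open>k = 0\<close>.
\<close>

definition hausdorff_gauge :: "nat \<Rightarrow> 'a::metric_space set \<Rightarrow> ennreal" where
  "hausdorff_gauge k E =
     (if E = {} then 0 else ennreal (unit_ball_vol (real k) * (diameter E / 2) ^ k))"

text \<open>
  Boundedness has to be required explicitly because \<^const>\<open>diameter\<close> is unspecified on
  unbounded sets.
\<close>

definition hausdorff_content :: "nat \<Rightarrow> real \<Rightarrow> 'a::metric_space set \<Rightarrow> ennreal" where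
  "hausdorff_content k \<delta> A =
     (INF E \<in> {E :: nat \<Rightarrow> 'a set. (\<forall>i. bounded (E i) \<and> diameter (E i) \<le> \<delta>) \<and> A \<subseteq> (\<Union>i. E i)}.
        \<Sum>i. hausdorff_gauge k (E i))"

definition hausdorff_outer :: "nat \<Rightarrow> 'a::metric_space set \<Rightarrow> ennreal" where
  "hausdorff_outer k A = (SUP \<delta> \<in> {0<..}. hausdorff_content k \<delta> A)"

definition hausdorff_measure :: "nat \<Rightarrow> 'a::metric_space measure" where
  "hausdorff_measure k = measure_of UNIV (sets borel) (hausdorff_outer k)"

text \<open>
  A \<^const>\<open>measure_of\<close> construction is the zero measure unless its argument is countably
  additive, so we check below that the Hausdorff outer measure is a measure on the Borel sets
  (Caratheodory's criterion for metric outer measures).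
\<close>

lemma hausdorff_outer_mono: "A \<subseteq> B \<Longrightarrow> hausdorff_outer k A \<le> hausdorff_outer k B"
  unfolding hausdorff_outer_def hausdorff_content_def
  by (intro SUP_mono' INF_superset_mono) auto

lemma hausdorff_outer_empty [simp]: "hausdorff_outer k {} = 0"
proof -
  have "hausdorff_content k \<delta> ({} :: 'a set) \<le> 0" if "\<delta> > 0" for \<delta>
    unfolding hausdorff_content_def
    using that by (intro INF_lower2[of "\<lambda>_. {}"]) (auto simp: hausdorff_gauge_def)
  then show ?thesis
    unfolding hausdorff_outer_def by (auto intro!: antisym SUP_least)
qed

lemma hausdorff_content_close:
  assumes "hausdorff_content k \<delta> A < e"
  obtains E where "\<And>i. bounded (E i)" "\<And>i. diameter (E i) \<le> \<delta>" "A \<subseteq> (\<Union>i. E i)"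
    "(\<Sum>i. hausdorff_gauge k (E i)) < e"
  using assms unfolding hausdorff_content_def INF_less_iff by blast

lemma hausdorff_content_le:
  assumes "\<And>i. bounded (E i)" "\<And>i. diameter (E i) \<le> \<delta>" "A \<subseteq> (\<Union>i. E i)"
  shows "hausdorff_content k \<delta> A \<le> (\<Sum>i::nat. hausdorff_gauge k (E i))"
  using assms unfolding hausdorff_content_def by (intro INF_lower) auto

lemma hausdorff_content_le_outer: "\<delta> > 0 \<Longrightarrow> hausdorff_content k \<delta> A \<le> hausdorff_outer k A"
  unfolding hausdorff_outer_def by (intro SUP_upper) auto

lemma hausdorff_content_countably_subadditive:
  "hausdorff_content k \<delta> (\<Union>i. A i) \<le> (\<Sum>n. hausdorff_content k \<delta> (A n))"
proof (rule ennreal_le_epsilon)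
  fix e :: real
  assume e: "0 < e" and fin: "(\<Sum>n. hausdorff_content k \<delta> (A n)) < top"
  let ?H = "hausdorff_content k \<delta>"
  have lt: "?H (A n) < ?H (A n) + ennreal (e * (1/2) ^ Suc n)" for n
    using e fin by (auto simp add: less_top dest!: ennreal_suminf_lessD)
  have "\<exists>B. (\<forall>i. bounded (B i) \<and> diameter (B i) \<le> \<delta>) \<and> A n \<subseteq> (\<Union>i. B i) \<and>
      (\<Sum>i. hausdorff_gauge k (B i)) \<le> ?H (A n) + ennreal (e * (1/2) ^ Suc n)" for n
    by (rule hausdorff_content_close[OF lt[of n]]) (metis order_less_imp_le)
  then obtain B where B: "\<And>n i. bounded (B n i)" "\<And>n i. diameter (B n i) \<le> \<delta>"
      "\<And>n. A n \<subseteq> (\<Union>i. B n i)"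
      "\<And>n. (\<Sum>i. hausdorff_gauge k (B n i)) \<le> ?H (A n) + ennreal (e * (1/2) ^ Suc n)"
    by metis
  define C where "C = case_prod B \<circ> prod_decode"
  have "(\<Union>i. A i) \<subseteq> (\<Union>i. C i)"
    using B(3) by (auto simp add: C_def subset_eq) (metis prod.case prod_encode_inverse)
  then have "?H (\<Union>i. A i) \<le> (\<Sum>i. hausdorff_gauge k (C i))"
    by (intro hausdorff_content_le) (auto simp: C_def B split: prod.split)
  also have "\<dots> = (\<Sum>n. \<Sum>i. hausdorff_gauge k (B n i))"
    unfolding C_def comp_def
    using suminf_ennreal_2dimen[of _ "\<lambda>p. hausdorff_gauge k (case_prod B p)"] by auto
  also have "\<dots> \<le> (\<Sum>n. ?H (A n) + ennreal (e * (1/2) ^ Suc n))"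
    by (intro suminf_le B allI) auto
  also have "\<dots> = (\<Sum>n. ?H (A n)) + (\<Sum>n. ennreal e * ennreal ((1/2) ^ Suc n))"
    using e by (subst suminf_add[symmetric])
               (auto simp del: ennreal_suminf_cmult simp add: ennreal_mult[symmetric])
  also have "\<dots> = (\<Sum>n. ?H (A n)) + e"
    unfolding ennreal_suminf_cmult
    by (subst suminf_ennreal_eq[OF zero_le_power power_half_series]) auto
  finally show "?H (\<Union>i. A i) \<le> (\<Sum>n. ?H (A n)) + e" .
qed

lemma hausdorff_outer_countably_subadditive:
  "hausdorff_outer k (\<Union>i. A i) \<le> (\<Sum>n. hausdorff_outer k (A n))"
proof -
  have "hausdorff_content k \<delta> (\<Union>i. A i) \<le> (\<Sum>n. hausdorff_outer k (A n))" if "\<delta> > 0" for \<delta>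
    using hausdorff_content_countably_subadditive[of k \<delta> A]
    by (rule order_trans) (auto intro!: suminf_le hausdorff_content_le_outer that)
  then show ?thesis
    unfolding hausdorff_outer_def[of _ "\<Union>i. A i"] by (auto intro!: SUP_least)
qed

lemma hausdorff_content_antimono: "\<delta> \<le> \<delta>' \<Longrightarrow> hausdorff_content k \<delta>' A \<le> hausdorff_content k \<delta> A"
  unfolding hausdorff_content_def by (intro INF_superset_mono) (auto intro: order_trans)

lemma hausdorff_content_separated:
  fixes A B :: "'a::metric_space set"
  assumes sep: "\<And>x y. x \<in> A \<Longrightarrow> y \<in> B \<Longrightarrow> dist x y > \<delta>"
  shows "hausdorff_content k \<delta> A + hausdorff_content k \<delta> B \<le> hausdorff_content k \<delta> (A \<union> B)"
  unfolding hausdorff_content_def[of k \<delta> "A \<union> B"]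
proof (rule INF_greatest, clarify)
  fix E :: "nat \<Rightarrow> 'a set"
  assume E: "\<forall>i. bounded (E i) \<and> diameter (E i) \<le> \<delta>" "A \<union> B \<subseteq> (\<Union>i. E i)"
  define EA where "EA i = (if E i \<inter> A = {} then {} else E i)" for i
  define EB where "EB i = (if E i \<inter> B = {} then {} else E i)" for i
  have excl: "E i \<inter> A = {} \<or> E i \<inter> B = {}" for i
  proof (rule ccontr)
    assume "\<not> ?thesis"
    then obtain x y where "x \<in> E i" "x \<in> A" "y \<in> E i" "y \<in> B" by blast
    then show False
      using sep[of x y] diameter_bounded_bound[of "E i" x y] E(1)
      by (meson less_le_not_le order_trans)
  qed
  have \<delta>: "diameter {} \<le> \<delta>"
    using E(1) diameter_ge_0 by (metis diameter_empty order_trans)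
  have "A \<subseteq> (\<Union>i. EA i)"
    using E(2) by (fastforce simp: EA_def)
  then have A: "hausdorff_content k \<delta> A \<le> (\<Sum>i. hausdorff_gauge k (EA i))"
    using E(1) \<delta> by (intro hausdorff_content_le) (auto simp: EA_def)
  have "B \<subseteq> (\<Union>i. EB i)"
    using E(2) by (fastforce simp: EB_def)
  then have B: "hausdorff_content k \<delta> B \<le> (\<Sum>i. hausdorff_gauge k (EB i))"
    using E(1) \<delta> by (intro hausdorff_content_le) (auto simp: EB_def)
  have "hausdorff_content k \<delta> A + hausdorff_content k \<delta> B \<le>
      (\<Sum>i. hausdorff_gauge k (EA i) + hausdorff_gauge k (EB i))"
    using add_mono[OF A B] by (simp add: suminf_add)
  also have "\<dots> \<le> (\<Sum>i. hausdorff_gauge k (E i))"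
    using excl by (intro suminf_le) (auto simp: EA_def EB_def hausdorff_gauge_def)
  finally show "hausdorff_content k \<delta> A + hausdorff_content k \<delta> B
      \<le> (\<Sum>i. hausdorff_gauge k (E i))" .
qed

lemma hausdorff_outer_separated:
  fixes A B :: "'a::metric_space set"
  assumes d: "d > 0" and sep: "\<And>x y. x \<in> A \<Longrightarrow> y \<in> B \<Longrightarrow> dist x y \<ge> d"
  shows "hausdorff_outer k A + hausdorff_outer k B \<le> hausdorff_outer k (A \<union> B)"
proof -
  have "hausdorff_content k \<delta> A + hausdorff_content k \<epsilon> B \<le> hausdorff_outer k (A \<union> B)"
    if "\<delta> > 0" "\<epsilon> > 0" for \<delta> \<epsilon>
  proof -
    define \<eta> where "\<eta> = min (d / 2) (min \<delta> \<epsilon>)"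
    have \<eta>: "\<eta> > 0" "\<eta> < d" "\<eta> \<le> \<delta>" "\<eta> \<le> \<epsilon>"
      using that d by (auto simp: \<eta>_def min_def)
    have "hausdorff_content k \<delta> A + hausdorff_content k \<epsilon> B
        \<le> hausdorff_content k \<eta> A + hausdorff_content k \<eta> B"
      using \<eta> by (intro add_mono hausdorff_content_antimono)
    also have "\<dots> \<le> hausdorff_content k \<eta> (A \<union> B)"
      using sep \<eta>(2) by (intro hausdorff_content_separated) (meson less_le_trans)
    also have "\<dots> \<le> hausdorff_outer k (A \<union> B)"
      using \<eta>(1) by (rule hausdorff_content_le_outer)
    finally show ?thesis .
  qed
  then have "hausdorff_content k \<delta> A + hausdorff_outer k B \<le> hausdorff_outer k (A \<union> B)"
    if "\<delta> > 0" for \<delta>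
    unfolding hausdorff_outer_def[of k B] using that
    by (subst ennreal_SUP_add_right) (auto intro!: SUP_least exI[of _ 1])
  then show ?thesis
    unfolding hausdorff_outer_def[of k A]
    by (subst ennreal_SUP_add_left[symmetric]) (auto intro!: SUP_least exI[of _ 1])
qed

lemma UN_case_nat: "(\<Union>i. case i of 0 \<Rightarrow> X | Suc j \<Rightarrow> Y j) = X \<union> (\<Union>j. Y j)"
  by (auto split: nat.splits)

lemma closed_hausdorff_measurable:
  fixes C :: "'a::metric_space set"
  assumes "closed C"
  shows "hausdorff_outer k (A \<inter> C) + hausdorff_outer k (A - C) \<le> hausdorff_outer k A"
proof (cases "C = {} \<or> hausdorff_outer k A = top")
  case False
  let ?H = "hausdorff_outer k :: 'a set \<Rightarrow> ennreal"
  have Cne: "C \<noteq> {}" and fin: "?H A < top"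
    using False by (auto simp: less_top)
  define a :: "nat \<Rightarrow> real" where "a n = inverse (real (Suc n))" for n
  have a_anti: "a j \<le> a i" if "i \<le> j" for i j
    using that by (simp add: a_def)
  have a_strict: "a (Suc i) < a i" for i
    by (simp add: a_def)
  define D where "D n = {x \<in> A. a n \<le> infdist x C}" for n
  define R where "R j = {x \<in> A. a (Suc j) \<le> infdist x C \<and> infdist x C < a j}" for j
  have par: "(\<Sum>i<n. ?H (R (2 * i + p))) \<le> ?H (\<Union>i<n. R (2 * i + p))" for n p
  proof (induction n)
    case (Suc n)
    show ?case
    proof (cases n)
      case 0
      then show ?thesis by (simp add: lessThan_Suc)
    next
      case (Suc m)
      have "?H (\<Union>i<n. R (2 * i + p)) + ?H (R (2 * n + p))
          \<le> ?H ((\<Union>i<n. R (2 * i + p)) \<union> R (2 * n + p))"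
      proof (rule hausdorff_outer_separated)
        let ?M = "2 * m + p"
        show "a (Suc ?M) - a (Suc (Suc ?M)) > 0"
          using a_strict by simp
        fix x y assume "x \<in> (\<Union>i<n. R (2 * i + p))" and y: "y \<in> R (2 * n + p)"
        then obtain i where i: "i \<le> m" "x \<in> R (2 * i + p)"
          using Suc by (auto simp: less_Suc_eq_le)
        have "infdist x C \<ge> a (Suc ?M)"
          using i a_anti[of "Suc (2 * i + p)" "Suc ?M"] by (auto simp: R_def)
        moreover have "infdist y C \<le> a (Suc (Suc ?M))"
          using y Suc by (auto simp: R_def)
        moreover have "infdist x C \<le> infdist y C + dist x y"
          by (rule infdist_triangle)
        ultimately show "a (Suc ?M) - a (Suc (Suc ?M)) \<le> dist x y"
          by simp
      qed
      moreover have "(\<Union>i<n. R (2 * i + p)) \<union> R (2 * n + p) = (\<Union>i<Suc n. R (2 * i + p))"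
        by (auto simp: less_Suc_eq)
      ultimately have "?H (\<Union>i<n. R (2 * i + p)) + ?H (R (2 * n + p)) \<le> ?H (\<Union>i<Suc n. R (2 * i + p))"
        by argo
      with add_right_mono[OF Suc.IH, of "?H (R (2 * n + p))"] show ?thesis
        unfolding sum.lessThan_Suc by (rule order_trans)
    qed
  qed simp
  have par': "(\<Sum>i. ?H (R (2 * i + p))) \<le> ?H A" for p
  proof (rule suminf_le_const)
    show "(\<Sum>i<n. ?H (R (2 * i + p))) \<le> ?H A" for n
      by (rule order_trans[OF par]) (auto intro!: hausdorff_outer_mono simp: R_def)
  qed simp
  have "(\<Sum>j<n. ?H (R j)) \<le> ?H A + ?H A" for n
  proof -
    have "(\<Sum>j<n. ?H (R j)) \<le> (\<Sum>j<2 * n. ?H (R j))"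
      by (rule sum_mono2) auto
    also have "\<dots> = (\<Sum>i<n. ?H (R (2 * i + 0))) + (\<Sum>i<n. ?H (R (2 * i + 1)))"
      by (induction n) (auto simp: ac_simps)
    also have "\<dots> \<le> (\<Sum>i. ?H (R (2 * i + 0))) + (\<Sum>i. ?H (R (2 * i + 1)))"
      by (intro add_mono sum_le_suminf) auto
    also have "\<dots> \<le> ?H A + ?H A"
      by (intro add_mono par')
    finally show ?thesis .
  qed
  then have "(\<Sum>j. ?H (R j)) \<le> ?H A + ?H A"
    by (intro suminf_le_const) auto
  then have Rfin: "(\<Sum>j. ?H (R j)) < top"
    using fin by (metis ennreal_add_less_top le_less_trans)
  show ?thesis
  proof (rule ennreal_le_epsilon)
    fix e :: real assume e: "0 < e"
    have "(\<lambda>n. \<Sum>j<n. ?H (R j)) \<longlonglongrightarrow> (\<Sum>j. ?H (R j))"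
      by (rule summable_LIMSEQ) simp
    then have "(\<lambda>n. (\<Sum>j<n. ?H (R j)) + ennreal e) \<longlonglongrightarrow> (\<Sum>j. ?H (R j)) + ennreal e"
      by (intro tendsto_add) auto
    moreover have "(\<Sum>j. ?H (R j)) < (\<Sum>j. ?H (R j)) + ennreal e"
      using Rfin e by (simp add: less_top)
    ultimately have "\<forall>\<^sub>F n in sequentially. (\<Sum>j. ?H (R j)) < (\<Sum>j<n. ?H (R j)) + ennreal e"
      by (rule order_tendstoD(1))
    then obtain n where n: "(\<Sum>j. ?H (R j)) < (\<Sum>j<n. ?H (R j)) + ennreal e"
      by (auto simp: eventually_sequentially)
    have "(\<Sum>j. ?H (R j)) = (\<Sum>j. ?H (R (j + n))) + (\<Sum>j<n. ?H (R j))"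
      by (rule suminf_offset) simp
    with n have "(\<Sum>j<n. ?H (R j)) + (\<Sum>j. ?H (R (j + n))) \<le> (\<Sum>j<n. ?H (R j)) + ennreal e"
      by (metis add.commute order_less_imp_le)
    moreover have "(\<Sum>j<n. ?H (R j)) \<noteq> top"
    proof -
      have "(\<Sum>j<n. ?H (R j)) \<le> (\<Sum>j. ?H (R j))"
        by (rule sum_le_suminf) auto
      then have "(\<Sum>j<n. ?H (R j)) < top"
        using Rfin by (rule le_less_trans)
      then show ?thesis
        by (rule less_imp_neq)
    qed
    ultimately have tail: "(\<Sum>j. ?H (R (j + n))) \<le> ennreal e"
      by (simp only: ennreal_add_left_cancel_le infinity_ennreal_def) blast
    have "A - C \<subseteq> D n \<union> (\<Union>j. R (j + n))"
    proof
      fix x assume x: "x \<in> A - C"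
      then have pos: "infdist x C > 0"
        using assms Cne in_closed_iff_infdist_zero[of C x] infdist_nonneg[of x C] by auto
      then obtain m where m: "a m < infdist x C"
        using reals_Archimedean unfolding a_def by blast
      define l where "l = (LEAST l. a l \<le> infdist x C)"
      have l: "a l \<le> infdist x C"
        unfolding l_def by (rule LeastI[of _ m]) (use m in simp)
      have l': "\<not> a i \<le> infdist x C" if "i < l" for i
        using not_less_Least that unfolding l_def by blast
      show "x \<in> D n \<union> (\<Union>j. R (j + n))"
      proof (cases "l \<le> n")
        case True
        then have "x \<in> D n"
          using x l a_anti[OF True] by (auto simp: D_def)
        then show ?thesis by simp
      next
        case False
        then obtain j where j: "l = Suc (j + n)"
          by (metis add.commute less_imp_Suc_add not_le_imp_less)
        have "x \<in> R (j + n)"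
          using x l l'[of "j + n"] by (auto simp: R_def j)
        then show ?thesis by auto
      qed
    qed
    then have "?H (A - C) \<le> ?H (D n \<union> (\<Union>j. R (j + n)))"
      by (rule hausdorff_outer_mono)
    also have "\<dots> = ?H (\<Union>i. case i of 0 \<Rightarrow> D n | Suc j \<Rightarrow> R (j + n))"
      by (simp only: UN_case_nat)
    also have "\<dots> \<le> (\<Sum>i. ?H (case i of 0 \<Rightarrow> D n | Suc j \<Rightarrow> R (j + n)))"
      by (rule hausdorff_outer_countably_subadditive)
    also have "\<dots> = (\<Sum>j. ?H (R (j + n))) + ?H (D n)"
      using suminf_offset[of "\<lambda>i. ?H (case i of 0 \<Rightarrow> D n | Suc j \<Rightarrow> R (j + n))" 1] by simp
    also have "\<dots> \<le> ennreal e + ?H (D n)"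
      using tail by (rule add_right_mono)
    finally have 1: "?H (A - C) \<le> ennreal e + ?H (D n)" .
    have "?H (A \<inter> C) + ?H (D n) \<le> ?H (A \<inter> C \<union> D n)"
    proof (rule hausdorff_outer_separated)
      show "a n > 0" by (simp add: a_def)
      fix x y assume "x \<in> A \<inter> C" "y \<in> D n"
      then show "a n \<le> dist x y"
        using infdist_le[of x C y] by (auto simp: D_def dist_commute)
    qed
    also have "\<dots> \<le> ?H A"
      by (rule hausdorff_outer_mono) (auto simp: D_def)
    finally have 2: "?H (A \<inter> C) + ?H (D n) \<le> ?H A" .
    have "?H (A \<inter> C) + ?H (A - C) \<le> ?H (A \<inter> C) + ?H (D n) + ennreal e"
      using add_left_mono[OF 1] by (simp add: ac_simps)
    also have "\<dots> \<le> ?H A + ennreal e"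
      using 2 by (rule add_right_mono)
    finally show "?H (A \<inter> C) + ?H (A - C) \<le> ?H A + ennreal e" .
  qed
qed auto

lemma measure_space_hausdorff:
  "measure_space UNIV (sets borel) (hausdorff_outer k :: 'a::metric_space set \<Rightarrow> ennreal)"
proof -
  let ?H = "hausdorff_outer k :: 'a set \<Rightarrow> ennreal"
  let ?L = "lambda_system UNIV (Pow UNIV) ?H"
  have "outer_measure_space (Pow UNIV) ?H"
    by (auto simp: outer_measure_space_def positive_def increasing_def countably_subadditive_def
        intro: hausdorff_outer_mono hausdorff_outer_countably_subadditive)
  then have L: "measure_space UNIV ?L ?H"
    by (rule sigma_algebra.caratheodory_lemma[OF sigma_algebra_Pow])
  have "C \<in> ?L" if "closed C" for C
  proof -
    have "?H (C \<inter> x) + ?H (- C \<inter> x) = ?H x" for x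
    proof (rule antisym)
      show "?H (C \<inter> x) + ?H (- C \<inter> x) \<le> ?H x"
        using closed_hausdorff_measurable[OF that, of k x] by (simp add: Int_commute Diff_eq)
      have "?H x \<le> ?H (\<Union>i. case i of 0 \<Rightarrow> C \<inter> x | Suc j \<Rightarrow> case j of 0 \<Rightarrow> - C \<inter> x | _ \<Rightarrow> {})"
        by (rule hausdorff_outer_mono) (unfold UN_case_nat, auto)
      also have "\<dots> \<le> (\<Sum>i. ?H (case i of 0 \<Rightarrow> C \<inter> x | Suc j \<Rightarrow> case j of 0 \<Rightarrow> - C \<inter> x | _ \<Rightarrow> {}))"
        by (rule hausdorff_outer_countably_subadditive)
      also have "\<dots> = (\<Sum>i<2. ?H (case i of 0 \<Rightarrow> C \<inter> x | Suc j \<Rightarrow> case j of 0 \<Rightarrow> - C \<inter> x | _ \<Rightarrow> {}))"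
        by (rule suminf_finite) (auto split: nat.split)
      also have "\<dots> = ?H (C \<inter> x) + ?H (- C \<inter> x)"
        by (simp add: numeral_2_eq_2)
      finally show "?H x \<le> ?H (C \<inter> x) + ?H (- C \<inter> x)" .
    qed
    then show ?thesis
      by (simp add: lambda_system_def Compl_eq_Diff_UNIV)
  qed
  then have "sigma_sets UNIV (Collect closed) \<subseteq> ?L"
    using L by (intro sigma_algebra.sigma_sets_subset) (auto simp: measure_space_def)
  then have sub: "sets borel \<subseteq> ?L"
    by (simp add: borel_eq_closed)
  have "countably_additive (sets borel) ?H"
    using L sub unfolding measure_space_def countably_additive_def
    by (meson order_trans subsetD)
  then show ?thesis
    using sets.sigma_algebra_axioms[of "borel :: 'a measure"]
    by (auto simp: measure_space_def positive_def)
qed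

lemma sets_hausdorff_measure [simp, measurable_cong]: "sets (hausdorff_measure k) = sets borel"
  unfolding hausdorff_measure_def using sets.sigma_sets_eq[of borel] by simp

lemma space_hausdorff_measure [simp]: "space (hausdorff_measure k) = UNIV"
  unfolding hausdorff_measure_def by simp

lemma emeasure_hausdorff_measure:
  "A \<in> sets borel \<Longrightarrow> emeasure (hausdorff_measure k) A = hausdorff_outer k A"
  using measure_space_hausdorff[of k] unfolding hausdorff_measure_def measure_space_def
  by (subst emeasure_measure_of_sigma) auto


section \<open>Intersection bodies and Steiner symmetrization\<close>

text \<open>
  For \<open>\<theta>\<close> in the unit sphere, \<open>{\<theta>}\<^sup>\<bottom>\<close> is the hyperplane orthogonal to \<open>\<theta>\<close>; the radial function
  is the integral over it with respect to the Hausdorff measure of codimension one.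
\<close>

definition intersection_radial :: "('a::euclidean_space \<Rightarrow> real) \<Rightarrow> 'a \<Rightarrow> real" where
  "intersection_radial g \<theta> = (LINT y : {\<theta>}\<^sup>\<bottom> | hausdorff_measure (DIM('a) - 1). g y)"

definition intersection_body :: "('a::euclidean_space \<Rightarrow> real) \<Rightarrow> 'a set" where
  "intersection_body g = {r *\<^sub>R \<theta> | r \<theta>. \<theta> \<in> sphere 0 1 \<and> 0 \<le> r \<and> r \<le> intersection_radial g \<theta>}"

definition line_in_direction :: "'a::euclidean_space \<Rightarrow> 'a \<Rightarrow> 'a set" where
  "line_in_direction u y = range (\<lambda>s. y + s *\<^sub>R u)"

text \<open>The orthogonal projection onto \<open>{u}\<^sup>\<bottom>\<close>, for a unit vector \<open>u\<close>.\<close>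

definition proj_perp :: "'a::euclidean_space \<Rightarrow> 'a \<Rightarrow> 'a" where
  "proj_perp u x = x - (x \<bullet> u) *\<^sub>R u"

definition steiner_set :: "'a::euclidean_space \<Rightarrow> 'a set \<Rightarrow> 'a set" where
  "steiner_set u K = {y + s *\<^sub>R u | y s. y \<in> proj_perp u ` K \<and>
     \<bar>s\<bar> \<le> enn2real (hausdorff_outer 1 (K \<inter> line_in_direction u y)) / 2}"

text \<open>
  The layer-cake integral is taken over \<open>t > 0\<close>, where the superlevel sets of a compactly supported
  continuous function are compact; the omitted value \<open>t = 0\<close> is a null set.
\<close>

definition steiner_fun :: "'a::euclidean_space \<Rightarrow> ('a \<Rightarrow> real) \<Rightarrow> 'a \<Rightarrow> real" where
  "steiner_fun u f x = (LINT t : {0<..} | lborel. indicator (steiner_set u {z. f z \<ge> t}) x)"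

end

theory Submission
  imports Defs
begin

text \<open>
  Fix \<open>u\<close> and parametrize the hyperplanes not containing \<open>u\<close> as the graphs \<open>{y - (y \<bullet> a) u}\<close> over
  \<open>u\<^sup>\<bottom>\<close>, with \<open>a \<in> u\<^sup>\<bottom>\<close>. The Jacobians of the measure on the graph and of the polar coordinates
  cancel, so that up to a constant
  \[ |I(g)| = \int_{u^\perp} \Big( \int_{u^\perp} g(y - (y \cdot a) u) \, dy \Big)^n da. \]
  Writing \<open>g\<close> as an integral of indicators of superlevel sets and expanding the power, one gets an
  integral over \<open>y\<^sub>1, \<dots>, y\<^sub>n\<close> of terms \<open>\<integral> \<Prod>\<^sub>i 1\<^bsub>A\<^sub>i\<^esub>(a \<bullet> y\<^sub>i) da\<close>, where \<open>A\<^sub>i\<close> is the section of a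
  superlevel set along the line through \<open>y\<^sub>i\<close>. Steiner symmetrization replaces every \<open>A\<^sub>i\<close> by the
  centered interval of the same length, which increases each term: almost surely \<open>n - 1\<close> of the
  vectors \<open>y\<^sub>i\<close> are a basis of \<open>u\<^sup>\<bottom>\<close>, and in the dual coordinates this follows by iterating the
  one-dimensional Riesz rearrangement inequality.
\<close>

section \<open>Hausdorff measure and Lebesgue measure\<close>

text \<open>Above dimension one, \<open>hausdorff_outer\<close> is compared with Lebesgue measure
  only up to a factor: invariance gives proportionality, and both sides of the theorem carry the
  same factor. On lines the factor is shown to be 1, because the lengths of line sections enter the
  Steiner symmetral itself. The power n arises as follows. Let \<Phi>(a) be the inner integral of
  the overview. For s \<noteq> 0 and y orthogonal to u, the point y + s u belongs to I(g) exactly if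
  |s| \<le> \<Phi>(y / s). Substituting y = s a costs the factor |s|^(n - 1), and integrating it
  over |s| \<le> \<Phi>(a) leaves a multiple of \<Phi>(a)^n. Continuous functions and compact sets
  are treated together: the main argument asks for a non-negative bounded Borel function with
  bounded support whose superlevel sets at positive levels are compact, and indicators of compact
  sets are of this kind.\<close>

lemma sigma_finite_borelI:
  fixes N :: "'a::euclidean_space measure"
  assumes sets: "sets N = sets borel" and fin: "\<And>r. emeasure N (cball 0 r) < \<infinity>"
  shows "sigma_finite_measure N"
proof
  have "x \<in> (\<Union>n::nat. cball 0 (real n))" for x :: 'a
    using real_arch_simple[of "norm x"] by auto
  then show "\<exists>A. countable A \<and> A \<subseteq> sets N \<and> \<Union> A = space N \<and> (\<forall>a\<in>A. emeasure N a \<noteq> \<infinity>)"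
    using fin sets sets_eq_imp_space_eq[OF sets]
    by (intro exI[of _ "range (\<lambda>n::nat. cball 0 (real n))"]) (auto simp: less_top)
qed

lemma nn_integral_lborel_translate:
  fixes f :: "'a::euclidean_space \<Rightarrow> ennreal"
  assumes [measurable]: "f \<in> borel_measurable borel"
  shows "(\<integral>\<^sup>+x. f (z + x) \<partial>lborel) = (\<integral>\<^sup>+x. f x \<partial>lborel)"
  by (subst (2) lborel_distr_plus[of z, symmetric]) (simp add: nn_integral_distr)

lemma nn_integral_lborel_scale:
  fixes f :: "'a::euclidean_space \<Rightarrow> ennreal"
  assumes [measurable]: "f \<in> borel_measurable borel" and "c \<noteq> 0"
  shows "(\<integral>\<^sup>+x. f x \<partial>lborel) = ennreal (\<bar>c\<bar> ^ DIM('a)) * (\<integral>\<^sup>+x. f (c *\<^sub>R x) \<partial>lborel)"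
  by (subst lborel_affine[OF assms(2), of 0])
     (simp add: nn_integral_density nn_integral_distr nn_integral_cmult)

lemma nn_integral_lborel_minus:
  fixes f :: "'a::euclidean_space \<Rightarrow> ennreal"
  assumes [measurable]: "f \<in> borel_measurable borel"
  shows "(\<integral>\<^sup>+x. f (z - x) \<partial>lborel) = (\<integral>\<^sup>+x. f x \<partial>lborel)"
proof -
  have "(\<integral>\<^sup>+x. f x \<partial>lborel) = (\<integral>\<^sup>+x. f (z + x) \<partial>lborel)"
    by (simp add: nn_integral_lborel_translate)
  also have "\<dots> = (\<integral>\<^sup>+x. f (z - x) \<partial>lborel)"
    using nn_integral_lborel_scale[of "\<lambda>x. f (z + x)" "-1"] by simp
  finally show ?thesis ..
qed

text \<open>The usual Fubini argument for the uniqueness of Haar measure.\<close>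

lemma translation_invariant_eq_lborel:
  fixes N :: "'a::euclidean_space measure"
  assumes sets: "sets N = sets borel" and fin: "\<And>r. emeasure N (cball 0 r) < \<infinity>"
    and inv: "\<And>z E. E \<in> sets borel \<Longrightarrow> emeasure N ((\<lambda>x. z + x) -` E) = emeasure N E"
    and E: "E \<in> sets borel"
  shows "emeasure N E = emeasure N (cbox 0 One) * emeasure lborel E"
proof -
  interpret N: sigma_finite_measure N
    using sets fin by (rule sigma_finite_borelI)
  interpret NL: pair_sigma_finite N lborel ..
  note [measurable_cong] = sets
  let ?F = "cbox 0 One :: 'a set"
  have sp: "space N = UNIV"
    using sets_eq_imp_space_eq[OF sets] by simp
  have dist: "distr N borel (\<lambda>x. z + x) = N" for z
    using inv sets by (intro measure_eqI) (auto simp: emeasure_distr sp)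
  have tr: "(\<integral>\<^sup>+x. g (z + x) \<partial>N) = (\<integral>\<^sup>+x. g x \<partial>N)"
    if [measurable]: "g \<in> borel_measurable borel" for g :: "'a \<Rightarrow> ennreal" and z
    by (subst (2) dist[of z, symmetric]) (simp add: nn_integral_distr)
  have [measurable]: "E \<in> sets borel" by fact
  have "emeasure N E * emeasure lborel ?F =
      (\<integral>\<^sup>+x. indicator E x * (\<integral>\<^sup>+y. indicator ?F (x + y) \<partial>lborel) \<partial>N)"
    using sets by (simp add: nn_integral_lborel_translate nn_integral_multc E)
  also have "\<dots> = (\<integral>\<^sup>+x. \<integral>\<^sup>+y. indicator E x * indicator ?F (x + y) \<partial>lborel \<partial>N)"
    by (simp add: nn_integral_cmult)
  also have "\<dots> = (\<integral>\<^sup>+y. \<integral>\<^sup>+x. indicator E x * indicator ?F (x + y) \<partial>N \<partial>lborel)"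
    by (rule NL.Fubini'[symmetric]) simp
  also have "\<dots> = (\<integral>\<^sup>+y. \<integral>\<^sup>+x. indicator E (x - y) * indicator ?F x \<partial>N \<partial>lborel)"
  proof (rule nn_integral_cong)
    fix y :: 'a
    show "(\<integral>\<^sup>+x. indicator E x * indicator ?F (x + y) \<partial>N) =
        (\<integral>\<^sup>+x. indicator E (x - y) * indicator ?F x \<partial>N)"
      using tr[of "\<lambda>x. indicator E (x - y) * indicator ?F x" y] by (simp add: add.commute)
  qed
  also have "\<dots> = (\<integral>\<^sup>+x. \<integral>\<^sup>+y. indicator E (x - y) * indicator ?F x \<partial>lborel \<partial>N)"
    by (rule NL.Fubini') simp
  also have "\<dots> = (\<integral>\<^sup>+x. emeasure lborel E * indicator ?F x \<partial>N)"
    by (simp add: nn_integral_multc nn_integral_lborel_minus E)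
  also have "\<dots> = emeasure N ?F * emeasure lborel E"
    using sets by (simp add: nn_integral_cmult mult.commute)
  finally show ?thesis
    by (simp add: emeasure_lborel_cbox_eq)
qed

section \<open>Isometries, finiteness and proportionality to Lebesgue measure\<close>

lemma hausdorff_gauge_mono:
  assumes "bounded F" "E \<subseteq> F" shows "hausdorff_gauge k E \<le> hausdorff_gauge k F"
  using assms diameter_subset[OF assms(2,1)] diameter_ge_0[of E] bounded_subset[OF assms]
  by (auto simp: hausdorff_gauge_def intro!: ennreal_leI mult_left_mono power_mono)

text \<open>The map need not be onto: a cover of the image pulls back to a cover of \<open>A\<close>
  whose members have no larger diameter. This allows a line to be measured through its
  parametrization by the reals.\<close>

lemma hausdorff_outer_isometry:
  fixes j :: "'a::real_normed_vector \<Rightarrow> 'b::real_normed_vector"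
  assumes j: "\<And>x y. dist (j x) (j y) = dist x y"
  shows "hausdorff_outer k (j ` A) = hausdorff_outer k A"
proof -
  have diam_im: "diameter (j ` E) = diameter E" for E
  proof -
    have "case_prod dist ` (j ` E \<times> j ` E) = case_prod dist ` (E \<times> E)"
      by (force simp: image_iff j)
    then show ?thesis by (simp add: diameter_def)
  qed
  have bd_im: "bounded (j ` E) = bounded E" for E
    unfolding bounded_two_points by (auto simp: j)
  have im_vim: "j ` (j -` E) \<subseteq> E" for E by auto
  have bd_vim: "bounded (j -` E)" if "bounded E" for E
    using bounded_subset[OF that im_vim] bd_im by blast
  have g_im: "hausdorff_gauge k (j ` E) = hausdorff_gauge k E" for E
    by (simp add: hausdorff_gauge_def diam_im)
  have g_vim: "hausdorff_gauge k (j -` E) \<le> hausdorff_gauge k E" if "bounded E" for E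
    using hausdorff_gauge_mono[OF that im_vim, of k] by (metis g_im)
  have "hausdorff_content k \<delta> (j ` A) = hausdorff_content k \<delta> A" for \<delta>
  proof (rule antisym)
    show "hausdorff_content k \<delta> (j ` A) \<le> hausdorff_content k \<delta> A"
      unfolding hausdorff_content_def[of k \<delta> A]
    proof (rule INF_greatest, clarify)
      fix E :: "nat \<Rightarrow> 'a set"
      assume E: "\<forall>i. bounded (E i) \<and> diameter (E i) \<le> \<delta>" "A \<subseteq> (\<Union>i. E i)"
      then have "j ` A \<subseteq> (\<Union>i. j ` E i)" by blast
      then have "hausdorff_content k \<delta> (j ` A) \<le> (\<Sum>i. hausdorff_gauge k (j ` E i))"
        using E(1) by (intro hausdorff_content_le) (auto simp: diam_im bd_im)
      then show "hausdorff_content k \<delta> (j ` A) \<le> (\<Sum>i. hausdorff_gauge k (E i))"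
        by (simp add: g_im)
    qed
    show "hausdorff_content k \<delta> A \<le> hausdorff_content k \<delta> (j ` A)"
      unfolding hausdorff_content_def[of k \<delta> "j ` A"]
    proof (rule INF_greatest, clarify)
      fix E :: "nat \<Rightarrow> 'b set"
      assume E: "\<forall>i. bounded (E i) \<and> diameter (E i) \<le> \<delta>" "j ` A \<subseteq> (\<Union>i. E i)"
      have "diameter (j -` E i) \<le> \<delta>" for i
        using diameter_subset[OF im_vim, of "E i"] E(1) diam_im order_trans by metis
      then have "hausdorff_content k \<delta> A \<le> (\<Sum>i. hausdorff_gauge k (j -` E i))"
        using E by (intro hausdorff_content_le) (force simp: bd_vim)+
      also have "\<dots> \<le> (\<Sum>i. hausdorff_gauge k (E i))"
        using E by (intro suminf_le g_vim) auto
      finally show "hausdorff_content k \<delta> A \<le> (\<Sum>i. hausdorff_gauge k (E i))" .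
    qed
  qed
  then show ?thesis by (simp add: hausdorff_outer_def)
qed

text \<open>A finite cover is padded with empty sets to a sequence. These have gauge 0 and diameter
  0, whence \<open>\<delta> \<ge> 0\<close>.\<close>

lemma hausdorff_content_le_finite:
  fixes E :: "'i \<Rightarrow> 'a::metric_space set"
  assumes I: "finite I" and "\<delta> \<ge> 0"
    and E: "\<And>i. i \<in> I \<Longrightarrow> bounded (E i)" "\<And>i. i \<in> I \<Longrightarrow> diameter (E i) \<le> \<delta>" "A \<subseteq> (\<Union>i\<in>I. E i)"
  shows "hausdorff_content k \<delta> A \<le> (\<Sum>i\<in>I. hausdorff_gauge k (E i))"
proof -
  obtain h where h: "bij_betw h {0..<card I} I"
    using ex_bij_betw_nat_finite[OF I] by blast
  define F where "F n = (if n < card I then E (h n) else {})" for n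
  have hI: "h n \<in> I" if "n < card I" for n
    using h that by (auto simp: bij_betw_def)
  have "A \<subseteq> (\<Union>n. F n)"
  proof
    fix x assume "x \<in> A"
    then obtain i where i: "i \<in> I" "x \<in> E i" using E(3) by blast
    then obtain n where "n < card I" "i = h n"
      using bij_betw_imp_surj_on[OF h] by (metis imageE atLeastLessThan_iff)
    then have "x \<in> F n" using i by (simp add: F_def)
    then show "x \<in> (\<Union>n. F n)" by blast
  qed
  then have "hausdorff_content k \<delta> A \<le> (\<Sum>n. hausdorff_gauge k (F n))"
    using hI E assms(2) by (intro hausdorff_content_le) (auto simp: F_def)
  also have "\<dots> = (\<Sum>n\<in>{0..<card I}. hausdorff_gauge k (F n))"
    by (rule suminf_finite) (auto simp: F_def hausdorff_gauge_def)
  also have "\<dots> = (\<Sum>n\<in>{0..<card I}. hausdorff_gauge k (E (h n)))"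
    by (rule sum.cong) (auto simp: F_def)
  also have "\<dots> = (\<Sum>i\<in>I. hausdorff_gauge k (E i))"
    by (rule sum.reindex_bij_betw[OF h])
  finally show ?thesis .
qed

text \<open>A flat box in the coordinate subspace spanned by \<open>S\<close> is cut into a grid of
  small cubes. Applied to \<open>Basis\<close> and to \<open>Basis\<close> without one vector, it
  makes the measures on the space and on a hyperplane finite on balls.\<close>

lemma hausdorff_outer_box_finite:
  fixes S :: "'a::euclidean_space set" and R :: real
  assumes S: "S \<subseteq> Basis" and R: "R > 0"
  shows "hausdorff_outer (card S) {x. (\<forall>b\<in>S. \<bar>x \<bullet> b\<bar> \<le> R) \<and> (\<forall>b\<in>Basis - S. x \<bullet> b = 0)} < \<infinity>"
    (is "hausdorff_outer _ ?A < _")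
proof -
  let ?d = "real (DIM('a))" and ?k = "card S"
  have finS: "finite S" by (rule finite_subset[OF S finite_Basis])
  \<comment> \<open>There are \<open>N ^ ?k\<close> cells, each of gauge at most
    \<open>unit_ball_vol ?k * (?d * R / N) ^ ?k\<close>, so \<open>N\<close> cancels. The factor
    \<open>?d\<close> comes from bounding the Euclidean norm by the sum of the coordinates.\<close>
  let ?C = "unit_ball_vol ?k * (?d * R) ^ ?k"
  have "hausdorff_content ?k \<delta> ?A \<le> ennreal ?C" if \<delta>: "\<delta> > 0" for \<delta>
  proof -
    obtain N :: nat where N: "N > 0" "?d * (2 * R) / N \<le> \<delta>"
    proof -
      obtain N :: nat where "?d * (2 * R) / \<delta> < N" using reals_Archimedean2 by blast
      moreover have "?d * (2 * R) / \<delta> > 0" using \<delta> R by (simp add: DIM_positive)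
      ultimately have "real N > 0" by linarith
      moreover from \<open>?d * (2 * R) / \<delta> < N\<close> have "?d * (2 * R) / N \<le> \<delta>"
        using \<delta> \<open>real N > 0\<close> by (simp add: field_simps)
      ultimately show ?thesis using that by simp
    qed
    define E where "E \<kappa> = {x::'a. (\<forall>b\<in>S. -R + 2 * R * real (\<kappa> b) / N \<le> x \<bullet> b \<and>
        x \<bullet> b \<le> -R + 2 * R * (real (\<kappa> b) + 1) / N) \<and> (\<forall>b\<in>Basis - S. x \<bullet> b = 0)}" for \<kappa> :: "'a \<Rightarrow> nat"
    let ?I = "S \<rightarrow>\<^sub>E {..<N}"
    have I: "finite ?I" using finS by (simp add: finite_PiE)
    have nrm: "norm (x - y) \<le> ?d * (2 * R) / N" if "x \<in> E \<kappa>" "y \<in> E \<kappa>" for x y \<kappa>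
    proof -
      have "\<bar>(x - y) \<bullet> b\<bar> \<le> 2 * R / N" if b: "b \<in> Basis" for b
      proof (cases "b \<in> S")
        case True
        with \<open>x \<in> E \<kappa>\<close> \<open>y \<in> E \<kappa>\<close>
        have "-R + 2 * R * real (\<kappa> b) / N \<le> x \<bullet> b" "x \<bullet> b \<le> -R + 2 * R * (real (\<kappa> b) + 1) / N"
          "-R + 2 * R * real (\<kappa> b) / N \<le> y \<bullet> b" "y \<bullet> b \<le> -R + 2 * R * (real (\<kappa> b) + 1) / N"
          by (auto simp: E_def)
        moreover have "2 * R * (real (\<kappa> b) + 1) / N = 2 * R * real (\<kappa> b) / N + 2 * R / N"
          by (simp add: add_divide_distrib algebra_simps)
        ultimately show ?thesis by (simp add: inner_diff_left abs_le_iff)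
      next
        case False
        then show ?thesis using that \<open>x \<in> E \<kappa>\<close> \<open>y \<in> E \<kappa>\<close> R by (auto simp: E_def inner_diff_left)
      qed
      then have "(\<Sum>b\<in>Basis. \<bar>(x - y) \<bullet> b\<bar>) \<le> of_nat DIM('a) * (2 * R / N)"
        by (rule sum_bounded_above)
      then show ?thesis using norm_le_l1[of "x - y"] by simp
    qed
    have bd: "bounded (E \<kappa>)" for \<kappa>
      unfolding bounded_two_points dist_norm using nrm by blast
    have dm: "diameter (E \<kappa>) \<le> ?d * (2 * R) / N" for \<kappa>
      by (rule diameter_le) (use nrm R in auto)
    have "?A \<subseteq> (\<Union>\<kappa>\<in>?I. E \<kappa>)"
    proof
      fix x assume x: "x \<in> ?A"
      define t where "t b = (x \<bullet> b + R) * N / (2 * R)" for b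
      \<comment> \<open>The minimum puts the right end point \<open>t b = N\<close> into the last
        cell.\<close>
      define \<kappa> where "\<kappa> = (\<lambda>b\<in>S. min (nat \<lfloor>t b\<rfloor>) (N - 1))"
      have "\<kappa> \<in> ?I" using N by (auto simp: \<kappa>_def)
      moreover have "x \<in> E \<kappa>"
      proof -
        have "-R + 2 * R * real (\<kappa> b) / N \<le> x \<bullet> b \<and> x \<bullet> b \<le> -R + 2 * R * (real (\<kappa> b) + 1) / N"
          if b: "b \<in> S" for b
        proof -
          have xb: "-R \<le> x \<bullet> b" "x \<bullet> b \<le> R" using x b by auto
          have "(x \<bullet> b + R) * N \<le> (2 * R) * N"
            using xb by (intro mult_right_mono) auto
          then have t0: "0 \<le> t b" "t b \<le> N" using R xb by (simp_all add: t_def pos_divide_le_eq mult.commute)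
          have "real (\<kappa> b) \<le> t b"
            using b of_nat_floor[OF t0(1)] by (auto simp: \<kappa>_def intro: order_trans[rotated])
          moreover have "t b \<le> real (\<kappa> b) + 1"
            using b t0 N by (auto simp: \<kappa>_def min_def of_nat_diff)
          moreover have "x \<bullet> b = -R + 2 * R * t b / N"
            using R N by (simp add: t_def field_simps)
          ultimately show ?thesis using R N by (simp add: divide_right_mono mult_left_mono)
        qed
        then show ?thesis using x by (auto simp: E_def)
      qed
      ultimately show "x \<in> (\<Union>\<kappa>\<in>?I. E \<kappa>)" by blast
    qed
    then have "hausdorff_content ?k \<delta> ?A \<le> (\<Sum>\<kappa>\<in>?I. hausdorff_gauge ?k (E \<kappa>))"
      using I \<delta> bd order_trans[OF dm N(2)] by (intro hausdorff_content_le_finite) auto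
    also have "\<dots> \<le> (\<Sum>\<kappa>\<in>?I. ennreal (unit_ball_vol ?k * (?d * R / N) ^ ?k))"
    proof (intro sum_mono)
      fix \<kappa>
      have "diameter (E \<kappa>) / 2 \<le> ?d * R / N" using dm[of \<kappa>] by (simp add: mult_ac)
      moreover have "0 \<le> diameter (E \<kappa>)" using bd diameter_ge_0 by blast
      ultimately have "unit_ball_vol ?k * (diameter (E \<kappa>) / 2) ^ ?k \<le> unit_ball_vol ?k * (?d * R / N) ^ ?k"
        by (intro mult_left_mono power_mono) auto
      then show "hausdorff_gauge ?k (E \<kappa>) \<le> ennreal (unit_ball_vol ?k * (?d * R / N) ^ ?k)"
        by (auto simp: hausdorff_gauge_def intro: ennreal_leI)
    qed
    also have "\<dots> = ennreal (N ^ ?k * (unit_ball_vol ?k * (?d * R / N) ^ ?k))"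
      using finS by (simp add: card_PiE ennreal_mult' ennreal_of_nat_eq_real_of_nat ennreal_power)
    also have "N ^ ?k * (unit_ball_vol ?k * (?d * R / N) ^ ?k) = ?C"
      using N by (simp add: power_divide)
    finally show ?thesis .
  qed
  then have "hausdorff_outer ?k ?A \<le> ennreal ?C"
    unfolding hausdorff_outer_def by (intro SUP_least) auto
  then show ?thesis using le_less_trans by fastforce
qed

text \<open>Isometries include translations, so the uniqueness of Haar measure applies. The constant
  is the measure of the unit cube and is left unevaluated.\<close>

lemma emeasure_hausdorff_DIM:
  obtains C where "C < \<infinity>"
    "\<And>E :: 'a::euclidean_space set. E \<in> sets borel \<Longrightarrow> hausdorff_outer DIM('a) E = C * emeasure lborel E"
proof -
  let ?N = "hausdorff_measure DIM('a) :: 'a measure"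
  have fin: "emeasure ?N (cball 0 r) < \<infinity>" for r
  proof -
    have "cball 0 r \<subseteq> {x :: 'a. (\<forall>b\<in>Basis. \<bar>x \<bullet> b\<bar> \<le> \<bar>r\<bar> + 1) \<and> (\<forall>b\<in>Basis - Basis. x \<bullet> b = 0)}"
      by (auto intro: order_trans[OF Basis_le_norm])
    then have "hausdorff_outer DIM('a) (cball 0 r :: 'a set) \<le> hausdorff_outer DIM('a)
        {x :: 'a. (\<forall>b\<in>Basis. \<bar>x \<bullet> b\<bar> \<le> \<bar>r\<bar> + 1) \<and> (\<forall>b\<in>Basis - Basis. x \<bullet> b = 0)}"
      by (rule hausdorff_outer_mono)
    also have "\<dots> < \<infinity>" by (rule hausdorff_outer_box_finite) auto
    finally show ?thesis by (simp add: emeasure_hausdorff_measure)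
  qed
  have inv: "emeasure ?N ((\<lambda>x. z + x) -` E) = emeasure ?N E" if "E \<in> sets borel" for z E
  proof -
    have [measurable]: "E \<in> sets borel" by fact
    have "(\<lambda>x. z + x) -` E \<in> sets borel"
      by (rule measurable_sets_borel[of _ borel]) simp_all
    moreover have "(\<lambda>x. z + x) ` ((\<lambda>x. z + x) -` E) = E"
      by (simp add: surj_image_vimage_eq surj_plus)
    ultimately show ?thesis
      using hausdorff_outer_isometry[of "\<lambda>x. z + x" "DIM('a)" "(\<lambda>x. z + x) -` E"] that
      by (simp add: emeasure_hausdorff_measure)
  qed
  show ?thesis
  proof (rule that)
    show "emeasure ?N (cbox 0 One) < \<infinity>"
      by (rule le_less_trans[OF emeasure_mono fin[of "DIM('a)"]])
        (auto intro!: order_trans[OF norm_le_l1] sum_bounded_above[of _ _ 1, simplified]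
          simp: mem_box)
    show "hausdorff_outer DIM('a) E = emeasure ?N (cbox 0 One) * emeasure lborel E"
      if "E \<in> sets borel" for E :: "'a set"
      using translation_invariant_eq_lborel[OF _ fin inv that] that
      by (simp add: emeasure_hausdorff_measure)
  qed
qed

section \<open>Normalisation in dimension one\<close>

text \<open>Since \<open>unit_ball_vol 1 = 2\<close>, the gauge is the diameter. Equal subdivisions
  give the upper bound. For the lower bound every covering set is enlarged to the interval between
  its infimum and supremum, which has the same diameter, and Lebesgue measure is subadditive; the
  content at scale 1 is already large enough.\<close>

lemma hausdorff_outer_1_unit_interval: "hausdorff_outer 1 {0..1::real} = 1"
proof (rule antisym)
  have "hausdorff_content 1 \<delta> {0..1::real} \<le> 1" if \<delta>: "\<delta> > 0" for \<delta>
  proof -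
    obtain N :: nat where N: "N > 0" "1 / N \<le> \<delta>"
      using \<delta> reals_Archimedean[of \<delta>]
      by (metis inverse_eq_divide less_imp_le of_nat_0_less_iff zero_less_Suc)
    have "{0..1::real} \<subseteq> (\<Union>i<N. {i / N..(i + 1) / N})"
    proof
      fix x :: real assume x: "x \<in> {0..1}"
      define i where "i = min (nat \<lfloor>x * N\<rfloor>) (N - 1)"
      have t0: "0 \<le> x * N" "x * N \<le> N" using x by (auto simp: mult_left_le_one_le)
      have "real i \<le> x * N" using of_nat_floor[OF t0(1)] by (auto simp: i_def intro: order_trans[rotated])
      moreover have "x * N \<le> real i + 1"
        using t0 N by (auto simp: i_def min_def of_nat_diff)
      moreover have "i < N" using N by (auto simp: i_def)
      ultimately show "x \<in> (\<Union>i<N. {i / N..(i + 1) / N})"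
        using N by (auto simp: field_simps intro!: bexI[of _ i])
    qed
    then have "hausdorff_content 1 \<delta> {0..1::real} \<le> (\<Sum>i<N. hausdorff_gauge 1 {i / N..(i + 1) / N})"
      using N \<delta> by (intro hausdorff_content_le_finite) (auto simp: diff_divide_distrib[symmetric])
    also have "\<dots> = (\<Sum>i<N. ennreal (1 / N))"
      using N by (intro sum.cong)
        (auto simp: hausdorff_gauge_def diff_divide_distrib[symmetric] divide_right_mono not_le divide_less_cancel)
    also have "\<dots> = 1"
      using N by (simp flip: ennreal_mult' add: ennreal_of_nat_eq_real_of_nat)
    finally show ?thesis .
  qed
  then show "hausdorff_outer 1 {0..1::real} \<le> 1"
    unfolding hausdorff_outer_def by (intro SUP_least) auto
  have "1 \<le> hausdorff_content 1 1 {0..1::real}"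
    unfolding hausdorff_content_def
  proof (rule INF_greatest, clarify)
    fix E :: "nat \<Rightarrow> real set"
    assume E: "\<forall>i. bounded (E i) \<and> diameter (E i) \<le> 1" "{0..1} \<subseteq> (\<Union>i. E i)"
    define F where "F i = (if E i = {} then {} else {Inf (E i)..Sup (E i)})" for i
    have "bdd_above (E i)" "bdd_below (E i)" for i
      using E(1) by (simp_all add: bounded_imp_bdd_above bounded_imp_bdd_below)
    then have EF: "E i \<subseteq> F i" for i
      by (auto simp: F_def intro!: cInf_lower cSup_upper)
    have "emeasure lborel (F i) \<le> hausdorff_gauge 1 (E i)" for i
    proof (cases "E i = {}")
      case False
      have "Sup (E i) - Inf (E i) \<le> diameter (E i)"
      proof -
        have "x - y \<le> diameter (E i)" if "x \<in> E i" "y \<in> E i" for x y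
          using diameter_bounded_bound[of "E i" x y] that E(1) by (auto simp: dist_real_def)
        then have "x - diameter (E i) \<le> Inf (E i)" if "x \<in> E i" for x
          using that False by (intro cInf_greatest) (auto simp: algebra_simps)
        then have "Sup (E i) \<le> Inf (E i) + diameter (E i)"
          using False by (intro cSup_least) (auto simp: algebra_simps)
        then show ?thesis by simp
      qed
      then show ?thesis
        using False by (auto simp: F_def hausdorff_gauge_def emeasure_lborel_Icc_eq intro!: ennreal_leI)
    qed (simp add: F_def)
    then have "(\<Sum>i. emeasure lborel (F i)) \<le> (\<Sum>i. hausdorff_gauge 1 (E i))"
      by (intro suminf_le) auto
    moreover have "emeasure lborel (\<Union>i. F i) \<le> (\<Sum>i. emeasure lborel (F i))"
      by (intro emeasure_subadditive_countably) (auto simp: F_def)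
    moreover have "emeasure lborel {0..1::real} \<le> emeasure lborel (\<Union>i. F i)"
    proof (rule emeasure_mono)
      show "{0..1} \<subseteq> (\<Union>i. F i)" using E(2) EF by blast
    qed (auto simp: F_def)
    ultimately show "1 \<le> (\<Sum>i. hausdorff_gauge 1 (E i))" by simp
  qed
  also have "\<dots> \<le> hausdorff_outer 1 {0..1::real}"
    by (rule hausdorff_content_le_outer) simp
  finally show "1 \<le> hausdorff_outer 1 {0..1::real}" .
qed

lemma hausdorff_outer_1_real:
  fixes E :: "real set"
  assumes "E \<in> sets borel"
  shows "hausdorff_outer 1 E = emeasure lborel E"
proof -
  obtain C where C: "\<And>E :: real set. E \<in> sets borel \<Longrightarrow> hausdorff_outer 1 E = C * emeasure lborel E"
    using emeasure_hausdorff_DIM[where 'a = real] by auto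
  from C[of "{0..1}"] have "C = 1"
    using hausdorff_outer_1_unit_interval by simp
  with C assms show ?thesis by simp
qed

lemma hausdorff_outer_1_line:
  fixes K :: "'a::euclidean_space set"
  assumes [measurable]: "K \<in> sets borel" and u: "norm u = 1"
  shows "hausdorff_outer 1 (K \<inter> line_in_direction u y) = emeasure lborel {s. y + s *\<^sub>R u \<in> K}"
proof -
  have "K \<inter> line_in_direction u y = (\<lambda>s. y + s *\<^sub>R u) ` {s. y + s *\<^sub>R u \<in> K}"
    by (auto simp: line_in_direction_def)
  moreover have "{s. y + s *\<^sub>R u \<in> K} \<in> sets borel"
    by measurable
  moreover have "dist (y + s *\<^sub>R u) (y + t *\<^sub>R u) = dist s t" for s t
    using u by (simp add: dist_norm real_norm_def flip: scaleR_diff_left)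
  ultimately show ?thesis
    using hausdorff_outer_isometry[of "\<lambda>s. y + s *\<^sub>R u" 1] hausdorff_outer_1_real by simp
qed

section \<open>Hausdorff measure on hyperplanes\<close>

lemma mem_orthogonal_comp_singleton: "x \<in> {\<theta>}\<^sup>\<bottom> \<longleftrightarrow> \<theta> \<bullet> x = 0"
  by (simp add: orthogonal_comp_def orthogonal_def)

lemma sets_orthogonal_comp [measurable]: "({\<theta>}\<^sup>\<bottom> :: 'a::euclidean_space set) \<in> sets borel"
proof -
  have "{\<theta>}\<^sup>\<bottom> = {x. \<theta> \<bullet> x = 0}" by (auto simp: mem_orthogonal_comp_singleton)
  then show ?thesis by (simp add: borel_closed closed_hyperplane)
qed

text \<open>A measure on the whole space that is concentrated on the hyperplane: integrands stay
  functions on the full space, and orthogonality to \<open>\<theta>\<close> becomes an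
  almost-everywhere property.\<close>

definition hyperplane_measure :: "'a::euclidean_space \<Rightarrow> 'a measure" where
  "hyperplane_measure \<theta> = density (hausdorff_measure (DIM('a) - 1)) (indicator ({\<theta>}\<^sup>\<bottom>))"

lemma sets_hyperplane_measure [simp, measurable_cong]: "sets (hyperplane_measure \<theta>) = sets borel"
  by (simp add: hyperplane_measure_def)

lemma space_hyperplane_measure [simp]: "space (hyperplane_measure \<theta>) = UNIV"
  by (simp add: hyperplane_measure_def)

lemma emeasure_hyperplane_measure:
  fixes E :: "'a::euclidean_space set"
  assumes "E \<in> sets borel"
  shows "emeasure (hyperplane_measure \<theta>) E = hausdorff_outer (DIM('a) - 1) ({\<theta>}\<^sup>\<bottom> \<inter> E)"
proof -
  have "{\<theta>}\<^sup>\<bottom> \<inter> E \<in> sets borel" using assms sets_orthogonal_comp by blast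
  then show ?thesis
    using assms emeasure_restricted[of "{\<theta>}\<^sup>\<bottom>" "hausdorff_measure (DIM('a) - 1)" E]
    by (simp add: hyperplane_measure_def emeasure_hausdorff_measure)
qed

lemma AE_hyperplane_measure: "AE y in hyperplane_measure \<theta>. \<theta> \<bullet> y = 0"
  unfolding hyperplane_measure_def by (subst AE_density) (auto simp: mem_orthogonal_comp_singleton indicator_def)

text \<open>The reflection that exchanges the two unit vectors. It is its own inverse, so the same
  map serves for images and for preimages. It transports statements about one hyperplane to any
  other.\<close>

lemma exists_reflection:
  fixes \<theta> \<theta>' :: "'a::euclidean_space"
  assumes "norm \<theta> = 1" "norm \<theta>' = 1"
  obtains T where "linear T" "\<And>x y. T x \<bullet> T y = x \<bullet> y" "T \<theta> = \<theta>'" "\<And>x. T (T x) = x"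
proof (cases "\<theta> = \<theta>'")
  case True
  then show ?thesis using that[of "\<lambda>x. x"] by (simp add: linear_id[unfolded id_def])
next
  case False
  define w where "w = \<theta> - \<theta>'"
  have ww: "w \<bullet> w \<noteq> 0" using False by (simp add: w_def)
  define T where "T x = x - (2 * (x \<bullet> w) / (w \<bullet> w)) *\<^sub>R w" for x
  have Tw: "T x \<bullet> w = - (x \<bullet> w)" for x
    using ww by (simp add: T_def inner_diff_left)
  have 1: "\<theta> \<bullet> \<theta> = 1" "\<theta>' \<bullet> \<theta>' = 1" using assms by (simp_all add: dot_square_norm)
  have "2 * (\<theta> \<bullet> w) = w \<bullet> w"
    using 1 by (simp add: w_def inner_diff_left inner_diff_right inner_commute)
  then have "T \<theta> = \<theta>'" using ww by (simp add: T_def w_def)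
  moreover have "linear T"
    by (rule linearI) (simp_all add: T_def inner_add_left algebra_simps add_divide_distrib)
  moreover have "T x \<bullet> T y = x \<bullet> y" for x y
  proof -
    have "T x \<bullet> T y = T x \<bullet> y + 2 * (y \<bullet> w) / (w \<bullet> w) * (x \<bullet> w)"
      by (simp add: T_def[of y] inner_diff_right Tw)
    also have "T x \<bullet> y = x \<bullet> y - 2 * (x \<bullet> w) / (w \<bullet> w) * (y \<bullet> w)"
      by (simp add: T_def inner_diff_left inner_commute[of w y])
    finally show ?thesis by simp
  qed
  moreover have "T (T x) = x" for x
    using ww by (simp add: T_def[of "T x"] Tw) (simp add: T_def)
  ultimately show ?thesis using that by blast
qed

lemma borel_measurable_linear:
  fixes T :: "'a::euclidean_space \<Rightarrow> 'b::euclidean_space"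
  shows "linear T \<Longrightarrow> T \<in> borel_measurable borel"
  by (intro borel_measurable_continuous_onI linear_continuous_on linear_conv_bounded_linear[THEN iffD1])

lemma distr_hyperplane_measure_isometry:
  fixes T :: "'a::euclidean_space \<Rightarrow> 'a"
  assumes T: "linear T" "\<And>x y. T x \<bullet> T y = x \<bullet> y" "T \<theta> = \<theta>'" "\<And>x. T (T x) = x"
  shows "distr (hyperplane_measure \<theta>) borel T = hyperplane_measure \<theta>'"
proof (rule measure_eqI)
  have [measurable]: "T \<in> borel_measurable borel"
    using T(1) by (rule borel_measurable_linear)
  fix E assume "E \<in> sets (distr (hyperplane_measure \<theta>) borel T)"
  then have [measurable]: "E \<in> sets borel" by simp
  have dist: "dist (T x) (T y) = dist x y" for x y
    using T(1,2) by (simp add: dist_norm norm_eq_sqrt_inner flip: linear_diff)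
  have TE: "T -` E \<in> sets borel" by (rule measurable_sets_borel[of _ borel]) simp_all
  have "T ` ({\<theta>}\<^sup>\<bottom> \<inter> T -` E) = {\<theta>'}\<^sup>\<bottom> \<inter> E"
  proof (intro subset_antisym subsetI)
    fix x assume "x \<in> {\<theta>'}\<^sup>\<bottom> \<inter> E"
    then have "T x \<in> {\<theta>}\<^sup>\<bottom> \<inter> T -` E"
      using T(2)[of \<theta> "T x"] T(3,4) by (simp add: mem_orthogonal_comp_singleton)
    then show "x \<in> T ` ({\<theta>}\<^sup>\<bottom> \<inter> T -` E)" using T(4)[of x] by (metis imageI)
  qed (use T(2)[of \<theta>] T(3) in \<open>auto simp: mem_orthogonal_comp_singleton\<close>)
  then show "emeasure (distr (hyperplane_measure \<theta>) borel T) E = emeasure (hyperplane_measure \<theta>') E"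
    using hausdorff_outer_isometry[OF dist, of "DIM('a) - 1" "{\<theta>}\<^sup>\<bottom> \<inter> T -` E"] TE
    by (simp add: emeasure_distr emeasure_hyperplane_measure)
qed simp

text \<open>A reflection moves the hyperplane to a coordinate hyperplane and preserves the ball,
  which then lies in a flat coordinate box.\<close>

lemma emeasure_hyperplane_measure_cball:
  fixes \<theta> :: "'a::euclidean_space"
  assumes "norm \<theta> = 1"
  shows "emeasure (hyperplane_measure \<theta>) (cball 0 r) < \<infinity>"
proof -
  obtain b :: 'a where b: "b \<in> Basis" using nonempty_Basis by blast
  have "norm b = 1" using b by simp
  then obtain T where T: "linear T" "\<And>x y. T x \<bullet> T y = x \<bullet> y" "T b = \<theta>" "\<And>x. T (T x) = x"
    using exists_reflection assms by metis
  have [measurable]: "T \<in> borel_measurable borel"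
    using T(1) by (rule borel_measurable_linear)
  have "T -` cball 0 r = cball 0 r"
    using T(2) by (auto simp: norm_eq_sqrt_inner)
  then have "emeasure (hyperplane_measure \<theta>) (cball 0 r) = emeasure (hyperplane_measure b) (cball 0 r)"
    by (subst distr_hyperplane_measure_isometry[OF T, symmetric]) (simp add: emeasure_distr)
  also have "\<dots> = hausdorff_outer (DIM('a) - 1) ({b}\<^sup>\<bottom> \<inter> cball 0 r)"
    by (simp add: emeasure_hyperplane_measure)
  \<comment> \<open>The half-width \<open>\<bar>r\<bar> + 1\<close> is positive for every
    \<open>r\<close>, as the box lemma demands.\<close>
  also have "\<dots> \<le> hausdorff_outer (card (Basis - {b}))
      {x. (\<forall>b'\<in>Basis - {b}. \<bar>x \<bullet> b'\<bar> \<le> \<bar>r\<bar> + 1) \<and> (\<forall>b'\<in>Basis - (Basis - {b}). x \<bullet> b' = 0)}"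
    using b by (auto simp: mem_orthogonal_comp_singleton inner_commute
        intro!: hausdorff_outer_mono intro: order_trans[OF Basis_le_norm])
  also have "\<dots> < \<infinity>" by (rule hausdorff_outer_box_finite) auto
  finally show ?thesis .
qed

lemma sigma_finite_hyperplane_measure:
  "norm \<theta> = 1 \<Longrightarrow> sigma_finite_measure (hyperplane_measure \<theta>)"
  by (rule sigma_finite_borelI[OF sets_hyperplane_measure emeasure_hyperplane_measure_cball])

lemma nn_integral_hyperplane_translate:
  fixes z :: "'a::euclidean_space"
  assumes [measurable]: "f \<in> borel_measurable borel" and z: "\<theta> \<bullet> z = 0"
  shows "(\<integral>\<^sup>+y. f (z + y) \<partial>hyperplane_measure \<theta>) = (\<integral>\<^sup>+y. f y \<partial>hyperplane_measure \<theta>)"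
proof -
  have "distr (hyperplane_measure \<theta>) borel (\<lambda>y. z + y) = hyperplane_measure \<theta>"
  proof (rule measure_eqI)
    fix E assume "E \<in> sets (distr (hyperplane_measure \<theta>) borel (\<lambda>y. z + y))"
    then have [measurable]: "E \<in> sets borel" by simp
    have zE: "(\<lambda>y. z + y) -` E \<in> sets borel" by (rule measurable_sets_borel[of _ borel]) simp_all
    have "(\<lambda>y. z + y) ` ({\<theta>}\<^sup>\<bottom> \<inter> (\<lambda>y. z + y) -` E) = {\<theta>}\<^sup>\<bottom> \<inter> E"
    proof (intro subset_antisym subsetI)
      fix x assume "x \<in> {\<theta>}\<^sup>\<bottom> \<inter> E"
      then show "x \<in> (\<lambda>y. z + y) ` ({\<theta>}\<^sup>\<bottom> \<inter> (\<lambda>y. z + y) -` E)"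
        using z by (intro image_eqI[of _ _ "x - z"]) (auto simp: mem_orthogonal_comp_singleton inner_diff_right)
    qed (use z in \<open>auto simp: mem_orthogonal_comp_singleton inner_add_right\<close>)
    then show "emeasure (distr (hyperplane_measure \<theta>) borel (\<lambda>y. z + y)) E = emeasure (hyperplane_measure \<theta>) E"
      using hausdorff_outer_isometry[of "\<lambda>y. z + y" "DIM('a) - 1" "{\<theta>}\<^sup>\<bottom> \<inter> (\<lambda>y. z + y) -` E"] zE
      by (simp add: emeasure_distr emeasure_hyperplane_measure)
  qed simp
  then have "(\<integral>\<^sup>+y. f y \<partial>hyperplane_measure \<theta>) = (\<integral>\<^sup>+y. f y \<partial>distr (hyperplane_measure \<theta>) borel (\<lambda>y. z + y))"
    by simp
  then show ?thesis by (simp add: nn_integral_distr)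
qed

section \<open>Slicing the space by parallel hyperplanes\<close>

text \<open>The product of the hyperplane measure with Lebesgue measure on the normal line is
  translation invariant on the whole space, hence a multiple of Lebesgue measure. The essential
  point is that one finite constant serves all directions, so that foliations in different
  directions can be compared.\<close>

lemma hyperplane_foliation:
  "\<exists>c < \<infinity>. \<forall>(\<theta> :: 'a::euclidean_space) f. norm \<theta> = 1 \<longrightarrow> f \<in> borel_measurable borel \<longrightarrow>
       (\<integral>\<^sup>+y. \<integral>\<^sup>+s. f (y + s *\<^sub>R \<theta>) \<partial>lborel \<partial>hyperplane_measure \<theta>) = c * (\<integral>\<^sup>+x. f x \<partial>lborel)"
proof -
  define N :: "'a \<Rightarrow> 'a measure" where
    "N \<theta> = distr (hyperplane_measure \<theta> \<Otimes>\<^sub>M lborel) borel (\<lambda>(y, s). y + s *\<^sub>R \<theta>)" for \<theta>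
  have [simp, measurable_cong]: "sets (N \<theta>) = sets borel" for \<theta> by (simp add: N_def)
  have int_N: "(\<integral>\<^sup>+x. f x \<partial>N \<theta>) = (\<integral>\<^sup>+y. \<integral>\<^sup>+s. f (y + s *\<^sub>R \<theta>) \<partial>lborel \<partial>hyperplane_measure \<theta>)"
    if [measurable]: "f \<in> borel_measurable borel" for f :: "'a \<Rightarrow> ennreal" and \<theta>
    by (simp add: N_def nn_integral_distr case_prod_beta' lborel.nn_integral_fst[symmetric])
  have em_N: "emeasure (N \<theta>) E = (\<integral>\<^sup>+y. \<integral>\<^sup>+s. indicator E (y + s *\<^sub>R \<theta>) \<partial>lborel \<partial>hyperplane_measure \<theta>)"
    if E[measurable]: "E \<in> sets borel" for E \<theta>
    using int_N[of "indicator E" \<theta>] E by simp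
  have fin: "emeasure (N \<theta>) (cball 0 r) < \<infinity>" if \<theta>: "norm \<theta> = 1" for \<theta> r
  proof -
    have [measurable]: "cball (0::'a) r \<in> sets borel" by simp
    have "emeasure (N \<theta>) (cball 0 r) = (\<integral>\<^sup>+y. \<integral>\<^sup>+s. indicator (cball 0 r) (y + s *\<^sub>R \<theta>) \<partial>lborel \<partial>hyperplane_measure \<theta>)"
      by (rule em_N) simp
    also have "\<dots> \<le> (\<integral>\<^sup>+y. \<integral>\<^sup>+s. indicator (cball 0 r) y * indicator {-r..r} s \<partial>lborel \<partial>hyperplane_measure \<theta>)"
    proof (rule nn_integral_mono_AE, rule AE_mp[OF AE_hyperplane_measure[of \<theta>]], intro AE_I2 impI nn_integral_mono)
      fix y :: 'a and s :: real assume "\<theta> \<bullet> y = 0"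
      have "norm y \<le> r \<and> \<bar>s\<bar> \<le> r" if "norm (y + s *\<^sub>R \<theta>) \<le> r"
      proof -
        have "(y + s *\<^sub>R \<theta>) \<bullet> (y + s *\<^sub>R \<theta>) = y \<bullet> y + s * s"
        proof -
          have "\<theta> \<bullet> \<theta> = 1" "y \<bullet> \<theta> = 0"
            using \<theta> \<open>\<theta> \<bullet> y = 0\<close> by (simp_all add: dot_square_norm inner_commute)
          then show ?thesis
            using \<open>\<theta> \<bullet> y = 0\<close> by (simp add: inner_add_left inner_add_right)
        qed
        then have "(norm (y + s *\<^sub>R \<theta>))\<^sup>2 = (norm y)\<^sup>2 + \<bar>s\<bar>\<^sup>2"
          by (simp only: power2_norm_eq_inner power2_abs) (simp add: power2_eq_square)
        moreover have "(norm (y + s *\<^sub>R \<theta>))\<^sup>2 \<le> r\<^sup>2" using that by (intro power_mono) auto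
        moreover have "r \<ge> 0" using that norm_ge_zero order_trans by blast
        ultimately show ?thesis by (smt (verit) power2_le_imp_le zero_le_power2)
      qed
      then show "indicator (cball 0 r) (y + s *\<^sub>R \<theta>) \<le> (indicator (cball 0 r) y * indicator {-r..r} s :: ennreal)"
        by (auto simp: indicator_def abs_le_iff)
    qed
    also have "\<dots> = emeasure (hyperplane_measure \<theta>) (cball 0 r) * emeasure lborel {-r..r}"
      using nn_integral_multc[of "indicator (cball 0 r)" "hyperplane_measure \<theta>" "emeasure lborel {-r..r}"]
      by (simp add: nn_integral_cmult)
    also have "\<dots> < \<infinity>"
      using emeasure_hyperplane_measure_cball[OF \<theta>, of r] by (auto simp: ennreal_mult_less_top emeasure_lborel_Icc_eq)
    finally show ?thesis .
  qed
  have inv: "emeasure (N \<theta>) ((\<lambda>x. z + x) -` E) = emeasure (N \<theta>) E"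
    if \<theta>: "norm \<theta> = 1" and [measurable]: "E \<in> sets borel" for \<theta> z E
  proof -
    interpret sigma_finite_measure "hyperplane_measure \<theta>" by (rule sigma_finite_hyperplane_measure[OF \<theta>])
    \<comment> \<open>The part of \<open>z\<close> along \<open>\<theta>\<close> is absorbed by the
      line integral, the part in the hyperplane by the hyperplane measure.\<close>
    define z' where "z' = z - (z \<bullet> \<theta>) *\<^sub>R \<theta>"
    have z': "\<theta> \<bullet> z' = 0" using \<theta> by (simp add: z'_def inner_diff_right dot_square_norm inner_commute)
    have [measurable]: "(\<lambda>x. z + x) -` E \<in> sets borel" by (rule measurable_sets_borel[of _ borel]) simp_all
    have "emeasure (N \<theta>) ((\<lambda>x. z + x) -` E) =
        (\<integral>\<^sup>+y. \<integral>\<^sup>+s. indicator E (z + (y + s *\<^sub>R \<theta>)) \<partial>lborel \<partial>hyperplane_measure \<theta>)"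
      by (simp add: em_N indicator_vimage[unfolded comp_def, symmetric] indicator_def)
    also have "\<dots> = (\<integral>\<^sup>+y. \<integral>\<^sup>+s. indicator E (z' + y + (z \<bullet> \<theta> + s) *\<^sub>R \<theta>) \<partial>lborel \<partial>hyperplane_measure \<theta>)"
      by (simp add: z'_def algebra_simps)
    also have "\<dots> = (\<integral>\<^sup>+y. \<integral>\<^sup>+s. indicator E (z' + y + s *\<^sub>R \<theta>) \<partial>lborel \<partial>hyperplane_measure \<theta>)"
      by (subst nn_integral_lborel_translate[where f = "\<lambda>s. indicator E (_ + s *\<^sub>R \<theta>)"]) simp_all
    also have "\<dots> = (\<integral>\<^sup>+y. \<integral>\<^sup>+s. indicator E (y + s *\<^sub>R \<theta>) \<partial>lborel \<partial>hyperplane_measure \<theta>)"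
      by (rule nn_integral_hyperplane_translate[OF _ z']) measurable
    finally show ?thesis by (simp add: em_N)
  qed
  have N_eq: "emeasure (N \<theta>) E = emeasure (N \<theta>) (cbox 0 One) * emeasure lborel E"
    if "norm \<theta> = 1" "E \<in> sets borel" for \<theta> E
    using fin[OF that(1)] inv[OF that(1)] that(2) by (intro translation_invariant_eq_lborel) auto
  obtain b :: 'a where "b \<in> Basis" using nonempty_Basis by blast
  then have b: "norm b = 1" by simp
  let ?c = "emeasure (N b) (cbox 0 One)"
  have c_eq: "emeasure (N \<theta>) (cbox 0 One) = ?c" if \<theta>: "norm \<theta> = 1" for \<theta>
  proof -
    obtain T where T: "linear T" "\<And>x y. T x \<bullet> T y = x \<bullet> y" "T b = \<theta>" "\<And>x. T (T x) = x"
      using exists_reflection b \<theta> by metis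
    have [measurable]: "T \<in> borel_measurable borel"
      using T(1) by (rule borel_measurable_linear)
    have [measurable]: "cball (0::'a) 1 \<in> sets borel" by simp
    \<comment> \<open>The constants of two directions are compared on the unit ball, which every
      norm-preserving linear map leaves invariant; the unit box would be moved by
      \<open>T\<close>.\<close>
    have "emeasure (N \<theta>) (cball 0 1) =
        (\<integral>\<^sup>+y. \<integral>\<^sup>+s. indicator (cball 0 1) (y + s *\<^sub>R \<theta>) \<partial>lborel \<partial>distr (hyperplane_measure b) borel T)"
      by (simp add: em_N distr_hyperplane_measure_isometry[OF T])
    also have "\<dots> = (\<integral>\<^sup>+y. \<integral>\<^sup>+s. indicator (cball 0 1) (T y + s *\<^sub>R \<theta>) \<partial>lborel \<partial>hyperplane_measure b)"
      by (rule nn_integral_distr) measurable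
    also have "\<dots> = (\<integral>\<^sup>+y. \<integral>\<^sup>+s. indicator (cball 0 1) (y + s *\<^sub>R b) \<partial>lborel \<partial>hyperplane_measure b)"
    proof -
      have "T y + s *\<^sub>R \<theta> = T (y + s *\<^sub>R b)" for y s
        using T(1,3) by (simp add: linear_add linear_cmul)
      moreover have "norm (T x) = norm x" for x by (simp add: norm_eq_sqrt_inner T(2))
      ultimately show ?thesis by (simp add: indicator_def)
    qed
    also have "\<dots> = emeasure (N b) (cball 0 1)" by (simp add: em_N)
    finally have eq: "emeasure (N \<theta>) (cbox 0 One) * emeasure lborel (cball (0::'a) 1) =
        ?c * emeasure lborel (cball (0::'a) 1)"
      using N_eq[OF \<theta>, of "cball 0 1"] N_eq[OF b, of "cball 0 1"] by simp
    have "emeasure lborel (cball (0::'a) 1) \<noteq> 0" "emeasure lborel (cball (0::'a) 1) \<noteq> \<infinity>"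
      using emeasure_lborel_cball_finite[of "0::'a" 1] content_cball_pos[of 1 "0::'a"]
      by (auto simp: measure_def)
    then show ?thesis using eq
      by (metis ennreal_divide_self ennreal_times_divide infinity_ennreal_def less_top mult.right_neutral)
  qed
  show ?thesis
  proof (intro exI conjI allI impI)
    show "?c < \<infinity>"
      by (rule le_less_trans[OF emeasure_mono fin[OF b, of "DIM('a)"]])
        (auto intro!: order_trans[OF norm_le_l1] sum_bounded_above[of _ _ 1, simplified] simp: mem_box)
    fix \<theta> :: 'a and f :: "'a \<Rightarrow> ennreal"
    assume \<theta>: "norm \<theta> = 1" and f: "f \<in> borel_measurable borel"
    have "N \<theta> = scale_measure ?c lborel"
      using N_eq[OF \<theta>] c_eq[OF \<theta>] by (intro measure_eqI) simp_all
    then show "(\<integral>\<^sup>+y. \<integral>\<^sup>+s. f (y + s *\<^sub>R \<theta>) \<partial>lborel \<partial>hyperplane_measure \<theta>) = ?c * (\<integral>\<^sup>+x. f x \<partial>lborel)"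
      using int_N[OF f, of \<theta>] f by (simp add: nn_integral_scale_measure)
  qed
qed

text \<open>A name for the constant, so that identities for different directions and different
  integrands visibly share it. The choice depends on the space alone.\<close>

definition foliation_const :: "'a::euclidean_space itself \<Rightarrow> ennreal" where
  "foliation_const _ = (SOME c. c < \<infinity> \<and> (\<forall>(\<theta> :: 'a) f. norm \<theta> = 1 \<longrightarrow> f \<in> borel_measurable borel \<longrightarrow>
     (\<integral>\<^sup>+y. \<integral>\<^sup>+s. f (y + s *\<^sub>R \<theta>) \<partial>lborel \<partial>hyperplane_measure \<theta>) = c * (\<integral>\<^sup>+x. f x \<partial>lborel)))"

lemma foliation_const:
  fixes \<theta> :: "'a::euclidean_space"
  shows foliation_const_finite: "foliation_const TYPE('a) < \<infinity>"
    and nn_integral_foliation: "norm \<theta> = 1 \<Longrightarrow> f \<in> borel_measurable borel \<Longrightarrow>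
      (\<integral>\<^sup>+y. \<integral>\<^sup>+s. f (y + s *\<^sub>R \<theta>) \<partial>lborel \<partial>hyperplane_measure \<theta>) =
      foliation_const TYPE('a) * (\<integral>\<^sup>+x. f x \<partial>lborel)"
  using someI_ex[OF hyperplane_foliation[where 'a = 'a]] unfolding foliation_const_def by blast+

lemma proj_perp_orthogonal: "norm u = 1 \<Longrightarrow> u \<bullet> x = 0 \<Longrightarrow> proj_perp u x = x"
  by (simp add: proj_perp_def inner_commute)

lemma proj_perp_add_scaleR: "norm u = 1 \<Longrightarrow> proj_perp u (y + s *\<^sub>R u) = proj_perp u y"
  by (simp add: proj_perp_def inner_add_left dot_square_norm algebra_simps)

lemma inner_proj_perp_self: "norm u = 1 \<Longrightarrow> u \<bullet> proj_perp u x = 0"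
  by (simp add: proj_perp_def inner_diff_right dot_square_norm inner_commute)

lemma borel_measurable_proj_perp [measurable]: "proj_perp u \<in> borel_measurable borel"
  unfolding proj_perp_def[abs_def] by measurable

lemma nn_integral_hyperplane_proj_perp:
  assumes "norm u = 1"
  shows "(\<integral>\<^sup>+y. h (proj_perp u y) \<partial>hyperplane_measure u) = (\<integral>\<^sup>+y. h y \<partial>hyperplane_measure u)"
proof (rule nn_integral_cong_AE)
  show "AE y in hyperplane_measure u. h (proj_perp u y) = h y"
    using AE_hyperplane_measure[of u] by eventually_elim (simp add: proj_perp_orthogonal[OF assms])
qed

lemma nn_integral_unit_slab: "(\<integral>\<^sup>+s. indicator {0..1} (a + s) \<partial>lborel) = (1 :: ennreal)" for a :: real
  using nn_integral_lborel_translate[of "indicator {0..1} :: real \<Rightarrow> ennreal" a] by simp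

text \<open>Thickening: extending \<open>g\<close> constantly along \<open>u\<close> over a slab of
  width 1 turns an integral over the hyperplane into one over the full space, to which
  \<open>nn_integral_foliation\<close> and the transformation rules of Lebesgue measure
  apply.\<close>

lemma nn_integral_hyperplane_slab:
  fixes u :: "'a::euclidean_space"
  assumes u: "norm u = 1" and [measurable]: "g \<in> borel_measurable borel"
  shows "(\<integral>\<^sup>+s. g (proj_perp u (y + s *\<^sub>R u)) * indicator {0..1} ((y + s *\<^sub>R u) \<bullet> u) \<partial>lborel) = g (proj_perp u y)"
proof -
  have "(\<integral>\<^sup>+s. g (proj_perp u (y + s *\<^sub>R u)) * indicator {0..1} ((y + s *\<^sub>R u) \<bullet> u) \<partial>lborel) =
      (\<integral>\<^sup>+s. g (proj_perp u y) * indicator {0..1} (y \<bullet> u + s) \<partial>lborel)"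
    using u by (simp add: proj_perp_add_scaleR inner_add_left dot_square_norm)
  then show ?thesis by (simp add: nn_integral_cmult nn_integral_unit_slab)
qed

text \<open>The density \<open>1 / \<bar>\<theta> \<bullet> u\<bar>\<close> comes from foliating the space by translates of \<open>\<theta>\<^sup>\<bottom>\<close> in the
  directions \<open>\<theta>\<close> and \<open>u\<close>, which differ by a shear along \<open>\<theta>\<^sup>\<bottom>\<close>; no determinant is needed.\<close>

lemma nn_integral_hyperplane_project:
  fixes u \<theta> :: "'a::euclidean_space"
  assumes u: "norm u = 1" and \<theta>: "norm \<theta> = 1" and ne: "\<theta> \<bullet> u \<noteq> 0"
    and g[measurable]: "g \<in> borel_measurable borel"
  shows "(\<integral>\<^sup>+y. g (proj_perp u y) \<partial>hyperplane_measure \<theta>) =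
    ennreal (1 / \<bar>\<theta> \<bullet> u\<bar>) * (\<integral>\<^sup>+y. g y \<partial>hyperplane_measure u)"
proof -
  interpret sigma_finite_measure "hyperplane_measure \<theta>" by (rule sigma_finite_hyperplane_measure[OF \<theta>])
  interpret P: pair_sigma_finite "hyperplane_measure \<theta>" lborel ..
  define f where "f x = g (proj_perp u x) * indicator {0..1} (x \<bullet> u)" for x
  have [measurable]: "f \<in> borel_measurable borel" unfolding f_def by measurable
  define \<kappa> where "\<kappa> = \<theta> \<bullet> u"
  define u' where "u' = u - \<kappa> *\<^sub>R \<theta>"
  have u': "\<theta> \<bullet> (s *\<^sub>R u') = 0" for s
    using \<theta> by (simp add: u'_def \<kappa>_def inner_diff_right dot_square_norm)
  have "(\<integral>\<^sup>+y. g (proj_perp u y) \<partial>hyperplane_measure \<theta>) =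
      (\<integral>\<^sup>+y. \<integral>\<^sup>+s. f (y + s *\<^sub>R u) \<partial>lborel \<partial>hyperplane_measure \<theta>)"
    unfolding f_def by (subst nn_integral_hyperplane_slab[OF u g]) simp
  also have "\<dots> = (\<integral>\<^sup>+s. \<integral>\<^sup>+y. f (y + s *\<^sub>R u) \<partial>hyperplane_measure \<theta> \<partial>lborel)"
    by (rule P.Fubini'[symmetric]) measurable
  also have "\<dots> = (\<integral>\<^sup>+s. \<integral>\<^sup>+y. f (y + (\<kappa> * s) *\<^sub>R \<theta>) \<partial>hyperplane_measure \<theta> \<partial>lborel)"
  proof (rule nn_integral_cong)
    fix s :: real
    have "y + s *\<^sub>R u = s *\<^sub>R u' + y + (\<kappa> * s) *\<^sub>R \<theta>" for y
      by (simp add: u'_def algebra_simps)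
    then show "(\<integral>\<^sup>+y. f (y + s *\<^sub>R u) \<partial>hyperplane_measure \<theta>) =
        (\<integral>\<^sup>+y. f (y + (\<kappa> * s) *\<^sub>R \<theta>) \<partial>hyperplane_measure \<theta>)"
      by (simp only: nn_integral_hyperplane_translate[OF _ u', of "\<lambda>y. f (y + (\<kappa> * s) *\<^sub>R \<theta>)" s])
        (rule nn_integral_hyperplane_translate[OF _ u'], measurable)
  qed
  also have "\<dots> = (\<integral>\<^sup>+y. \<integral>\<^sup>+s. f (y + (\<kappa> * s) *\<^sub>R \<theta>) \<partial>lborel \<partial>hyperplane_measure \<theta>)"
    by (rule P.Fubini') measurable
  also have "\<dots> = (\<integral>\<^sup>+y. ennreal (1 / \<bar>\<kappa>\<bar>) * (\<integral>\<^sup>+s. f (y + s *\<^sub>R \<theta>) \<partial>lborel) \<partial>hyperplane_measure \<theta>)"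
  proof (rule nn_integral_cong)
    fix y :: 'a
    have "(\<integral>\<^sup>+s. f (y + s *\<^sub>R \<theta>) \<partial>lborel) = ennreal \<bar>\<kappa>\<bar> * (\<integral>\<^sup>+s. f (y + (\<kappa> * s) *\<^sub>R \<theta>) \<partial>lborel)"
      using nn_integral_real_affine[of "\<lambda>s. f (y + s *\<^sub>R \<theta>)" \<kappa> 0] ne by (simp add: \<kappa>_def)
    then show "(\<integral>\<^sup>+s. f (y + (\<kappa> * s) *\<^sub>R \<theta>) \<partial>lborel) = ennreal (1 / \<bar>\<kappa>\<bar>) * (\<integral>\<^sup>+s. f (y + s *\<^sub>R \<theta>) \<partial>lborel)"
      using ne by (simp add: \<kappa>_def mult.assoc[symmetric] flip: ennreal_mult')
  qed
  also have "\<dots> = ennreal (1 / \<bar>\<kappa>\<bar>) * (\<integral>\<^sup>+y. \<integral>\<^sup>+s. f (y + s *\<^sub>R \<theta>) \<partial>lborel \<partial>hyperplane_measure \<theta>)"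
    by (rule nn_integral_cmult) measurable
  also have "(\<integral>\<^sup>+y. \<integral>\<^sup>+s. f (y + s *\<^sub>R \<theta>) \<partial>lborel \<partial>hyperplane_measure \<theta>) =
      (\<integral>\<^sup>+y. \<integral>\<^sup>+s. f (y + s *\<^sub>R u) \<partial>lborel \<partial>hyperplane_measure u)"
    using nn_integral_foliation[OF \<theta>, of f] nn_integral_foliation[OF u, of f] by simp
  also have "\<dots> = (\<integral>\<^sup>+y. g (proj_perp u y) \<partial>hyperplane_measure u)"
    unfolding f_def by (subst nn_integral_hyperplane_slab[OF u g]) simp
  also have "\<dots> = (\<integral>\<^sup>+y. g y \<partial>hyperplane_measure u)"
    by (rule nn_integral_hyperplane_proj_perp[OF u])
  finally show ?thesis by (simp add: \<kappa>_def)
qed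

text \<open>After thickening, the exponent is the dimension of the space, from scaling Lebesgue
  measure, minus 1, from rescaling the slab in the normal direction.\<close>

lemma nn_integral_hyperplane_scale:
  fixes u :: "'a::euclidean_space"
  assumes u: "norm u = 1" and r: "r \<noteq> 0" and g[measurable]: "g \<in> borel_measurable borel"
  shows "(\<integral>\<^sup>+y. g y \<partial>hyperplane_measure u) =
    ennreal (\<bar>r\<bar> ^ (DIM('a) - 1)) * (\<integral>\<^sup>+y. g (r *\<^sub>R y) \<partial>hyperplane_measure u)"
proof -
  define f where "f x = g (proj_perp u x) * indicator {0..1} (x \<bullet> u)" for x
  have [measurable]: "f \<in> borel_measurable borel" unfolding f_def by measurable
  have slab: "(\<integral>\<^sup>+s. f (y + s *\<^sub>R u) \<partial>lborel) = g (proj_perp u y)" for y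
    unfolding f_def by (rule nn_integral_hyperplane_slab[OF u g])
  have slab_r: "(\<integral>\<^sup>+s. f (r *\<^sub>R (y + s *\<^sub>R u)) \<partial>lborel) = ennreal (1 / \<bar>r\<bar>) * g (r *\<^sub>R proj_perp u y)" for y
  proof -
    have "g (r *\<^sub>R proj_perp u y) = (\<integral>\<^sup>+s. f (r *\<^sub>R y + s *\<^sub>R u) \<partial>lborel)"
      by (simp add: slab) (simp add: proj_perp_def algebra_simps)
    also have "\<dots> = ennreal \<bar>r\<bar> * (\<integral>\<^sup>+s. f (r *\<^sub>R (y + s *\<^sub>R u)) \<partial>lborel)"
      using nn_integral_real_affine[of "\<lambda>s. f (r *\<^sub>R y + s *\<^sub>R u)" r 0] r by (simp add: scaleR_add_right)
    finally show ?thesis using r by (simp add: mult.assoc[symmetric] flip: ennreal_mult')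
  qed
  have proj: "(\<integral>\<^sup>+y. h (proj_perp u y) \<partial>hyperplane_measure u) = (\<integral>\<^sup>+y. h y \<partial>hyperplane_measure u)"
    for h :: "'a \<Rightarrow> ennreal"
    by (rule nn_integral_hyperplane_proj_perp[OF u])
  have D: "\<bar>r\<bar> ^ DIM('a) / \<bar>r\<bar> = \<bar>r\<bar> ^ (DIM('a) - 1)"
    using r DIM_positive[where 'a='a] by (cases "DIM('a)") simp_all
  have "(\<integral>\<^sup>+y. g y \<partial>hyperplane_measure u) = (\<integral>\<^sup>+y. \<integral>\<^sup>+s. f (y + s *\<^sub>R u) \<partial>lborel \<partial>hyperplane_measure u)"
    unfolding slab by (rule proj[symmetric])
  also have "\<dots> = foliation_const TYPE('a) * (\<integral>\<^sup>+x. f x \<partial>lborel)" by (rule nn_integral_foliation[OF u]) simp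
  also have "\<dots> = ennreal (\<bar>r\<bar> ^ DIM('a)) * (foliation_const TYPE('a) * (\<integral>\<^sup>+x. f (r *\<^sub>R x) \<partial>lborel))"
    using r by (subst nn_integral_lborel_scale[of f r]) (simp_all add: mult_ac)
  also have "foliation_const TYPE('a) * (\<integral>\<^sup>+x. f (r *\<^sub>R x) \<partial>lborel) =
      (\<integral>\<^sup>+y. \<integral>\<^sup>+s. f (r *\<^sub>R (y + s *\<^sub>R u)) \<partial>lborel \<partial>hyperplane_measure u)"
    by (rule nn_integral_foliation[OF u, symmetric]) simp
  also have "\<dots> = ennreal (1 / \<bar>r\<bar>) * (\<integral>\<^sup>+y. g (r *\<^sub>R proj_perp u y) \<partial>hyperplane_measure u)"
    unfolding slab_r by (rule nn_integral_cmult) measurable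
  also have "(\<integral>\<^sup>+y. g (r *\<^sub>R proj_perp u y) \<partial>hyperplane_measure u) =
      (\<integral>\<^sup>+y. g (r *\<^sub>R y) \<partial>hyperplane_measure u)"
    by (rule proj)
  finally show ?thesis
    using D by (simp add: mult.assoc[symmetric] flip: ennreal_mult')
qed

text \<open>The vector \<open>e\<close> certifies that the projection \<open>w\<close> of
  \<open>v\<close> to the hyperplane is non-zero. The set \<open>w \<bullet> x = 0\<close> is
  Lebesgue null and a union of lines parallel to \<open>u\<close>. Each of these lines contributes
  infinity or 0 to the foliated integral, so almost no foot point lies in the set.\<close>

lemma AE_hyperplane_inner_nonzero:
  fixes u v e :: "'a::euclidean_space"
  assumes u: "norm u = 1" and e: "u \<bullet> e = 0" "v \<bullet> e \<noteq> 0"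
  shows "AE y in hyperplane_measure u. v \<bullet> y \<noteq> 0"
proof -
  define w where "w = proj_perp u v"
  have wx: "w \<bullet> x = v \<bullet> proj_perp u x" for x
    by (simp add: w_def proj_perp_def inner_diff_left inner_diff_right inner_commute)
  have "w \<noteq> 0" using wx[of e] e by (auto simp: proj_perp_def inner_commute)
  have wu: "w \<bullet> u = 0" using inner_proj_perp_self[OF u, of v] by (simp add: w_def inner_commute)
  let ?f = "indicator {x. w \<bullet> x = 0} :: 'a \<Rightarrow> ennreal"
  have [measurable]: "{x. w \<bullet> x = 0} \<in> sets borel" by (simp add: borel_closed closed_hyperplane)
  have "negligible {x. w \<bullet> x = 0}" using \<open>w \<noteq> 0\<close> by (intro negligible_hyperplane) auto
  then have "emeasure lborel {x. w \<bullet> x = 0} = 0"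
    by (auto simp: negligible_iff_null_sets null_sets_completion_iff dest: null_setsD1)
  then have "(\<integral>\<^sup>+y. \<integral>\<^sup>+s. ?f (y + s *\<^sub>R u) \<partial>lborel \<partial>hyperplane_measure u) = 0"
    using nn_integral_foliation[OF u, of ?f] by simp
  then have "AE y in hyperplane_measure u. (\<integral>\<^sup>+s. ?f (y + s *\<^sub>R u) \<partial>lborel) = 0"
    by (subst (asm) nn_integral_0_iff_AE) simp_all
  moreover have "(\<integral>\<^sup>+s. ?f (y + s *\<^sub>R u) \<partial>lborel) = (if w \<bullet> y = 0 then \<infinity> else 0)" for y
    using wu by (simp add: inner_add_right indicator_def)
  ultimately have "AE y in hyperplane_measure u. w \<bullet> y \<noteq> 0" by (simp split: if_splits)
  then show ?thesis
    using AE_hyperplane_measure[of u] by eventually_elim (simp add: wx proj_perp_orthogonal[OF u])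
qed

section \<open>Rearrangement on the line\<close>

text \<open>The argument is the length. The interval is open, so that length 0 gives the empty set.
  A point in it thus witnesses a section of positive measure, and the closed segment of the Steiner
  symmetral contains it.\<close>

definition centered_interval :: "real \<Rightarrow> real set" where
  "centered_interval a = {- (a / 2)<..<a / 2}"

lemma mem_centered_interval: "x \<in> centered_interval a \<longleftrightarrow> \<bar>x\<bar> < a / 2"
  by (auto simp: centered_interval_def)

lemma centered_interval_measurable [measurable]: "centered_interval a \<in> sets borel"
  by (simp add: centered_interval_def)

text \<open>If \<open>H\<close> is the symmetric decreasing rearrangement of \<open>h\<close>, this
  is the Hardy-Littlewood inequality for indicators. As a relation between two functions it survives
  convolution with an indicator on one side and with the centered interval on the other, and so
  serves as the invariant of an induction.\<close>

definition rearr_dominated :: "(real \<Rightarrow> ennreal) \<Rightarrow> (real \<Rightarrow> ennreal) \<Rightarrow> bool" where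
  "rearr_dominated h H \<longleftrightarrow> (\<forall>E\<in>sets borel. bounded E \<longrightarrow>
     (\<integral>\<^sup>+x. indicator E x * h x \<partial>lborel) \<le>
     (\<integral>\<^sup>+x. indicator (centered_interval (measure lborel E)) x * H x \<partial>lborel))"

lemma emeasure_lborel_bounded:
  "bounded A \<Longrightarrow> emeasure lborel A = ennreal (measure lborel A)"
  using emeasure_bounded_finite[of A] by (simp add: emeasure_eq_ennreal_measure less_top)

lemma nn_integral_eq_0I: "(\<And>x. f x = 0) \<Longrightarrow> (\<integral>\<^sup>+x. f x \<partial>M) = 0"
  by simp

section \<open>Slicing the sum of two sets\<close>

text \<open>The witness is the quantile function of \<open>A\<close>: \<open>\<alpha> t\<close> is
  the leftmost point with mass \<open>t\<close> of \<open>A\<close> to its left. It transports the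
  uniform measure on \<open>{0<..<a}\<close> to Lebesgue measure on \<open>A\<close>. The second
  property says that cutting the parameter at \<open>t\<close> cuts \<open>A\<close> at
  \<open>\<alpha> t\<close>.\<close>

lemma exists_quantile:
  fixes A :: "real set"
  assumes A[measurable]: "A \<in> sets borel" and bA: "bounded A"
  defines "a \<equiv> measure lborel A"
  shows "\<exists>\<alpha>\<in>borel_measurable borel.
    (\<forall>g\<in>borel_measurable borel.
       (\<integral>\<^sup>+\<tau>. indicator {0<..<a} \<tau> * g (\<alpha> \<tau>) \<partial>lborel) = (\<integral>\<^sup>+x. indicator A x * g x \<partial>lborel)) \<and>
    (\<forall>t. 0 < t \<longrightarrow> t < a \<longrightarrow> (\<forall>g\<in>borel_measurable borel.
       (\<integral>\<^sup>+\<tau>. indicator {t<..<a} \<tau> * g (\<alpha> \<tau>) \<partial>lborel) =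
       (\<integral>\<^sup>+x. indicator (A \<inter> {\<alpha> t<..}) x * g x \<partial>lborel)))"
proof -
  define F where "F x = measure lborel (A \<inter> {..x})" for x
  have fmA: "A \<in> fmeasurable lborel"
    using emeasure_bounded_finite[OF bA] by (simp add: fmeasurable_def)
  have fm: "A \<inter> {..x} \<in> fmeasurable lborel" for x
    using fmA by (rule fmeasurable_Int_fmeasurable) simp
  have emF: "emeasure lborel (A \<inter> {..x}) = ennreal (F x)" for x
    unfolding F_def using bA by (intro emeasure_lborel_bounded) (auto intro: bounded_subset)
  obtain R where R: "\<And>x. x \<in> A \<Longrightarrow> \<bar>x\<bar> \<le> R"
    using bA unfolding bounded_iff real_norm_def by blast
  have F0: "F x = 0" if "x < - R" for x
  proof -
    have "A \<inter> {..x} = {}" using R that by force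
    then show ?thesis by (simp add: F_def)
  qed
  have Fa: "F x = a" if "x \<ge> R" for x
  proof -
    have "A \<inter> {..x} = A" using R that by force
    then show ?thesis by (simp add: F_def a_def)
  qed
  have F_diff: "F y - F x \<le> y - x" if "x \<le> y" for x y
  proof -
    have "{x..y} \<in> fmeasurable lborel" by (simp add: fmeasurable_def emeasure_lborel_Icc_eq)
    then have "F y \<le> measure lborel ((A \<inter> {..x}) \<union> {x..y})"
      unfolding F_def using that fm by (intro measure_mono_fmeasurable fmeasurable.Un) auto
    also have "\<dots> \<le> F x + measure lborel {x..y}"
      unfolding F_def using fm by (intro measure_Un_le) auto
    finally show ?thesis using that by simp
  qed
  have F_mono: "F x \<le> F y" if "x \<le> y" for x y
    unfolding F_def using that fm by (intro measure_mono_fmeasurable) auto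
  have F_ge0: "0 \<le> F x" for x by (simp add: F_def)
  have F_le: "F x \<le> a" for x unfolding F_def a_def using fmA by (intro measure_mono_fmeasurable) auto
  have cont: "continuous_on UNIV F"
  proof (rule lipschitz_on_continuous_on[of 1], rule lipschitz_onI)
    fix x y show "dist (F x) (F y) \<le> 1 * dist x y"
      using F_diff[of x y] F_diff[of y x] F_mono[of x y] F_mono[of y x]
      by (cases "x \<le> y") (auto simp: dist_real_def)
  qed simp
  define \<alpha> where "\<alpha> t = (if 0 < t \<and> t < a then Inf {x. t \<le> F x} else 0)" for t
  \<comment> \<open>The Galois connection between \<open>\<alpha>\<close> and \<open>F\<close>; the
    infimum is attained because \<open>F\<close> is continuous.\<close>
  have \<alpha>_le: "\<alpha> t \<le> x \<longleftrightarrow> t \<le> F x" if t: "0 < t" "t < a" for t x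
  proof -
    have ne: "{x. t \<le> F x} \<noteq> {}" using Fa[of R] t by (auto intro!: exI[of _ R])
    have bd: "bdd_below {x. t \<le> F x}"
      using F0 t by (intro bdd_belowI[of _ "-R"]) (auto simp: not_less[symmetric] intro!: leI)
    have cl: "closed {x. t \<le> F x}"
      using cont by (intro closed_Collect_le) auto
    have "\<alpha> t \<in> {x. t \<le> F x}" using closed_contains_Inf[OF ne bd cl] t by (simp add: \<alpha>_def)
    then have "t \<le> F (\<alpha> t)" by simp
    moreover have "\<alpha> t \<le> x" if "t \<le> F x" for x using cInf_lower[OF _ bd, of x] that t by (simp add: \<alpha>_def)
    ultimately show ?thesis using F_mono[of "\<alpha> t" x] by auto
  qed
  \<comment> \<open>\<open>F\<close> is 1-Lipschitz, so it has no jumps and takes every intermediate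
    value. Equality here makes \<open>\<alpha>\<close> strictly increasing, which is what the cut at
    \<open>t\<close> needs.\<close>
  have F_\<alpha>: "F (\<alpha> t) = t" if t: "0 < t" "t < a" for t
  proof -
    have "\<exists>x\<ge>- \<bar>R\<bar> - 1. x \<le> \<bar>R\<bar> \<and> F x = t"
      using cont t F0[of "- \<bar>R\<bar> - 1"] Fa[of "\<bar>R\<bar>"]
      by (intro IVT') (auto intro: continuous_on_subset)
    then obtain x where "F x = t" by blast
    then have "\<alpha> t \<le> x" using \<alpha>_le[OF t] by simp
    then have "F (\<alpha> t) \<le> t" using F_mono \<open>F x = t\<close> by blast
    moreover have "t \<le> F (\<alpha> t)" using \<alpha>_le[OF t, of "\<alpha> t"] by simp
    ultimately show ?thesis by simp
  qed
  have \<alpha>_set: "{t. \<alpha> t \<le> x} = ({0<..<a} \<inter> {..F x}) \<union> (if 0 \<le> x then - {0<..<a} else {})" for x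
    using \<alpha>_le by (auto simp: \<alpha>_def[abs_def] split: if_splits)
  have \<alpha>_meas[measurable]: "\<alpha> \<in> borel_measurable borel"
    by (rule borel_measurableI_le) (use \<alpha>_set in auto)
  have distr: "distr (density lborel (indicator {0<..<a})) borel \<alpha> = density lborel (indicator A)"
    (is "?M = ?N")
  proof (rule measure_eqI_generator_eq[where \<Omega> = UNIV and E = "range atMost" and A = "\<lambda>n::nat. {..real n}"])
    show "Int_stable (range (atMost :: real \<Rightarrow> _))"
      by (auto simp: Int_stable_def)
    show "sets ?M = sigma_sets UNIV (range atMost)" "sets ?N = sigma_sets UNIV (range atMost)"
      by (simp_all add: borel_eq_atMost)
    show "(\<Union>n. {..real n}) = UNIV" using real_arch_simple by auto
    have M: "emeasure ?M {..x} = F x" for x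
    proof -
      have "emeasure ?M {..x} = emeasure lborel ({0<..<a} \<inter> \<alpha> -` {..x})"
        by (simp add: emeasure_distr emeasure_restricted[symmetric] measurable_sets_borel[OF \<alpha>_meas])
      also have "{0<..<a} \<inter> \<alpha> -` {..x} = {0<..<a} \<inter> {..F x}"
        using \<alpha>_le by auto
      also have "emeasure lborel ({0<..<a} \<inter> {..F x}) = F x"
      proof (cases "F x < a")
        case True
        then have "{0<..<a} \<inter> {..F x} = {0<..F x}" by auto
        then show ?thesis using F_ge0[of x] by simp
      next
        case False
        then have "{0<..<a} \<inter> {..F x} = {0<..<a}" "F x = a" using F_le[of x] by auto
        then show ?thesis using F_ge0[of x] by simp
      qed
      finally show ?thesis .
    qed
    have N: "emeasure ?N {..x} = F x" for x
      using emF by (simp add: emeasure_restricted)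
    show "emeasure ?M X = emeasure ?N X" if "X \<in> range atMost" for X
      using that M N by auto
    show "emeasure ?M {..real n} \<noteq> \<infinity>" for n using M by simp
  qed auto
  have push: "(\<integral>\<^sup>+\<tau>. indicator {0<..<a} \<tau> * g (\<alpha> \<tau>) \<partial>lborel) = (\<integral>\<^sup>+x. indicator A x * g x \<partial>lborel)"
    if [measurable]: "g \<in> borel_measurable borel" for g
  proof -
    have "(\<integral>\<^sup>+\<tau>. indicator {0<..<a} \<tau> * g (\<alpha> \<tau>) \<partial>lborel) = (\<integral>\<^sup>+x. g x \<partial>?M)"
      by (subst nn_integral_distr) (simp_all add: nn_integral_density)
    then show ?thesis unfolding distr by (simp add: nn_integral_density)
  qed
  show ?thesis
  proof (intro bexI[OF _ \<alpha>_meas] conjI ballI push allI impI)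
    fix g :: "real \<Rightarrow> ennreal" and t :: real
    assume t: "0 < t" "t < a" and [measurable]: "g \<in> borel_measurable borel"
    have "(\<integral>\<^sup>+\<tau>. indicator {t<..<a} \<tau> * g (\<alpha> \<tau>) \<partial>lborel) =
        (\<integral>\<^sup>+\<tau>. indicator {0<..<a} \<tau> * (indicator {\<alpha> t<..} (\<alpha> \<tau>) * g (\<alpha> \<tau>)) \<partial>lborel)"
    proof (rule nn_integral_cong)
      fix \<tau>
      have "\<alpha> t < \<alpha> \<tau> \<longleftrightarrow> t < \<tau>" if "0 < \<tau>" "\<tau> < a"
        using \<alpha>_le[OF that, of "\<alpha> t"] F_\<alpha>[OF t] by auto
      then show "indicator {t<..<a} \<tau> * g (\<alpha> \<tau>) = indicator {0<..<a} \<tau> * (indicator {\<alpha> t<..} (\<alpha> \<tau>) * g (\<alpha> \<tau>))"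
        using t by (auto simp: indicator_def)
    qed
    also have "\<dots> = (\<integral>\<^sup>+x. indicator A x * (indicator {\<alpha> t<..} x * g x) \<partial>lborel)"
      by (rule push) measurable
    finally show "(\<integral>\<^sup>+\<tau>. indicator {t<..<a} \<tau> * g (\<alpha> \<tau>) \<partial>lborel) =
        (\<integral>\<^sup>+x. indicator (A \<inter> {\<alpha> t<..}) x * g x \<partial>lborel)"
      by (simp add: indicator_inter_arith mult.assoc)
  qed
qed

lemma nn_integral_reflect_real:
  fixes g :: "real \<Rightarrow> ennreal"
  assumes [measurable]: "g \<in> borel_measurable borel"
  shows "(\<integral>\<^sup>+x. g (- x) \<partial>lborel) = (\<integral>\<^sup>+x. g x \<partial>lborel)"
  using nn_integral_real_affine[of g "-1" 0] by simp

lemma measure_lborel_uminus_vimage: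
  assumes [measurable]: "A \<in> sets borel"
  shows "measure lborel (uminus -` A :: real set) = measure lborel A"
proof -
  have "uminus -` A \<in> sets borel"
    using assms by (intro measurable_sets_borel[of _ borel]) simp_all
  then have "emeasure lborel (uminus -` A :: real set) = emeasure lborel A"
    using nn_integral_reflect_real[of "indicator A"] assms
    by (simp add: indicator_vimage[unfolded comp_def, symmetric] flip: nn_integral_indicator)
  then show ?thesis by (simp add: measure_def)
qed

lemma bounded_uminus_vimage: "bounded B \<Longrightarrow> bounded (uminus -` B :: real set)"
  unfolding bounded_iff by (metis norm_minus_cancel vimageE)

text \<open>The points of \<open>A \<times> B\<close> are sliced according to the minimum of the
  mass of \<open>A\<close> to the left of \<open>x\<close> and the mass of \<open>B\<close> to the right of \<open>y\<close>. On each slice the sum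
  \<open>x + y\<close> is injective.\<close>

lemma sumset_slices:
  fixes A B :: "real set"
  assumes A[measurable]: "A \<in> sets borel" and bA: "bounded A"
    and B[measurable]: "B \<in> sets borel" and bB: "bounded B"
  defines "a \<equiv> measure lborel A" and "b \<equiv> measure lborel B"
  shows "\<exists>S :: real \<Rightarrow> real set.
    (\<forall>t. 0 < t \<longrightarrow> t < min a b \<longrightarrow>
       S t \<in> sets borel \<and> bounded (S t) \<and> measure lborel (S t) = a + b - 2 * t) \<and>
    (\<forall>h\<in>borel_measurable borel.
       (\<integral>\<^sup>+x. indicator A x * (\<integral>\<^sup>+y. indicator B y * h (x + y) \<partial>lborel) \<partial>lborel) =
       (\<integral>\<^sup>+t. indicator {0<..<min a b} t * (\<integral>\<^sup>+s. indicator (S t) s * h s \<partial>lborel) \<partial>lborel))"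
proof -
  obtain \<alpha> where \<alpha>[measurable]: "\<alpha> \<in> borel_measurable borel"
    and q\<alpha>: "\<forall>g\<in>borel_measurable borel.
       (\<integral>\<^sup>+\<tau>. indicator {0<..<a} \<tau> * g (\<alpha> \<tau>) \<partial>lborel) = (\<integral>\<^sup>+x. indicator A x * g x \<partial>lborel)"
    "\<forall>t. 0 < t \<longrightarrow> t < a \<longrightarrow> (\<forall>g\<in>borel_measurable borel.
       (\<integral>\<^sup>+\<tau>. indicator {t<..<a} \<tau> * g (\<alpha> \<tau>) \<partial>lborel) =
       (\<integral>\<^sup>+x. indicator (A \<inter> {\<alpha> t<..}) x * g x \<partial>lborel))"
    using exists_quantile[OF A bA] unfolding a_def[symmetric] by (elim bexE conjE)
  note push_\<alpha> = q\<alpha>(1)[rule_format] and tail_\<alpha> = q\<alpha>(2)[rule_format]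
  let ?B = "uminus -` B :: real set"
  have [measurable]: "?B \<in> sets borel" using B by (intro measurable_sets_borel[of _ borel]) simp_all
  have bB': "bounded ?B" using bB by (rule bounded_uminus_vimage)
  have b': "measure lborel ?B = b" unfolding b_def by (rule measure_lborel_uminus_vimage) fact
  obtain \<gamma> where \<gamma>[measurable]: "\<gamma> \<in> borel_measurable borel"
    and q\<gamma>: "\<forall>g\<in>borel_measurable borel.
       (\<integral>\<^sup>+\<tau>. indicator {0<..<b} \<tau> * g (\<gamma> \<tau>) \<partial>lborel) = (\<integral>\<^sup>+x. indicator ?B x * g x \<partial>lborel)"
    "\<forall>t. 0 < t \<longrightarrow> t < b \<longrightarrow> (\<forall>g\<in>borel_measurable borel.
       (\<integral>\<^sup>+\<tau>. indicator {t<..<b} \<tau> * g (\<gamma> \<tau>) \<partial>lborel) =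
       (\<integral>\<^sup>+x. indicator (?B \<inter> {\<gamma> t<..}) x * g x \<partial>lborel))"
    using exists_quantile[OF \<open>?B \<in> sets borel\<close> bB'] unfolding b' by (elim bexE conjE)
  note push_\<gamma> = q\<gamma>(1)[rule_format] and tail_\<gamma> = q\<gamma>(2)[rule_format]
  \<comment> \<open>Undoing the reflection turns the left quantile of \<open>?B\<close> into a point
    with mass \<open>t\<close> of \<open>B\<close> to its right.\<close>
  define \<beta> where "\<beta> t = - \<gamma> t" for t
  have [measurable]: "\<beta> \<in> borel_measurable borel" unfolding \<beta>_def by measurable
  have push_\<beta>: "(\<integral>\<^sup>+\<tau>. indicator {0<..<b} \<tau> * g (\<beta> \<tau>) \<partial>lborel) = (\<integral>\<^sup>+y. indicator B y * g y \<partial>lborel)"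
    if [measurable]: "g \<in> borel_measurable borel" for g
    using push_\<gamma>[of "\<lambda>x. g (- x)"] nn_integral_reflect_real[of "\<lambda>y. indicator B y * g y"]
    by (simp add: \<beta>_def indicator_def)
  have tail_\<beta>: "(\<integral>\<^sup>+\<tau>. indicator {t<..<b} \<tau> * g (\<beta> \<tau>) \<partial>lborel) =
      (\<integral>\<^sup>+y. indicator (B \<inter> {..<\<beta> t}) y * g y \<partial>lborel)"
    if "0 < t" "t < b" and [measurable]: "g \<in> borel_measurable borel" for g t
  proof -
    have "indicator (?B \<inter> {\<gamma> t<..}) y = (indicator (B \<inter> {..<\<beta> t}) (- y) :: ennreal)" for y
      by (auto simp: indicator_def \<beta>_def)
    then show ?thesis
      using tail_\<gamma>[of t "\<lambda>x. g (- x)"] that nn_integral_reflect_real[of "\<lambda>y. indicator (B \<inter> {..<\<beta> t}) y * g y"]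
      by (simp add: \<beta>_def)
  qed
  \<comment> \<open>The slice at level \<open>t\<close> is L-shaped: one leg has
    \<open>x = \<alpha> t\<close> and \<open>y < \<beta> t\<close>, the other
    \<open>y = \<beta> t\<close> and \<open>x > \<alpha> t\<close>. The sums over the legs lie below
    and above \<open>\<alpha> t + \<beta> t\<close>, hence are disjoint, and have total length
    \<open>(b - t) + (a - t)\<close>.\<close>
  define S1 where "S1 t = {s. s - \<alpha> t \<in> B \<and> s - \<alpha> t < \<beta> t}" for t
  define S2 where "S2 t = {s. s - \<beta> t \<in> A \<and> \<alpha> t < s - \<beta> t}" for t
  have [measurable]: "S1 t \<in> sets borel" "S2 t \<in> sets borel" for t
    unfolding S1_def S2_def by measurable
  have disj: "S1 t \<inter> S2 t = {}" for t by (auto simp: S1_def S2_def)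
  have int1: "(\<integral>\<^sup>+s. indicator (S1 t) s * h s \<partial>lborel) = (\<integral>\<^sup>+\<tau>. indicator {t<..<b} \<tau> * h (\<alpha> t + \<beta> \<tau>) \<partial>lborel)"
    if t: "0 < t" "t < b" and [measurable]: "h \<in> borel_measurable borel" for t h
  proof -
    have "(\<integral>\<^sup>+s. indicator (S1 t) s * h s \<partial>lborel) = (\<integral>\<^sup>+y. indicator (S1 t) (\<alpha> t + y) * h (\<alpha> t + y) \<partial>lborel)"
      using nn_integral_real_affine[of "\<lambda>s. indicator (S1 t) s * h s" 1 "\<alpha> t"] by simp
    also have "\<dots> = (\<integral>\<^sup>+y. indicator (B \<inter> {..<\<beta> t}) y * h (\<alpha> t + y) \<partial>lborel)"
      by (simp add: S1_def indicator_def)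
    finally show ?thesis using tail_\<beta>[OF t, of "\<lambda>y. h (\<alpha> t + y)"] by simp
  qed
  have int2: "(\<integral>\<^sup>+s. indicator (S2 t) s * h s \<partial>lborel) = (\<integral>\<^sup>+\<sigma>. indicator {t<..<a} \<sigma> * h (\<alpha> \<sigma> + \<beta> t) \<partial>lborel)"
    if t: "0 < t" "t < a" and [measurable]: "h \<in> borel_measurable borel" for t h
  proof -
    have "(\<integral>\<^sup>+s. indicator (S2 t) s * h s \<partial>lborel) = (\<integral>\<^sup>+y. indicator (S2 t) (\<beta> t + y) * h (\<beta> t + y) \<partial>lborel)"
      using nn_integral_real_affine[of "\<lambda>s. indicator (S2 t) s * h s" 1 "\<beta> t"] by simp
    also have "\<dots> = (\<integral>\<^sup>+y. indicator (A \<inter> {\<alpha> t<..}) y * h (y + \<beta> t) \<partial>lborel)"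
      by (simp add: S2_def indicator_def add.commute)
    finally show ?thesis using tail_\<alpha>[OF t, of "\<lambda>y. h (y + \<beta> t)"] by simp
  qed
  show ?thesis
  proof (intro exI[of _ "\<lambda>t. S1 t \<union> S2 t"] conjI[of "\<forall>t. _ t"] allI impI ballI)
    fix t assume t: "0 < t" "t < min a b"
    have bd: "bounded (S1 t)" "bounded (S2 t)"
    proof -
      have "S1 t \<subseteq> (\<lambda>y. \<alpha> t + y) ` B" "S2 t \<subseteq> (\<lambda>y. \<beta> t + y) ` A"
        by (auto simp: S1_def S2_def image_iff) (metis add.commute diff_add_cancel)+
      then show "bounded (S1 t)" "bounded (S2 t)"
        using bounded_translation[OF bA] bounded_translation[OF bB] bounded_subset by blast+
    qed
    have "emeasure lborel (S1 t) = ennreal (b - t)" "emeasure lborel (S2 t) = ennreal (a - t)"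
      using int1[of t "\<lambda>_. 1"] int2[of t "\<lambda>_. 1"] t by simp_all
    then have "emeasure lborel (S1 t \<union> S2 t) = ennreal (b - t) + ennreal (a - t)"
      using disj by (subst plus_emeasure[symmetric]) auto
    also have "\<dots> = ennreal (a + b - 2 * t)" using t by (simp flip: ennreal_plus)
    finally have "measure lborel (S1 t \<union> S2 t) = a + b - 2 * t" using t by (simp add: measure_def)
    then show "S1 t \<union> S2 t \<in> sets borel \<and> bounded (S1 t \<union> S2 t) \<and> measure lborel (S1 t \<union> S2 t) = a + b - 2 * t"
      using bd by simp
  next
    fix h :: "real \<Rightarrow> ennreal" assume h[measurable]: "h \<in> borel_measurable borel"
    \<comment> \<open>The factor \<open>\<kappa> \<sigma> \<tau>\<close> selects the pairs whose
      minimum is the first parameter. The diagonal is null, so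
      \<open>\<kappa> \<sigma> \<tau>\<close> and \<open>\<kappa> \<tau> \<sigma>\<close> together
      account for almost all pairs; they yield the legs \<open>S1\<close> and
      \<open>S2\<close>.\<close>
    define \<kappa> :: "real \<Rightarrow> real \<Rightarrow> ennreal" where "\<kappa> x y = indicator {p. fst p < snd p} (x, y)" for x y
    have [measurable]: "{p :: real \<times> real. fst p < snd p} \<in> sets (borel \<Otimes>\<^sub>M borel)"
      unfolding borel_prod by (intro borel_open open_Collect_less continuous_intros)
    have [measurable]: "(\<lambda>x. \<kappa> (f x) (g x)) \<in> borel_measurable M"
      if [measurable]: "f \<in> borel_measurable M" "g \<in> borel_measurable M" for f g and M :: "'z measure"
      unfolding \<kappa>_def by measurable
    let ?H1 = "\<lambda>t. \<integral>\<^sup>+s. indicator (S1 t) s * h s \<partial>lborel" and ?H2 = "\<lambda>t. \<integral>\<^sup>+s. indicator (S2 t) s * h s \<partial>lborel"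
    let ?F = "\<lambda>\<sigma>. \<integral>\<^sup>+\<tau>. indicator {0<..<b} \<tau> * \<kappa> \<sigma> \<tau> * h (\<alpha> \<sigma> + \<beta> \<tau>) \<partial>lborel"
      and ?G = "\<lambda>\<sigma>. \<integral>\<^sup>+\<tau>. indicator {0<..<b} \<tau> * \<kappa> \<tau> \<sigma> * h (\<alpha> \<sigma> + \<beta> \<tau>) \<partial>lborel"
    have \<kappa>: "\<kappa> x y = (if x < y then 1 else 0)" for x y by (simp add: \<kappa>_def)
    have "(\<integral>\<^sup>+x. indicator A x * (\<integral>\<^sup>+y. indicator B y * h (x + y) \<partial>lborel) \<partial>lborel) =
        (\<integral>\<^sup>+x. indicator A x * (\<integral>\<^sup>+\<tau>. indicator {0<..<b} \<tau> * h (x + \<beta> \<tau>) \<partial>lborel) \<partial>lborel)"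
      by (subst push_\<beta>) simp_all
    also have "\<dots> = (\<integral>\<^sup>+\<sigma>. indicator {0<..<a} \<sigma> * (\<integral>\<^sup>+\<tau>. indicator {0<..<b} \<tau> * h (\<alpha> \<sigma> + \<beta> \<tau>) \<partial>lborel) \<partial>lborel)"
      by (rule push_\<alpha>[symmetric]) measurable
    also have "\<dots> = (\<integral>\<^sup>+\<sigma>. indicator {0<..<a} \<sigma> * ?F \<sigma> +
        indicator {0<..<a} \<sigma> * ?G \<sigma> \<partial>lborel)"
    proof (rule nn_integral_cong)
      fix \<sigma> :: real
      have "(\<integral>\<^sup>+\<tau>. indicator {0<..<b} \<tau> * h (\<alpha> \<sigma> + \<beta> \<tau>) \<partial>lborel) =
        (\<integral>\<^sup>+\<tau>. indicator {0<..<b} \<tau> * \<kappa> \<sigma> \<tau> * h (\<alpha> \<sigma> + \<beta> \<tau>) +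
            indicator {0<..<b} \<tau> * \<kappa> \<tau> \<sigma> * h (\<alpha> \<sigma> + \<beta> \<tau>) \<partial>lborel)"
        using AE_lborel_singleton[of \<sigma>] by (intro nn_integral_cong_AE, eventually_elim) (auto simp: indicator_def \<kappa>)
      also have "\<dots> = ?F \<sigma> +
          ?G \<sigma>"
        by (rule nn_integral_add) measurable
      finally show "indicator {0<..<a} \<sigma> * (\<integral>\<^sup>+\<tau>. indicator {0<..<b} \<tau> * h (\<alpha> \<sigma> + \<beta> \<tau>) \<partial>lborel) =
          indicator {0<..<a} \<sigma> * ?F \<sigma> +
          indicator {0<..<a} \<sigma> * ?G \<sigma>"
        by (simp only: distrib_left)
    qed
    also have "\<dots> = (\<integral>\<^sup>+\<sigma>. indicator {0<..<a} \<sigma> * ?F \<sigma> \<partial>lborel) +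
        (\<integral>\<^sup>+\<sigma>. indicator {0<..<a} \<sigma> * ?G \<sigma> \<partial>lborel)"
      by (rule nn_integral_add) measurable
    also have "(\<integral>\<^sup>+\<sigma>. indicator {0<..<a} \<sigma> * ?F \<sigma> \<partial>lborel) =
        (\<integral>\<^sup>+t. indicator {0<..<min a b} t * ?H1 t \<partial>lborel)"
    proof (rule nn_integral_cong)
      fix t :: real
      show "indicator {0<..<a} t * (\<integral>\<^sup>+\<tau>. indicator {0<..<b} \<tau> * \<kappa> t \<tau> * h (\<alpha> t + \<beta> \<tau>) \<partial>lborel) =
          indicator {0<..<min a b} t * ?H1 t"
      proof (cases "0 < t \<and> t < b")
        case True
        then have "indicator {0<..<b} \<tau> * \<kappa> t \<tau> = (indicator {t<..<b} \<tau> :: ennreal)" for \<tau>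
          by (auto simp: indicator_def \<kappa>)
        with True show ?thesis by (simp add: int1) (simp add: indicator_def)
      next
        case False
        then have "(\<integral>\<^sup>+\<tau>. indicator {0<..<b} \<tau> * \<kappa> t \<tau> * h (\<alpha> t + \<beta> \<tau>) \<partial>lborel) = 0" if "0 < t"
          using that by (intro nn_integral_eq_0I) (auto simp: indicator_def \<kappa>)
        with False show ?thesis by (auto simp: indicator_def \<kappa>)
      qed
    qed
    also have "(\<integral>\<^sup>+\<sigma>. indicator {0<..<a} \<sigma> * ?G \<sigma> \<partial>lborel) =
        (\<integral>\<^sup>+\<sigma>. \<integral>\<^sup>+\<tau>. indicator {0<..<a} \<sigma> * (indicator {0<..<b} \<tau> * \<kappa> \<tau> \<sigma> * h (\<alpha> \<sigma> + \<beta> \<tau>)) \<partial>lborel \<partial>lborel)"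
      by (simp add: nn_integral_cmult)
    also have "\<dots> = (\<integral>\<^sup>+\<tau>. \<integral>\<^sup>+\<sigma>. indicator {0<..<a} \<sigma> * (indicator {0<..<b} \<tau> * \<kappa> \<tau> \<sigma> * h (\<alpha> \<sigma> + \<beta> \<tau>)) \<partial>lborel \<partial>lborel)"
      by (rule lborel_pair.Fubini'[symmetric]) measurable
    also have "\<dots> = (\<integral>\<^sup>+t. indicator {0<..<min a b} t * ?H2 t \<partial>lborel)"
    proof (rule nn_integral_cong)
      fix t :: real
      show "(\<integral>\<^sup>+\<sigma>. indicator {0<..<a} \<sigma> * (indicator {0<..<b} t * \<kappa> t \<sigma> * h (\<alpha> \<sigma> + \<beta> t)) \<partial>lborel) =
          indicator {0<..<min a b} t * ?H2 t"
      proof (cases "0 < t \<and> t < min a b")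
        case True
        then have "indicator {0<..<a} \<sigma> * (indicator {0<..<b} t * \<kappa> t \<sigma> * h (\<alpha> \<sigma> + \<beta> t)) =
            indicator {t<..<a} \<sigma> * h (\<alpha> \<sigma> + \<beta> t)" for \<sigma>
          by (auto simp: indicator_def \<kappa>)
        with True show ?thesis by (simp add: int2)
      next
        case False
        then show ?thesis
          by (subst nn_integral_eq_0I) (auto simp: indicator_def \<kappa>)
      qed
    qed
    also have "(\<integral>\<^sup>+t. indicator {0<..<min a b} t * ?H1 t \<partial>lborel) +
        (\<integral>\<^sup>+t. indicator {0<..<min a b} t * ?H2 t \<partial>lborel) =
        (\<integral>\<^sup>+t. indicator {0<..<min a b} t * ?H1 t +
          indicator {0<..<min a b} t * ?H2 t \<partial>lborel)"
      unfolding S1_def S2_def by (rule nn_integral_add[symmetric]) measurable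
    also have "\<dots> = (\<integral>\<^sup>+t. indicator {0<..<min a b} t * (\<integral>\<^sup>+s. indicator (S1 t \<union> S2 t) s * h s \<partial>lborel) \<partial>lborel)"
    proof (rule nn_integral_cong)
      fix t :: real
      have "(\<integral>\<^sup>+s. indicator (S1 t \<union> S2 t) s * h s \<partial>lborel) =
          (\<integral>\<^sup>+s. indicator (S1 t) s * h s + indicator (S2 t) s * h s \<partial>lborel)"
        using disj[of t] by (intro nn_integral_cong) (auto simp: indicator_def \<kappa>)
      then show "indicator {0<..<min a b} t * ?H1 t +
          indicator {0<..<min a b} t * ?H2 t =
          indicator {0<..<min a b} t * (\<integral>\<^sup>+s. indicator (S1 t \<union> S2 t) s * h s \<partial>lborel)"
        by (simp add: nn_integral_add distrib_left)
    qed
    finally show "(\<integral>\<^sup>+x. indicator A x * (\<integral>\<^sup>+y. indicator B y * h (x + y) \<partial>lborel) \<partial>lborel) =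
       (\<integral>\<^sup>+t. indicator {0<..<min a b} t * (\<integral>\<^sup>+s. indicator (S1 t \<union> S2 t) s * h s \<partial>lborel) \<partial>lborel)" .
  qed
qed

text \<open>Both sides integrate \<open>H s\<close> against the same trapezoid
  \<open>max 0 (min (min a b) ((a + b) / 2 - \<bar>s\<bar>))\<close>. On the left it is the overlap
  of two intervals at displacement \<open>s\<close>, on the right the length of the set of levels
  \<open>t\<close> whose interval contains \<open>s\<close>. So the slice lengths of
  \<open>sumset_slices\<close> reappear, now with centered intervals.\<close>

lemma nn_integral_centered_intervals:
  assumes a: "0 \<le> a" and b: "0 \<le> b" and H[measurable]: "H \<in> borel_measurable borel"
  shows "(\<integral>\<^sup>+x. indicator (centered_interval a) x * (\<integral>\<^sup>+y. indicator (centered_interval b) y * H (x + y) \<partial>lborel) \<partial>lborel) =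
    (\<integral>\<^sup>+t. indicator {0<..<min a b} t * (\<integral>\<^sup>+s. indicator (centered_interval (a + b - 2 * t)) s * H s \<partial>lborel) \<partial>lborel)"
proof -
  have Ioo: "emeasure lborel {l<..<u} = ennreal (max 0 (u - l))" for l u :: real
    by (cases "l \<le> u") (auto simp: max_def)
  have [measurable]: "{p :: real \<times> real. \<bar>snd p\<bar> < (a + b - 2 * fst p) / 2} \<in> sets (borel \<Otimes>\<^sub>M borel)"
    unfolding borel_prod by (intro borel_open open_Collect_less continuous_intros) simp
  have "(\<integral>\<^sup>+x. indicator (centered_interval a) x * (\<integral>\<^sup>+y. indicator (centered_interval b) y * H (x + y) \<partial>lborel) \<partial>lborel) =
      (\<integral>\<^sup>+x. indicator (centered_interval a) x * (\<integral>\<^sup>+s. indicator (centered_interval b) (s - x) * H s \<partial>lborel) \<partial>lborel)"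
  proof (rule nn_integral_cong)
    fix x :: real
    show "indicator (centered_interval a) x * (\<integral>\<^sup>+y. indicator (centered_interval b) y * H (x + y) \<partial>lborel) =
        indicator (centered_interval a) x * (\<integral>\<^sup>+s. indicator (centered_interval b) (s - x) * H s \<partial>lborel)"
      using nn_integral_real_affine[of "\<lambda>s. indicator (centered_interval b) (s - x) * H s" 1 x] by simp
  qed
  also have "\<dots> = (\<integral>\<^sup>+x. \<integral>\<^sup>+s. indicator (centered_interval a) x * (indicator (centered_interval b) (s - x) * H s) \<partial>lborel \<partial>lborel)"
    by (simp add: nn_integral_cmult)
  also have "\<dots> = (\<integral>\<^sup>+s. \<integral>\<^sup>+x. indicator (centered_interval a) x * (indicator (centered_interval b) (s - x) * H s) \<partial>lborel \<partial>lborel)"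
    by (rule lborel_pair.Fubini'[symmetric]) measurable
  also have "\<dots> = (\<integral>\<^sup>+s. ennreal (max 0 (min (min a b) ((a + b) / 2 - \<bar>s\<bar>))) * H s \<partial>lborel)"
  proof (rule nn_integral_cong)
    fix s :: real
    have "(\<integral>\<^sup>+x. indicator (centered_interval a) x * (indicator (centered_interval b) (s - x) * H s) \<partial>lborel) =
        (\<integral>\<^sup>+x. H s * indicator {max (- (a / 2)) (s - b / 2)<..<min (a / 2) (s + b / 2)} x \<partial>lborel)"
      by (intro nn_integral_cong) (auto simp: indicator_def centered_interval_def)
    also have "\<dots> = H s * ennreal (max 0 (min (a / 2) (s + b / 2) - max (- (a / 2)) (s - b / 2)))"
      by (subst nn_integral_cmult) (simp_all add: Ioo)
    also have "max 0 (min (a / 2) (s + b / 2) - max (- (a / 2)) (s - b / 2)) = max 0 (min (min a b) ((a + b) / 2 - \<bar>s\<bar>))"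
      using a b by (auto simp: min_def max_def abs_if field_simps)
    finally show "(\<integral>\<^sup>+x. indicator (centered_interval a) x * (indicator (centered_interval b) (s - x) * H s) \<partial>lborel) =
        ennreal (max 0 (min (min a b) ((a + b) / 2 - \<bar>s\<bar>))) * H s"
      by (simp add: mult.commute)
  qed
  also have "\<dots> = (\<integral>\<^sup>+s. \<integral>\<^sup>+t. indicator {0<..<min a b} t * (indicator {p. \<bar>snd p\<bar> < (a + b - 2 * fst p) / 2} (t, s) * H s) \<partial>lborel \<partial>lborel)"
  proof (rule nn_integral_cong)
    fix s :: real
    have "(\<integral>\<^sup>+t. indicator {0<..<min a b} t * (indicator {p. \<bar>snd p\<bar> < (a + b - 2 * fst p) / 2} (t, s) * H s) \<partial>lborel) =
        (\<integral>\<^sup>+t. H s * indicator {0<..<min (min a b) ((a + b) / 2 - \<bar>s\<bar>)} t \<partial>lborel)"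
      by (intro nn_integral_cong) (auto simp: indicator_def field_simps)
    also have "\<dots> = H s * ennreal (max 0 (min (min a b) ((a + b) / 2 - \<bar>s\<bar>)))"
      by (subst nn_integral_cmult) (simp_all only: emeasure_lborel_singleton Ioo nn_integral_indicator sets_lborel borel_measurable_indicator diff_zero borel_open open_greaterThanLessThan measurable_lborel2)
    finally show "ennreal (max 0 (min (min a b) ((a + b) / 2 - \<bar>s\<bar>))) * H s =
        (\<integral>\<^sup>+t. indicator {0<..<min a b} t * (indicator {p. \<bar>snd p\<bar> < (a + b - 2 * fst p) / 2} (t, s) * H s) \<partial>lborel)"
      by (simp only: mult.commute)
  qed
  also have "\<dots> = (\<integral>\<^sup>+t. \<integral>\<^sup>+s. indicator {0<..<min a b} t * (indicator {p. \<bar>snd p\<bar> < (a + b - 2 * fst p) / 2} (t, s) * H s) \<partial>lborel \<partial>lborel)"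
    by (rule lborel_pair.Fubini') measurable
  also have "\<dots> = (\<integral>\<^sup>+t. indicator {0<..<min a b} t * (\<integral>\<^sup>+s. indicator (centered_interval (a + b - 2 * t)) s * H s \<partial>lborel) \<partial>lborel)"
  proof (rule nn_integral_cong)
    fix t :: real
    have "indicator {p. \<bar>snd p\<bar> < (a + b - 2 * fst p) / 2} (t, s) = (indicator (centered_interval (a + b - 2 * t)) s :: ennreal)" for s
      by (simp add: indicator_def mem_centered_interval)
    then show "(\<integral>\<^sup>+s. indicator {0<..<min a b} t * (indicator {p. \<bar>snd p\<bar> < (a + b - 2 * fst p) / 2} (t, s) * H s) \<partial>lborel) =
        indicator {0<..<min a b} t * (\<integral>\<^sup>+s. indicator (centered_interval (a + b - 2 * t)) s * H s \<partial>lborel)"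
      by (simp add: nn_integral_cmult)
  qed
  finally show ?thesis .
qed

text \<open>Domination is applied to each slice \<open>S t\<close>, whose length is that of the
  corresponding centered slice. With indicators for \<open>h\<close> and \<open>H\<close> this is
  the one-dimensional Riesz inequality.\<close>

lemma rearr_dominated_sum:
  assumes dom: "rearr_dominated h H" and [measurable]: "h \<in> borel_measurable borel" "H \<in> borel_measurable borel"
    and A: "A \<in> sets borel" "bounded A" and B: "B \<in> sets borel" "bounded B"
  shows "(\<integral>\<^sup>+x. indicator A x * (\<integral>\<^sup>+y. indicator B y * h (x + y) \<partial>lborel) \<partial>lborel) \<le>
    (\<integral>\<^sup>+x. indicator (centered_interval (measure lborel A)) x *
      (\<integral>\<^sup>+y. indicator (centered_interval (measure lborel B)) y * H (x + y) \<partial>lborel) \<partial>lborel)"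
proof -
  let ?a = "measure lborel A" and ?b = "measure lborel B"
  obtain S :: "real \<Rightarrow> real set" where S: "\<forall>t. 0 < t \<longrightarrow> t < min ?a ?b \<longrightarrow>
       S t \<in> sets borel \<and> bounded (S t) \<and> measure lborel (S t) = ?a + ?b - 2 * t"
    and eq: "\<forall>h\<in>borel_measurable borel.
       (\<integral>\<^sup>+x. indicator A x * (\<integral>\<^sup>+y. indicator B y * h (x + y) \<partial>lborel) \<partial>lborel) =
       (\<integral>\<^sup>+t. indicator {0<..<min ?a ?b} t * (\<integral>\<^sup>+s. indicator (S t) s * h s \<partial>lborel) \<partial>lborel)"
    using sumset_slices[OF A B] by (elim exE conjE)
  have "(\<integral>\<^sup>+x. indicator A x * (\<integral>\<^sup>+y. indicator B y * h (x + y) \<partial>lborel) \<partial>lborel) =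
      (\<integral>\<^sup>+t. indicator {0<..<min ?a ?b} t * (\<integral>\<^sup>+s. indicator (S t) s * h s \<partial>lborel) \<partial>lborel)"
    by (rule eq[rule_format]) fact
  also have "\<dots> \<le> (\<integral>\<^sup>+t. indicator {0<..<min ?a ?b} t *
      (\<integral>\<^sup>+s. indicator (centered_interval (?a + ?b - 2 * t)) s * H s \<partial>lborel) \<partial>lborel)"
  proof (rule nn_integral_mono)
    fix t :: real
    show "indicator {0<..<min ?a ?b} t * (\<integral>\<^sup>+s. indicator (S t) s * h s \<partial>lborel) \<le>
        indicator {0<..<min ?a ?b} t * (\<integral>\<^sup>+s. indicator (centered_interval (?a + ?b - 2 * t)) s * H s \<partial>lborel)"
    proof (cases "0 < t \<and> t < min ?a ?b")
      case True
      then have "S t \<in> sets borel" "bounded (S t)" "measure lborel (S t) = ?a + ?b - 2 * t"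
        using S by blast+
      then have "(\<integral>\<^sup>+s. indicator (S t) s * h s \<partial>lborel) \<le>
          (\<integral>\<^sup>+s. indicator (centered_interval (?a + ?b - 2 * t)) s * H s \<partial>lborel)"
        using dom unfolding rearr_dominated_def by metis
      then show ?thesis by (rule mult_left_mono) simp
    qed (auto simp: indicator_def)
  qed
  also have "\<dots> = (\<integral>\<^sup>+x. indicator (centered_interval ?a) x *
      (\<integral>\<^sup>+y. indicator (centered_interval ?b) y * H (x + y) \<partial>lborel) \<partial>lborel)"
    by (rule nn_integral_centered_intervals[symmetric]) simp_all
  finally show ?thesis .
qed

lemma measure_lborel_dilate:
  fixes c :: real
  assumes [measurable]: "A \<in> sets borel" and c: "c \<noteq> 0"
  shows "measure lborel {y. y / c \<in> A} = \<bar>c\<bar> * measure lborel A"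
proof -
  have [measurable]: "{y. y / c \<in> A} \<in> sets borel" by measurable
  have "emeasure lborel {y. y / c \<in> A} = \<bar>c\<bar> * emeasure lborel A"
    using nn_integral_real_affine[of "indicator {y. y / c \<in> A}" c 0] c assms(1)
    by (simp add: indicator_def flip: nn_integral_indicator)
  then show ?thesis by (simp add: measure_def enn2real_mult)
qed

lemma bounded_dilate:
  fixes c :: real
  assumes "bounded A" "c \<noteq> 0"
  shows "bounded {y. y / c \<in> A}"
proof -
  have "{y. y / c \<in> A} \<subseteq> (\<lambda>x. c *\<^sub>R x) ` A" using assms(2) by (force simp: image_iff)
  then show ?thesis using bounded_scaling[OF assms(1)] bounded_subset by blast
qed

lemma nn_integral_dilate:
  fixes c :: real
  assumes [measurable]: "A \<in> sets borel" "h \<in> borel_measurable borel" and c: "c \<noteq> 0"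
  shows "ennreal \<bar>c\<bar> * (\<integral>\<^sup>+y. indicator A y * h (s + c * y) \<partial>lborel) =
    (\<integral>\<^sup>+y. indicator {y. y / c \<in> A} y * h (s + y) \<partial>lborel)"
proof -
  have [measurable]: "{y. y / c \<in> A} \<in> sets borel" by measurable
  show ?thesis
    using nn_integral_real_affine[of "\<lambda>y. indicator {y. y / c \<in> A} y * h (s + y)" c 0] c
    by (simp add: indicator_def)
qed

lemma centered_interval_dilate:
  assumes "c \<noteq> 0"
  shows "{y. y / c \<in> centered_interval a} = centered_interval (\<bar>c\<bar> * a)"
proof -
  have "\<bar>y / c\<bar> < a / 2 \<longleftrightarrow> \<bar>y\<bar> < \<bar>c\<bar> * a / 2" for y
    using assms by (simp add: abs_divide pos_divide_less_eq mult_ac)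
  then show ?thesis by (intro set_eqI) (simp only: mem_Collect_eq mem_centered_interval)
qed

text \<open>For \<open>c \<noteq> 0\<close> the coefficient is moved into the set by dilating
  \<open>A\<close>, at the cost of the factor \<open>1 / \<bar>c\<bar>\<close> on both sides. For
  \<open>c = 0\<close> the inner integral is just the measure of \<open>A\<close> times
  \<open>h\<close>, and \<open>A\<close> and its centered interval have equal measure.\<close>

lemma rearr_dominated_convolve:
  assumes dom: "rearr_dominated h H" and h[measurable]: "h \<in> borel_measurable borel" "H \<in> borel_measurable borel"
    and A[measurable]: "A \<in> sets borel" and bA: "bounded A"
  shows "rearr_dominated (\<lambda>s. \<integral>\<^sup>+y. indicator A y * h (s + c * y) \<partial>lborel)
    (\<lambda>s. \<integral>\<^sup>+y. indicator (centered_interval (measure lborel A)) y * H (s + c * y) \<partial>lborel)"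
  unfolding rearr_dominated_def
proof (intro ballI impI)
  fix E :: "real set" assume E: "E \<in> sets borel" "bounded E"
  let ?A' = "centered_interval (measure lborel A)" and ?E' = "centered_interval (measure lborel E)"
  have [measurable]: "E \<in> sets borel" by fact
  show "(\<integral>\<^sup>+x. indicator E x * (\<integral>\<^sup>+y. indicator A y * h (x + c * y) \<partial>lborel) \<partial>lborel) \<le>
      (\<integral>\<^sup>+x. indicator ?E' x * (\<integral>\<^sup>+y. indicator ?A' y * H (x + c * y) \<partial>lborel) \<partial>lborel)"
  proof (cases "c = 0")
    case True
    have a: "emeasure lborel A = emeasure lborel ?A'"
      using bA by (simp add: emeasure_lborel_bounded centered_interval_def)
    have c0: "(\<integral>\<^sup>+x. indicator E x * (\<integral>\<^sup>+y. indicator A y * h (x + c * y) \<partial>lborel) \<partial>lborel) =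
        emeasure lborel A * (\<integral>\<^sup>+x. indicator E x * h x \<partial>lborel)"
      if [measurable]: "E \<in> sets borel" "A \<in> sets borel" "h \<in> borel_measurable borel" for E A h
    proof -
      have "(\<integral>\<^sup>+x. indicator E x * (\<integral>\<^sup>+y. indicator A y * h (x + c * y) \<partial>lborel) \<partial>lborel) =
          (\<integral>\<^sup>+x. indicator E x * (emeasure lborel A * h x) \<partial>lborel)"
        using True by (simp add: nn_integral_multc)
      also have "\<dots> = (\<integral>\<^sup>+x. emeasure lborel A * (indicator E x * h x) \<partial>lborel)"
        by (simp only: mult.left_commute)
      also have "\<dots> = emeasure lborel A * (\<integral>\<^sup>+x. indicator E x * h x \<partial>lborel)"
        by (rule nn_integral_cmult) measurable
      finally show ?thesis .
    qed
    have "(\<integral>\<^sup>+x. indicator E x * (\<integral>\<^sup>+y. indicator A y * h (x + c * y) \<partial>lborel) \<partial>lborel) =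
        emeasure lborel A * (\<integral>\<^sup>+x. indicator E x * h x \<partial>lborel)"
      by (rule c0) measurable
    also have "\<dots> \<le> emeasure lborel ?A' * (\<integral>\<^sup>+x. indicator ?E' x * H x \<partial>lborel)"
      unfolding a using dom E by (intro mult_left_mono) (auto simp: rearr_dominated_def)
    also have "\<dots> = (\<integral>\<^sup>+x. indicator ?E' x * (\<integral>\<^sup>+y. indicator ?A' y * H (x + c * y) \<partial>lborel) \<partial>lborel)"
      by (rule c0[symmetric]) measurable
    finally show ?thesis .
  next
    case False
    let ?cA = "{y. y / c \<in> A}" and ?r = "ennreal (1 / \<bar>c\<bar>)"
    have cA: "?cA \<in> sets borel" by measurable
    have dil: "(\<integral>\<^sup>+y. indicator A y * h (x + c * y) \<partial>lborel) = ?r * (\<integral>\<^sup>+y. indicator {y. y / c \<in> A} y * h (x + y) \<partial>lborel)"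
      if [measurable]: "A \<in> sets borel" "h \<in> borel_measurable borel" for A h x
      unfolding nn_integral_dilate[OF that False, symmetric]
      using False by (simp add: mult.assoc[symmetric] flip: ennreal_mult')
    have "(\<integral>\<^sup>+x. indicator E x * (\<integral>\<^sup>+y. indicator A y * h (x + c * y) \<partial>lborel) \<partial>lborel) =
        ?r * (\<integral>\<^sup>+x. indicator E x * (\<integral>\<^sup>+y. indicator ?cA y * h (x + y) \<partial>lborel) \<partial>lborel)"
      using cA by (simp add: dil mult.left_commute[of _ ?r] nn_integral_cmult)
    also have "\<dots> \<le> ?r * (\<integral>\<^sup>+x. indicator ?E' x *
        (\<integral>\<^sup>+y. indicator (centered_interval (measure lborel ?cA)) y * H (x + y) \<partial>lborel) \<partial>lborel)"
      using E cA bounded_dilate[OF bA False] by (intro mult_left_mono rearr_dominated_sum dom h) auto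
    also have "centered_interval (measure lborel ?cA) = {y. y / c \<in> ?A'}"
      using False by (simp add: measure_lborel_dilate centered_interval_dilate)
    also have "?r * (\<integral>\<^sup>+x. indicator ?E' x * (\<integral>\<^sup>+y. indicator {y. y / c \<in> ?A'} y * H (x + y) \<partial>lborel) \<partial>lborel) =
        (\<integral>\<^sup>+x. indicator ?E' x * (\<integral>\<^sup>+y. indicator ?A' y * H (x + c * y) \<partial>lborel) \<partial>lborel)"
      by (simp add: dil mult.left_commute[of _ ?r] nn_integral_cmult)
    finally show ?thesis .
  qed
qed

text \<open>An intersection has at most the smaller of the two measures, and centered intervals are
  nested, so they attain this bound.\<close>

lemma rearr_dominated_indicator:
  assumes [measurable]: "A \<in> sets borel" and bA: "bounded A"
  shows "rearr_dominated (indicator A) (indicator (centered_interval (measure lborel A)))"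
  unfolding rearr_dominated_def
proof (intro ballI impI)
  fix E :: "real set" assume E[measurable]: "E \<in> sets borel" and bE: "bounded E"
  let ?a = "measure lborel A" and ?e = "measure lborel E"
  have fm: "A \<in> fmeasurable lborel" "E \<in> fmeasurable lborel"
    using emeasure_bounded_finite bA bE by (auto simp: fmeasurable_def)
  have "(\<integral>\<^sup>+x. indicator E x * indicator A x \<partial>lborel) = emeasure lborel (E \<inter> A)"
    by (simp flip: indicator_inter_arith)
  also have "\<dots> = ennreal (measure lborel (E \<inter> A))"
    using bE by (intro emeasure_lborel_bounded) (auto intro: bounded_subset)
  also have "\<dots> \<le> ennreal (min ?e ?a)"
    using fm by (intro ennreal_leI) (auto intro!: measure_mono_fmeasurable)
  also have "\<dots> = emeasure lborel (centered_interval (min ?e ?a))"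
    by (simp add: centered_interval_def min_def)
  also have "centered_interval (min ?e ?a) = centered_interval ?e \<inter> centered_interval ?a"
    by (auto simp: centered_interval_def min_def)
  also have "emeasure lborel (centered_interval ?e \<inter> centered_interval ?a) =
      (\<integral>\<^sup>+x. indicator (centered_interval ?e) x * indicator (centered_interval ?a) x \<partial>lborel)"
    by (simp flip: indicator_inter_arith)
  finally show "(\<integral>\<^sup>+x. indicator E x * indicator A x \<partial>lborel) \<le>
      (\<integral>\<^sup>+x. indicator (centered_interval ?e) x * indicator (centered_interval ?a) x \<partial>lborel)" .
qed

section \<open>Iteration over several coordinates\<close>

interpretation lborel_product: product_sigma_finite "\<lambda>_ :: 'i. lborel :: real measure" ..

text \<open>The offset \<open>s\<close> lets the induction close: the term of the coordinate that is
  split off moves into it.\<close>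

lemma nn_integral_PiM_insert_prod:
  fixes B :: "'i \<Rightarrow> real set" and f :: "real \<Rightarrow> ennreal" and c :: "'i \<Rightarrow> real"
  assumes I: "finite I" "j \<notin> I"
    and B: "\<And>i. i \<in> insert j I \<Longrightarrow> B i \<in> sets borel" and f[measurable]: "f \<in> borel_measurable borel"
  shows "(\<integral>\<^sup>+t. (\<Prod>i\<in>insert j I. indicator (B i) (t i)) * f (s + (\<Sum>i\<in>insert j I. c i * t i)) \<partial>(\<Pi>\<^sub>M i\<in>insert j I. lborel)) =
    (\<integral>\<^sup>+y. indicator (B j) y * (\<integral>\<^sup>+t. (\<Prod>i\<in>I. indicator (B i) (t i)) *
      f ((s + c j * y) + (\<Sum>i\<in>I. c i * t i)) \<partial>(\<Pi>\<^sub>M i\<in>I. lborel)) \<partial>lborel)"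
  proof -
    have [measurable]: "B i \<in> sets borel" if "i \<in> insert j I" for i using B that .
    have "(\<integral>\<^sup>+t. (\<Prod>i\<in>insert j I. indicator (B i) (t i)) * f (s + (\<Sum>i\<in>insert j I. c i * t i)) \<partial>(\<Pi>\<^sub>M i\<in>insert j I. lborel)) =
        (\<integral>\<^sup>+y. \<integral>\<^sup>+t. (\<Prod>i\<in>insert j I. indicator (B i) ((t(j := y)) i)) * f (s + (\<Sum>i\<in>insert j I. c i * (t(j := y)) i)) \<partial>(\<Pi>\<^sub>M i\<in>I. lborel) \<partial>lborel)"
      using I by (intro lborel_product.product_nn_integral_insert_rev) measurable
    also have "\<dots> = (\<integral>\<^sup>+y. \<integral>\<^sup>+t. indicator (B j) y * ((\<Prod>i\<in>I. indicator (B i) (t i)) * f ((s + c j * y) + (\<Sum>i\<in>I. c i * t i))) \<partial>(\<Pi>\<^sub>M i\<in>I. lborel) \<partial>lborel)"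
    proof -
      have 1: "(\<Prod>i\<in>I. indicator (B i) (if i = j then y else t i)) = (\<Prod>i\<in>I. indicator (B i) (t i) :: ennreal)" for y t
        using I by (intro prod.cong) auto
      have 2: "(\<Sum>i\<in>I. c i * (if i = j then y else t i)) = (\<Sum>i\<in>I. c i * t i)" for y t
        using I by (intro sum.cong) auto
      show ?thesis using I by (simp add: 1 2 mult.assoc add.assoc)
    qed
    also have "\<dots> = (\<integral>\<^sup>+y. indicator (B j) y * (\<integral>\<^sup>+t. (\<Prod>i\<in>I. indicator (B i) (t i)) * f ((s + c j * y) + (\<Sum>i\<in>I. c i * t i)) \<partial>(\<Pi>\<^sub>M i\<in>I. lborel)) \<partial>lborel)"
      by (intro nn_integral_cong nn_integral_cmult) measurable
    finally show ?thesis .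
  qed

lemma borel_measurable_PiM_prod:
  fixes B :: "'i \<Rightarrow> real set" and f :: "real \<Rightarrow> ennreal" and c :: "'i \<Rightarrow> real"
  assumes I: "finite I" and B: "\<And>i. i \<in> I \<Longrightarrow> B i \<in> sets borel" and f[measurable]: "f \<in> borel_measurable borel"
  shows "(\<lambda>s. \<integral>\<^sup>+t. (\<Prod>i\<in>I. indicator (B i) (t i)) * f (s + (\<Sum>i\<in>I. c i * t i)) \<partial>(\<Pi>\<^sub>M i\<in>I. lborel)) \<in> borel_measurable borel"
proof -
  interpret I: finite_product_sigma_finite "\<lambda>_ :: 'i. lborel :: real measure" I
    by standard (rule I)
  have [measurable]: "B i \<in> sets borel" if "i \<in> I" for i using B that .
  show ?thesis by measurable
qed

text \<open>Integrating out one coordinate is a convolution with a scaled indicator, so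
  \<open>rearr_dominated_convolve\<close> handles one coordinate per induction step.\<close>

lemma rearr_dominated_PiM:
  fixes A :: "'i \<Rightarrow> real set" and c :: "'i \<Rightarrow> real"
  assumes I: "finite I" and A: "\<And>i. i \<in> I \<Longrightarrow> A i \<in> sets borel" "\<And>i. i \<in> I \<Longrightarrow> bounded (A i)"
    and dom: "rearr_dominated h H" and h[measurable]: "h \<in> borel_measurable borel" "H \<in> borel_measurable borel"
  shows "rearr_dominated
    (\<lambda>s. \<integral>\<^sup>+t. (\<Prod>i\<in>I. indicator (A i) (t i)) * h (s + (\<Sum>i\<in>I. c i * t i)) \<partial>(\<Pi>\<^sub>M i\<in>I. lborel))
    (\<lambda>s. \<integral>\<^sup>+t. (\<Prod>i\<in>I. indicator (centered_interval (measure lborel (A i))) (t i)) *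
       H (s + (\<Sum>i\<in>I. c i * t i)) \<partial>(\<Pi>\<^sub>M i\<in>I. lborel))"
  using I A
proof (induction I)
  case empty
  then show ?case using dom by (simp add: space_PiM_empty emeasure_PiM_empty)
next
  case (insert j I)
  have "rearr_dominated
      (\<lambda>s. \<integral>\<^sup>+y. indicator (A j) y * (\<integral>\<^sup>+t. (\<Prod>i\<in>I. indicator (A i) (t i)) * h ((s + c j * y) + (\<Sum>i\<in>I. c i * t i)) \<partial>(\<Pi>\<^sub>M i\<in>I. lborel)) \<partial>lborel)
      (\<lambda>s. \<integral>\<^sup>+y. indicator (centered_interval (measure lborel (A j))) y * (\<integral>\<^sup>+t. (\<Prod>i\<in>I. indicator (centered_interval (measure lborel (A i))) (t i)) *
         H ((s + c j * y) + (\<Sum>i\<in>I. c i * t i)) \<partial>(\<Pi>\<^sub>M i\<in>I. lborel)) \<partial>lborel)"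
    using insert.prems by (intro rearr_dominated_convolve insert.IH borel_measurable_PiM_prod insert.hyps h) auto
  then show ?case
    using insert.prems insert.hyps by (subst (1 2) nn_integral_PiM_insert_prod) (auto simp: h)
qed

text \<open>The coordinate \<open>j\<close> with non-zero coefficient is kept back:
  \<open>A j\<close>, dilated by \<open>c j\<close>, becomes the test set in the domination relation
  obtained from the other coordinates. If all coefficients were zero, \<open>B = {0}\<close> could
  make the left side positive while the right side vanishes.\<close>

lemma rearrangement_PiM:
  fixes A :: "'i \<Rightarrow> real set" and c :: "'i \<Rightarrow> real"
  assumes I: "finite I" and A: "\<And>i. i \<in> I \<Longrightarrow> A i \<in> sets borel" "\<And>i. i \<in> I \<Longrightarrow> bounded (A i)"
    and B: "B \<in> sets borel" "bounded B" and j: "j \<in> I" "c j \<noteq> 0"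
  shows "(\<integral>\<^sup>+t. (\<Prod>i\<in>I. indicator (A i) (t i)) * indicator B (\<Sum>i\<in>I. c i * t i) \<partial>(\<Pi>\<^sub>M i\<in>I. lborel)) \<le>
    (\<integral>\<^sup>+t. (\<Prod>i\<in>I. indicator (centered_interval (measure lborel (A i))) (t i)) *
       indicator (centered_interval (measure lborel B)) (\<Sum>i\<in>I. c i * t i) \<partial>(\<Pi>\<^sub>M i\<in>I. lborel))"
proof -
  define J where "J = I - {j}"
  have J: "finite J" "j \<notin> J" and I_eq: "I = insert j J" using I j by (auto simp: J_def)
  define h where "h s = (\<integral>\<^sup>+t. (\<Prod>i\<in>J. indicator (A i) (t i)) * indicator B (s + (\<Sum>i\<in>J. c i * t i)) \<partial>(\<Pi>\<^sub>M i\<in>J. lborel))" for s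
  define H where "H s = (\<integral>\<^sup>+t. (\<Prod>i\<in>J. indicator (centered_interval (measure lborel (A i))) (t i)) *
       indicator (centered_interval (measure lborel B)) (s + (\<Sum>i\<in>J. c i * t i)) \<partial>(\<Pi>\<^sub>M i\<in>J. lborel))" for s
  have dom: "rearr_dominated h H"
    unfolding h_def H_def using J I_eq A B by (intro rearr_dominated_PiM rearr_dominated_indicator) auto
  have [measurable]: "h \<in> borel_measurable borel" "H \<in> borel_measurable borel"
    unfolding h_def H_def using J I_eq A B by (auto intro!: borel_measurable_PiM_prod)
  let ?r = "ennreal (1 / \<bar>c j\<bar>)" and ?cA = "{y. y / c j \<in> A j}"
  have [measurable]: "A j \<in> sets borel" using A j by blast
  have cA: "?cA \<in> sets borel" by measurable
  have dil: "(\<integral>\<^sup>+y. indicator E y * f (c j * y) \<partial>lborel) = ?r * (\<integral>\<^sup>+y. indicator {y. y / c j \<in> E} y * f y \<partial>lborel)"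
    if "E \<in> sets borel" "f \<in> borel_measurable borel" for E and f :: "real \<Rightarrow> ennreal"
    using nn_integral_dilate[OF that j(2), of 0, symmetric] j
    by (simp add: mult.assoc[symmetric] flip: ennreal_mult')
  have "(\<integral>\<^sup>+t. (\<Prod>i\<in>I. indicator (A i) (t i)) * indicator B (\<Sum>i\<in>I. c i * t i) \<partial>(\<Pi>\<^sub>M i\<in>I. lborel)) =
      (\<integral>\<^sup>+y. indicator (A j) y * h (c j * y) \<partial>lborel)"
    using nn_integral_PiM_insert_prod[OF J, of A "indicator B" 0 c] A B by (simp add: I_eq h_def)
  also have "\<dots> = ?r * (\<integral>\<^sup>+y. indicator ?cA y * h y \<partial>lborel)"
    by (rule dil) measurable
  also have "\<dots> \<le> ?r * (\<integral>\<^sup>+y. indicator (centered_interval (measure lborel ?cA)) y * H y \<partial>lborel)"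
    using dom cA bounded_dilate[OF A(2)[OF j(1)] j(2)] unfolding rearr_dominated_def
    by (intro mult_left_mono) auto
  also have "centered_interval (measure lborel ?cA) = {y. y / c j \<in> centered_interval (measure lborel (A j))}"
    using j by (simp add: measure_lborel_dilate centered_interval_dilate)
  also have "?r * (\<integral>\<^sup>+y. indicator {y. y / c j \<in> centered_interval (measure lborel (A j))} y * H y \<partial>lborel) =
      (\<integral>\<^sup>+y. indicator (centered_interval (measure lborel (A j))) y * H (c j * y) \<partial>lborel)"
    by (rule dil[symmetric]) measurable
  also have "\<dots> = (\<integral>\<^sup>+t. (\<Prod>i\<in>I. indicator (centered_interval (measure lborel (A i))) (t i)) *
       indicator (centered_interval (measure lborel B)) (\<Sum>i\<in>I. c i * t i) \<partial>(\<Pi>\<^sub>M i\<in>I. lborel))"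
    using nn_integral_PiM_insert_prod[OF J, of "\<lambda>i. centered_interval (measure lborel (A i))"
        "indicator (centered_interval (measure lborel B))" 0 c]
    by (simp add: I_eq H_def)
  finally show ?thesis .
qed

section \<open>Rearrangement on a hyperplane\<close>

lemma nn_integral_lborel_vec:
  fixes f :: "real ^ 'n \<Rightarrow> ennreal"
  assumes [measurable]: "f \<in> borel_measurable borel"
  shows "(\<integral>\<^sup>+x. f x \<partial>lborel) = (\<integral>\<^sup>+t. f (\<chi> i. t i) \<partial>(\<Pi>\<^sub>M i\<in>UNIV. lborel))"
proof -
  let ?P = "\<Pi>\<^sub>M i\<in>(UNIV :: 'n set). (lborel :: real measure)"
  have [measurable]: "(\<lambda>t. \<chi> i. t i) \<in> borel_measurable ?P"
    by (subst borel_measurable_euclidean_space) (auto simp: Basis_vec_def inner_axis)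
  have "lborel = distr ?P borel (\<lambda>t. \<chi> i. t i)"
  proof (rule lborel_eqI)
    fix l u :: "real ^ 'n" assume le: "\<And>b. b \<in> Basis \<Longrightarrow> l \<bullet> b \<le> u \<bullet> b"
    have le': "l $ i \<le> u $ i" for i using le[of "axis i 1"] by (simp add: inner_axis)
    have "(\<lambda>t. \<chi> i. t i) -` box l u \<inter> space ?P = Pi\<^sub>E UNIV (\<lambda>i. {l $ i<..<u $ i})"
      by (auto simp: mem_box_cart space_PiM PiE_iff)
    then have "emeasure (distr ?P borel (\<lambda>t. \<chi> i. t i)) (box l u) = (\<Prod>i\<in>UNIV. ennreal (u $ i - l $ i))"
      using le' by (simp add: emeasure_distr lborel_product.emeasure_PiM)
    also have "\<dots> = ennreal (\<Prod>i\<in>UNIV. (u - l) $ i)"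
      using le' by (simp add: prod_ennreal)
    also have "(\<Prod>i\<in>UNIV. (u - l) $ i) = (\<Prod>b\<in>Basis. (u - l) \<bullet> b)"
    proof -
      have B: "(Basis :: (real ^ 'n) set) = range (\<lambda>i. axis i 1)"
        by (auto simp: Basis_vec_def Basis_real_def)
      have "inj (\<lambda>i :: 'n. axis i (1::real))" by (auto simp: inj_def axis_eq_axis)
      then show ?thesis unfolding B by (subst prod.reindex) (simp_all add: inner_axis)
    qed
    finally show "emeasure (distr ?P borel (\<lambda>t. \<chi> i. t i)) (box l u) = ennreal (\<Prod>b\<in>Basis. (u - l) \<bullet> b)" .
  qed simp
  then have "(\<integral>\<^sup>+x. f x \<partial>lborel) = (\<integral>\<^sup>+x. f x \<partial>distr ?P borel (\<lambda>t. \<chi> i. t i))" by simp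
  then show ?thesis by (simp add: nn_integral_distr)
qed

text \<open>The image of Lebesgue measure under an invertible linear map is again translation
  invariant and finite on balls. The factor is the reciprocal of the absolute determinant; its
  existence is enough, because it multiplies both sides of the later inequality.\<close>

lemma nn_integral_lborel_linear:
  fixes L L' :: "'a::euclidean_space \<Rightarrow> 'a"
  assumes L: "linear L" and L': "linear L'" and inv: "\<And>x. L' (L x) = x" "\<And>x. L (L' x) = x"
  shows "\<exists>k. \<forall>g\<in>borel_measurable borel. (\<integral>\<^sup>+x. g (L x) \<partial>lborel) = k * (\<integral>\<^sup>+x. g x \<partial>lborel)"
proof -
  have [measurable]: "L \<in> borel_measurable borel"
    using L by (rule borel_measurable_linear)
  let ?N = "distr lborel borel L"
  define k where "k = emeasure ?N (cbox 0 One)"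
  have N: "emeasure ?N E = k * emeasure lborel E" if "E \<in> sets borel" for E
    unfolding k_def
  proof (rule translation_invariant_eq_lborel[OF _ _ _ that])
    fix r
    have "L -` cball 0 r \<subseteq> L' ` cball 0 r" using inv by (metis (no_types, opaque_lifting) image_eqI subsetI vimageD)
    moreover have "bounded (L' ` cball 0 r)" using L' by (intro bounded_linear_image) (simp_all add: linear_conv_bounded_linear)
    ultimately have "bounded (L -` cball 0 r)" using bounded_subset by blast
    then show "emeasure ?N (cball 0 r) < \<infinity>"
      by (simp add: emeasure_distr emeasure_bounded_finite[simplified])
  next
    fix z E assume [measurable]: "E \<in> sets (borel :: 'a measure)"
    have [measurable]: "(\<lambda>x. z + x) -` E \<in> sets borel" by (rule measurable_sets_borel[of _ borel]) simp_all
    have "emeasure ?N ((\<lambda>x. z + x) -` E) = (\<integral>\<^sup>+x. indicator E (L (L' z + x)) \<partial>lborel)"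
      using nn_integral_distr[of L lborel borel "indicator ((\<lambda>x. z + x) -` E)"]
      by (simp add: linear_add[OF L] inv indicator_def)
    also have "\<dots> = (\<integral>\<^sup>+x. indicator E (L x) \<partial>lborel)"
      by (rule nn_integral_lborel_translate) measurable
    also have "\<dots> = emeasure ?N E"
      using nn_integral_distr[of L lborel borel "indicator E"] by simp
    finally show "emeasure ?N ((\<lambda>x. z + x) -` E) = emeasure ?N E" .
  qed simp
  have eq: "?N = scale_measure k lborel"
    by (rule measure_eqI) (simp, simp only: sets_distr N emeasure_scale_measure)
  have "(\<integral>\<^sup>+x. g (L x) \<partial>lborel) = k * (\<integral>\<^sup>+x. g x \<partial>lborel)"
    if [measurable]: "g \<in> borel_measurable borel" for g
  proof -
    have "(\<integral>\<^sup>+x. g (L x) \<partial>lborel) = (\<integral>\<^sup>+x. g x \<partial>?N)" by (simp add: nn_integral_distr)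
    also have "\<dots> = k * (\<integral>\<^sup>+x. g x \<partial>lborel)"
      by (subst eq) (simp add: nn_integral_scale_measure)
    finally show ?thesis .
  qed
  then show ?thesis by blast
qed

text \<open>The matrix with rows \<open>z i\<close> sends \<open>x\<close> to its inner products
  with them. Its row \<open>j\<close> is the normal \<open>u\<close>, and the other rows are
  orthogonal to \<open>u\<close>, so thickening the hyperplane along \<open>u\<close> affects only
  coordinate \<open>j\<close>, which is then integrated over the unit interval.\<close>

lemma nn_integral_hyperplane_coordinates:
  fixes z :: "'n \<Rightarrow> real ^ 'n" and u :: "real ^ 'n"
  assumes u: "norm u = 1" and zj: "z j = u" and perp: "\<And>i. i \<noteq> j \<Longrightarrow> u \<bullet> z i = 0"
    and det: "det (\<chi> i. z i) \<noteq> 0"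
  defines "P \<equiv> \<Pi>\<^sub>M i\<in>UNIV - {j}. (lborel :: real measure)"
  shows "\<exists>k. \<forall>g\<in>borel_measurable P.
    (\<integral>\<^sup>+a. g (\<lambda>i\<in>UNIV - {j}. a \<bullet> z i) \<partial>hyperplane_measure u) = k * (\<integral>\<^sup>+t. g t \<partial>P)"
proof -
  let ?A = "\<chi> i. z i" and ?I = "UNIV - {j}"
  obtain A' where A': "?A ** A' = mat 1" "A' ** ?A = mat 1"
    using det unfolding invertible_det_nz[symmetric] invertible_def by blast
  have inv: "A' *v (?A *v x) = x" "?A *v (A' *v x) = x" for x
    by (simp_all add: matrix_vector_mul_assoc A')
  obtain k where k: "\<forall>g\<in>borel_measurable borel. (\<integral>\<^sup>+x. g (?A *v x) \<partial>lborel) = k * (\<integral>\<^sup>+x. g x \<partial>lborel)"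
    using nn_integral_lborel_linear[of "(*v) ?A" "(*v) A'"] inv by (auto simp: matrix_vector_mul_linear)
  let ?c = "foliation_const TYPE(real ^ 'n)"
  have Ax: "(?A *v x) $ i = x \<bullet> z i" for x i
    by (simp add: matrix_vector_mul_component inner_commute)
  have "(\<integral>\<^sup>+a. g (\<lambda>i\<in>?I. a \<bullet> z i) \<partial>hyperplane_measure u) = (?c * k) * (\<integral>\<^sup>+t. g t \<partial>P)"
    if g: "g \<in> borel_measurable P" for g
  proof -
    have [measurable]: "g \<in> borel_measurable (\<Pi>\<^sub>M i\<in>?I. (lborel :: real measure))"
      using g by (simp add: P_def)
    define F where "F x = g (\<lambda>i\<in>?I. x $ i) * indicator {0..1} (x $ j)" for x :: "real ^ 'n"
    have vn[measurable]: "(\<lambda>x. x $ i) \<in> borel_measurable borel" for i :: 'n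
      by (intro borel_measurable_continuous_onI continuous_intros)
    have [measurable]: "(\<lambda>x :: real ^ 'n. \<lambda>i\<in>?I. x $ i) \<in> borel \<rightarrow>\<^sub>M (\<Pi>\<^sub>M i\<in>?I. lborel)"
      by (rule measurable_restrict) simp
    have F[measurable]: "F \<in> borel_measurable borel" unfolding F_def by measurable
    have [measurable]: "(\<lambda>x. ?A *v x) \<in> borel_measurable borel"
      by (intro borel_measurable_continuous_onI matrix_vector_mult_linear_continuous_on)
    have "(\<integral>\<^sup>+a. g (\<lambda>i\<in>?I. a \<bullet> z i) \<partial>hyperplane_measure u) =
        (\<integral>\<^sup>+a. \<integral>\<^sup>+s. F (?A *v (a + s *\<^sub>R u)) \<partial>lborel \<partial>hyperplane_measure u)"
    proof (rule nn_integral_cong)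
      fix a :: "real ^ 'n"
      have 1: "(\<lambda>i\<in>?I. (?A *v (a + s *\<^sub>R u)) $ i) = (\<lambda>i\<in>?I. a \<bullet> z i)" for s
        using perp by (intro restrict_ext) (simp add: Ax inner_add_left)
      have 2: "(?A *v (a + s *\<^sub>R u)) $ j = a \<bullet> u + s" for s
        using u by (simp add: Ax zj inner_add_left dot_square_norm)
      show "g (\<lambda>i\<in>?I. a \<bullet> z i) = (\<integral>\<^sup>+s. F (?A *v (a + s *\<^sub>R u)) \<partial>lborel)"
        unfolding F_def 1 2 by (simp add: nn_integral_cmult nn_integral_unit_slab)
    qed
    also have "\<dots> = ?c * (\<integral>\<^sup>+x. F (?A *v x) \<partial>lborel)"
      by (rule nn_integral_foliation[OF u]) measurable
    also have "\<dots> = (?c * k) * (\<integral>\<^sup>+x. F x \<partial>lborel)"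
      using k F by (simp add: mult.assoc)
    also have "(\<integral>\<^sup>+x. F x \<partial>lborel) = (\<integral>\<^sup>+t. F (\<chi> i. t i) \<partial>(\<Pi>\<^sub>M i\<in>insert j ?I. lborel))"
      using nn_integral_lborel_vec[OF F] by (simp add: insert_absorb)
    also have "\<dots> = (\<integral>\<^sup>+t. \<integral>\<^sup>+y. F (\<chi> i. (t(j := y)) i) \<partial>lborel \<partial>P)"
      unfolding P_def
    proof (rule lborel_product.product_nn_integral_insert)
      have "(\<lambda>t. \<chi> i. t i) \<in> borel_measurable (\<Pi>\<^sub>M i\<in>insert j ?I. lborel)"
        by (subst borel_measurable_euclidean_space) (auto simp: Basis_vec_def inner_axis)
      then show "(\<lambda>t. F (\<chi> i. t i)) \<in> borel_measurable (\<Pi>\<^sub>M i\<in>insert j ?I. lborel)"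
        by measurable
    qed auto
    also have "\<dots> = (\<integral>\<^sup>+t. g t \<partial>P)"
    proof (rule nn_integral_cong)
      fix t assume "t \<in> space P"
      then have "(\<lambda>i\<in>?I. t i) = t" by (auto simp: P_def space_PiM PiE_iff extensional_def restrict_def)
      moreover have "(\<lambda>i\<in>?I. if i = j then y else t i) = (\<lambda>i\<in>?I. t i)" for y
        by (intro restrict_ext) auto
      ultimately show "(\<integral>\<^sup>+y. F (\<chi> i. (t(j := y)) i) \<partial>lborel) = g t"
        by (simp add: F_def nn_integral_cmult cong: restrict_cong)
    qed
    finally show ?thesis .
  qed
  then show ?thesis by blast
qed

text \<open>Expanding \<open>y\<close> in the basis \<open>z\<close> turns
  \<open>a \<bullet> y\<close> into a linear form in the coordinates \<open>a \<bullet> z i\<close>.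
  The coefficient of \<open>u\<close> is zero because \<open>y\<close> is orthogonal to
  \<open>u\<close>, and some other coefficient is non-zero because \<open>y\<close> is. This is then
  the situation of \<open>rearrangement_PiM\<close>.\<close>

lemma hyperplane_rearrangement:
  fixes z :: "'n \<Rightarrow> real ^ 'n" and u y :: "real ^ 'n" and A :: "'n \<Rightarrow> real set"
  assumes u: "norm u = 1" and zj: "z j = u" and perp: "\<And>i. i \<noteq> j \<Longrightarrow> u \<bullet> z i = 0"
    and det: "det (\<chi> i. z i) \<noteq> 0" and y: "u \<bullet> y = 0" "y \<noteq> 0"
    and A: "\<And>i. A i \<in> sets borel" "\<And>i. bounded (A i)" and B: "B \<in> sets borel" "bounded B"
  shows "(\<integral>\<^sup>+a. (\<Prod>i\<in>UNIV - {j}. indicator (A i) (a \<bullet> z i)) * indicator B (a \<bullet> y) \<partial>hyperplane_measure u) \<le>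
    (\<integral>\<^sup>+a. (\<Prod>i\<in>UNIV - {j}. indicator (centered_interval (measure lborel (A i))) (a \<bullet> z i)) *
      indicator (centered_interval (measure lborel B)) (a \<bullet> y) \<partial>hyperplane_measure u)"
proof -
  let ?A = "\<chi> i. z i" and ?I = "UNIV - {j}"
  let ?P = "\<Pi>\<^sub>M i\<in>?I. (lborel :: real measure)"
  have "det (transpose ?A) \<noteq> 0" using det by (simp add: det_transpose)
  then obtain A' where "transpose ?A ** A' = mat 1"
    unfolding invertible_det_nz[symmetric] invertible_def by blast
  then have "transpose ?A *v (A' *v y) = y" by (simp add: matrix_vector_mul_assoc)
  then obtain c where "transpose ?A *v c = y" by blast
  then have c: "y = (\<Sum>i\<in>UNIV. c $ i *\<^sub>R z i)"
    by (simp add: matrix_mult_sum column_transpose row_def scalar_mult_eq_scaleR vec_lambda_eta)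
  have split: "x \<bullet> y = c $ j * (x \<bullet> u) + (\<Sum>i\<in>?I. c $ i * (x \<bullet> z i))" for x
  proof -
    have "x \<bullet> y = (\<Sum>i\<in>UNIV. c $ i * (x \<bullet> z i))"
      by (subst c) (simp add: inner_sum_right)
    then show ?thesis by (simp add: sum.remove[of UNIV j] zj)
  qed
  have "c $ j = 0"
    using split[of u] y perp u by (simp add: dot_square_norm)
  with split have ay: "x \<bullet> y = (\<Sum>i\<in>?I. c $ i * (x \<bullet> z i))" for x by simp
  obtain i0 where i0: "i0 \<in> ?I" "c $ i0 \<noteq> 0"
  proof (rule ccontr)
    assume "\<not> thesis"
    then have "c $ i = 0" if "i \<in> ?I" for i using that \<open>\<And>i0. i0 \<in> ?I \<Longrightarrow> c $ i0 \<noteq> 0 \<Longrightarrow> thesis\<close> by blast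
    then have "y \<bullet> y = 0" unfolding ay by simp
    then show False using y by simp
  qed
  obtain k where k: "\<forall>g\<in>borel_measurable ?P.
      (\<integral>\<^sup>+a. g (\<lambda>i\<in>?I. a \<bullet> z i) \<partial>hyperplane_measure u) = k * (\<integral>\<^sup>+t. g t \<partial>?P)"
    using nn_integral_hyperplane_coordinates[OF u zj perp det] by blast
  have eq: "(\<integral>\<^sup>+a. (\<Prod>i\<in>?I. indicator (A i) (a \<bullet> z i)) * indicator B (a \<bullet> y) \<partial>hyperplane_measure u) =
      k * (\<integral>\<^sup>+t. (\<Prod>i\<in>?I. indicator (A i) (t i)) * indicator B (\<Sum>i\<in>?I. c $ i * t i) \<partial>?P)"
    if [measurable]: "\<And>i. A i \<in> sets borel" "B \<in> sets borel" for A :: "'n \<Rightarrow> real set" and B :: "real set"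
  proof -
    have "(\<integral>\<^sup>+a. (\<Prod>i\<in>?I. indicator (A i) ((\<lambda>i\<in>?I. a \<bullet> z i) i)) * indicator B (\<Sum>i\<in>?I. c $ i * (\<lambda>i\<in>?I. a \<bullet> z i) i) \<partial>hyperplane_measure u) =
        k * (\<integral>\<^sup>+t. (\<Prod>i\<in>?I. indicator (A i) (t i)) * indicator B (\<Sum>i\<in>?I. c $ i * t i) \<partial>?P)"
      by (rule k[rule_format]) measurable
    then show ?thesis by (simp add: ay)
  qed
  show ?thesis
    unfolding eq[OF A(1) B(1)] eq[OF centered_interval_measurable centered_interval_measurable]
    using A B i0 by (intro mult_left_mono rearrangement_PiM[of _ A B i0 "\<lambda>i. c $ i"]) auto
qed

section \<open>Almost sure linear independence\<close>

text \<open>An exchange argument: starting from the basis \<open>e\<close>, rows are replaced by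
  random vectors one at a time. The determinant is linear in the replaced row and non-zero at
  \<open>e j\<close> by the induction hypothesis, so the assumption on \<open>Y\<close> excludes its
  zeros almost surely.\<close>

lemma AE_PiM_det_nonzero:
  fixes Y :: "'w \<Rightarrow> real ^ 'n" and e :: "'n \<Rightarrow> real ^ 'n"
  assumes M: "sigma_finite_measure M" and Y[measurable]: "Y \<in> borel_measurable M"
    and J: "\<And>v j. j \<in> J \<Longrightarrow> v \<bullet> e j \<noteq> 0 \<Longrightarrow> AE w in M. v \<bullet> Y w \<noteq> 0"
    and e: "det (\<chi> i. e i) \<noteq> 0"
  shows "AE w in (\<Pi>\<^sub>M i\<in>J. M). det (\<chi> i. if i \<in> J then Y (w i) else e i) \<noteq> 0"
proof -
  interpret M: sigma_finite_measure M by fact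
  interpret P: product_sigma_finite "\<lambda>_ :: 'n. M" ..
  have fin: "finite J" by simp
  have vn[measurable]: "(\<lambda>x. x $ i) \<in> borel_measurable borel" for i :: 'n
    by (intro borel_measurable_continuous_onI continuous_intros)
  have meas[measurable]: "(\<lambda>w. det (\<chi> i. if i \<in> J then Y (w i) else e i)) \<in> borel_measurable (\<Pi>\<^sub>M i\<in>J. M)" for J
  proof -
    have "(\<lambda>w. (if i \<in> J then Y (w i) else e i) $ p) \<in> borel_measurable (\<Pi>\<^sub>M i\<in>J. M)" for i p
      by (cases "i \<in> J") simp_all
    then show ?thesis unfolding det_def by simp
  qed
  show ?thesis
    using fin J
  proof (induction J)
    case empty
    then show ?case using e by simp
  next
    case (insert j J)
    let ?R = "\<lambda>J w. \<chi> i. if i \<in> J then Y (w i) else e i"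
    let ?f = "\<lambda>w. indicator {0} (det (?R (insert j J) w)) :: ennreal"
    have IH: "AE w in (\<Pi>\<^sub>M i\<in>J. M). det (?R J w) \<noteq> 0"
      using insert.prems by (intro insert.IH) auto
    have "(\<integral>\<^sup>+w. ?f w \<partial>(\<Pi>\<^sub>M i\<in>insert j J. M)) = (\<integral>\<^sup>+w. \<integral>\<^sup>+y. ?f (w(j := y)) \<partial>M \<partial>(\<Pi>\<^sub>M i\<in>J. M))"
      using insert.hyps by (intro P.product_nn_integral_insert) measurable
    also have "\<dots> = (\<integral>\<^sup>+w. 0 \<partial>(\<Pi>\<^sub>M i\<in>J. M))"
    proof (rule nn_integral_cong_AE, use IH in eventually_elim)
      fix w assume w: "det (?R J w) \<noteq> 0"
      define r where "r y = det (\<chi> i. if i = j then y else ?R J w $ i)" for y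
      have "linear r"
      proof (rule linearI)
        show "r (x + y) = r x + r y" for x y
          unfolding r_def by (rule det_row_add)
        show "r (c *\<^sub>R x) = c *\<^sub>R r x" for c x
          unfolding r_def scalar_mult_eq_scaleR[symmetric] real_scaleR_def by (rule det_row_mul)
      qed
      \<comment> \<open>The vector representing the linear functional \<open>r\<close>, that is, the
        cofactors of row \<open>j\<close>.\<close>
      define v where "v = adjoint r 1"
      have v: "v \<bullet> y = r y" for y
        using adjoint_works[OF \<open>linear r\<close>, of y 1] by (simp add: v_def inner_commute)
      have "(\<chi> i. if i = j then e j else ?R J w $ i) = ?R J w"
        using insert.hyps by (simp add: vec_eq_iff)
      then have "v \<bullet> e j \<noteq> 0" using w unfolding v r_def by simp
      then have AE_v: "AE y in M. v \<bullet> Y y \<noteq> 0" using insert.prems by blast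
      have eqR: "?R (insert j J) (w(j := y)) = (\<chi> i. if i = j then Y y else ?R J w $ i)" for y
        using insert.hyps by (auto simp: vec_eq_iff)
      from AE_v have "AE y in M. ?f (w(j := y)) = 0"
      proof eventually_elim
        case (elim y)
        then show ?case unfolding eqR v r_def by (simp only: indicator_def singleton_iff of_bool_eq)
      qed
      then show "(\<integral>\<^sup>+y. ?f (w(j := y)) \<partial>M) = 0"
        by (subst nn_integral_cong_AE) auto
    qed
    finally have "(\<integral>\<^sup>+w. ?f w \<partial>(\<Pi>\<^sub>M i\<in>insert j J. M)) = 0" by simp
    then have "AE w in (\<Pi>\<^sub>M i\<in>insert j J. M). ?f w = 0"
      by (subst (asm) nn_integral_0_iff_AE) measurable
    then show ?case by eventually_elim (auto simp: indicator_def split: if_splits)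
  qed
qed

text \<open>The standard basis is reflected so that its vector \<open>j\<close> becomes
  \<open>u\<close>. It is the starting point of the exchange argument.\<close>

lemma exists_orthonormal_rows:
  fixes u :: "real ^ 'n"
  assumes u: "norm u = 1"
  shows "\<exists>e. e j = u \<and> (\<forall>i. i \<noteq> j \<longrightarrow> u \<bullet> e i = 0) \<and> det (\<chi> i. e i) \<noteq> 0"
proof -
  have "norm (axis j (1::real) :: real ^ 'n) = 1" by simp
  then obtain T where T: "linear T" "\<And>x y. T x \<bullet> T y = x \<bullet> y" "T (axis j 1) = u" "\<And>x. T (T x) = x"
    using exists_reflection u by metis
  let ?E = "\<chi> i. T (axis i 1)"
  have "(?E ** transpose ?E) $ i $ k = T (axis i 1) \<bullet> T (axis k 1)" for i k
    by (simp add: matrix_matrix_mult_def transpose_def inner_vec_def)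
  then have "?E ** transpose ?E = mat 1"
    by (simp add: vec_eq_iff T(2) inner_axis_axis mat_def inner_real_def)
  then have "det ?E * det ?E = 1" by (metis det_I det_mul det_transpose)
  then have "det ?E \<noteq> 0" by auto
  moreover have "u \<bullet> T (axis i 1) = 0" if "i \<noteq> j" for i
    using that T(2)[of "axis j 1" "axis i 1"] by (simp add: T(3) inner_axis_axis)
  ultimately show ?thesis using T(3) by (intro exI[of _ "\<lambda>i. T (axis i 1)"]) auto
qed

text \<open>The \<open>n\<close>-th power is expanded into an integral over \<open>n\<close> independent parameters. For almost all
  of them, \<open>n - 1\<close> of the vectors \<open>Y w\<close> are a basis of the hyperplane and the last one is non-zero.\<close>

lemma nn_integral_hyperplane_power_rearrangement:
  fixes u :: "real ^ 'n" and M :: "'w measure" and Y :: "'w \<Rightarrow> real ^ 'n" and D :: "('w \<times> real) set"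
  assumes n: "CARD('n) \<ge> 2" and u: "norm u = 1" and M: "sigma_finite_measure M"
    and Y[measurable]: "Y \<in> borel_measurable M" and perp: "\<And>w. u \<bullet> Y w = 0"
    and nondeg: "\<And>v e. u \<bullet> e = 0 \<Longrightarrow> v \<bullet> e \<noteq> 0 \<Longrightarrow> AE w in M. v \<bullet> Y w \<noteq> 0"
    and D[measurable]: "D \<in> sets (M \<Otimes>\<^sub>M borel)" and bd: "\<And>w. bounded (Pair w -` D)"
  shows "(\<integral>\<^sup>+a. (\<integral>\<^sup>+w. indicator (Pair w -` D) (a \<bullet> Y w) \<partial>M) ^ CARD('n) \<partial>hyperplane_measure u) \<le>
    (\<integral>\<^sup>+a. (\<integral>\<^sup>+w. indicator (centered_interval (measure lborel (Pair w -` D))) (a \<bullet> Y w) \<partial>M) ^ CARD('n)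
       \<partial>hyperplane_measure u)"
proof -
  \<comment> \<open>An arbitrary index, reserved for the normal \<open>u\<close>; the remaining
    \<open>n - 1\<close> indices carry the random basis of the hyperplane.\<close>
  define j :: 'n where "j = undefined"
  let ?I = "UNIV - {j}"
  let ?\<mu> = "hyperplane_measure u"
  let ?P = "\<Pi>\<^sub>M i\<in>?I. M"
  let ?C = "\<lambda>w. centered_interval (measure lborel (Pair w -` D))"
  interpret M: sigma_finite_measure M by fact
  interpret \<mu>: sigma_finite_measure ?\<mu> by (rule sigma_finite_hyperplane_measure[OF u])
  interpret P: product_sigma_finite "\<lambda>_ :: 'n. M" ..
  interpret PI: finite_product_sigma_finite "\<lambda>_ :: 'n. M" ?I by standard simp
  interpret P\<mu>: pair_sigma_finite ?P ?\<mu> ..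
  interpret M\<mu>: pair_sigma_finite M ?\<mu> ..
  \<comment> \<open>One factor of the power is kept apart with its own variable \<open>v\<close>:
    the factors over \<open>?I\<close> supply the basis, and \<open>Y v\<close> is the vector to be
    expanded in it.\<close>
  have expand: "(\<integral>\<^sup>+a. (\<integral>\<^sup>+w. F w (a \<bullet> Y w) \<partial>M) ^ CARD('n) \<partial>?\<mu>) =
      (\<integral>\<^sup>+w. \<integral>\<^sup>+v. \<integral>\<^sup>+a. (\<Prod>i\<in>?I. F (w i) (a \<bullet> Y (w i))) * F v (a \<bullet> Y v) \<partial>?\<mu> \<partial>M \<partial>?P)"
    if F: "case_prod F \<in> borel_measurable (M \<Otimes>\<^sub>M borel)" for F :: "'w \<Rightarrow> real \<Rightarrow> ennreal"
  proof -
    let ?G = "\<lambda>w v a. (\<Prod>i\<in>?I. F (w i) (a \<bullet> Y (w i))) * F v (a \<bullet> Y v)"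
    have [measurable]: "(\<lambda>x. F (f x) (g x)) \<in> borel_measurable N"
      if "f \<in> N \<rightarrow>\<^sub>M M" "g \<in> borel_measurable N" for f g and N :: "'z measure"
      using measurable_compose[OF measurable_Pair[OF that] F] by simp
    have "(\<integral>\<^sup>+a. (\<integral>\<^sup>+w. F w (a \<bullet> Y w) \<partial>M) ^ CARD('n) \<partial>?\<mu>) =
        (\<integral>\<^sup>+a. \<integral>\<^sup>+w. (\<integral>\<^sup>+v. ?G w v a \<partial>M) \<partial>?P \<partial>?\<mu>)"
    proof (rule nn_integral_cong)
      fix a :: "real ^ 'n"
      let ?\<Phi> = "\<integral>\<^sup>+w. F w (a \<bullet> Y w) \<partial>M"
      have "?\<Phi> ^ CARD('n) = (\<Prod>i\<in>?I. ?\<Phi>) * ?\<Phi>"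
        by (simp add: card_Diff_singleton power_Suc2[symmetric] del: power_Suc)
      also have "(\<Prod>i\<in>?I. ?\<Phi>) = (\<integral>\<^sup>+w. (\<Prod>i\<in>?I. F (w i) (a \<bullet> Y (w i))) \<partial>?P)"
        by (rule P.product_nn_integral_prod[symmetric]) simp_all
      also have "\<dots> * ?\<Phi> = (\<integral>\<^sup>+w. (\<Prod>i\<in>?I. F (w i) (a \<bullet> Y (w i))) * ?\<Phi> \<partial>?P)"
        by (rule nn_integral_multc[symmetric]) measurable
      also have "\<dots> = (\<integral>\<^sup>+w. (\<integral>\<^sup>+v. ?G w v a \<partial>M) \<partial>?P)"
        by (intro nn_integral_cong nn_integral_cmult[symmetric]) measurable
      finally show "?\<Phi> ^ CARD('n) = (\<integral>\<^sup>+w. (\<integral>\<^sup>+v. ?G w v a \<partial>M) \<partial>?P)" .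
    qed
    also have "\<dots> = (\<integral>\<^sup>+w. \<integral>\<^sup>+a. (\<integral>\<^sup>+v. ?G w v a \<partial>M) \<partial>?\<mu> \<partial>?P)"
      by (rule P\<mu>.Fubini') measurable
    also have "\<dots> = (\<integral>\<^sup>+w. \<integral>\<^sup>+v. \<integral>\<^sup>+a. ?G w v a \<partial>?\<mu> \<partial>M \<partial>?P)"
    proof (rule nn_integral_cong)
      fix w assume w: "w \<in> space ?P"
      have "(\<lambda>a. F (w i) (a \<bullet> Y (w i))) \<in> borel_measurable borel" if "i \<in> ?I" for i
      proof -
        have [measurable]: "w i \<in> space M" using w that by (auto simp: space_PiM PiE_iff)
        show ?thesis by measurable
      qed
      then have [measurable]: "(\<lambda>a. \<Prod>i\<in>?I. F (w i) (a \<bullet> Y (w i))) \<in> borel_measurable borel"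
        by (rule borel_measurable_prod_ennreal)
      show "(\<integral>\<^sup>+a. (\<integral>\<^sup>+v. ?G w v a \<partial>M) \<partial>?\<mu>) =
          (\<integral>\<^sup>+v. \<integral>\<^sup>+a. ?G w v a \<partial>?\<mu> \<partial>M)"
        by (rule M\<mu>.Fubini') measurable
    qed
    finally show ?thesis .
  qed
  have D_w: "Pair w -` D \<in> sets borel" for w by (rule sets_Pair1) measurable
  have [measurable]: "(\<lambda>w. measure lborel (Pair w -` D)) \<in> borel_measurable M"
  proof -
    have "(\<lambda>w. emeasure lborel (Pair w -` D)) \<in> borel_measurable M"
      by (rule lborel.measurable_emeasure_Pair) measurable
    then show ?thesis unfolding measure_def by measurable
  qed
  have F1: "(\<lambda>(w, s). indicator (Pair w -` D) s) \<in> borel_measurable (M \<Otimes>\<^sub>M borel)"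
  proof -
    have "(\<lambda>(w, s). indicator (Pair w -` D) s) = (indicator D :: _ \<Rightarrow> ennreal)"
      by (auto simp: indicator_def)
    then show ?thesis by simp
  qed
  have F2: "(\<lambda>(w, s). indicator (?C w) s :: ennreal) \<in> borel_measurable (M \<Otimes>\<^sub>M borel)"
  proof -
    have "{p \<in> space (M \<Otimes>\<^sub>M borel). \<bar>snd p\<bar> < measure lborel (Pair (fst p) -` D) / 2} \<in> sets (M \<Otimes>\<^sub>M borel)"
      by measurable
    then have "(indicator {p \<in> space (M \<Otimes>\<^sub>M borel). \<bar>snd p\<bar> < measure lborel (Pair (fst p) -` D) / 2} :: _ \<Rightarrow> ennreal)
        \<in> borel_measurable (M \<Otimes>\<^sub>M borel)" by (rule borel_measurable_indicator)
    then show ?thesis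
      by (rule measurable_cong[THEN iffD1, rotated]) (auto simp: indicator_def mem_centered_interval)
  qed
  obtain e where e: "e j = u" "\<And>i. i \<noteq> j \<Longrightarrow> u \<bullet> e i = 0" "det (\<chi> i. e i) \<noteq> 0"
    using exists_orthonormal_rows[OF u, of j] by blast
  let ?G1 = "\<lambda>w v a. (\<Prod>i\<in>?I. indicator (Pair (w i) -` D) (a \<bullet> Y (w i))) * indicator (Pair v -` D) (a \<bullet> Y v) :: ennreal"
    and ?G2 = "\<lambda>w v a. (\<Prod>i\<in>?I. indicator (?C (w i)) (a \<bullet> Y (w i))) * indicator (?C v) (a \<bullet> Y v) :: ennreal"
  have AE_det: "AE w in ?P. det (\<chi> i. if i \<in> ?I then Y (w i) else e i) \<noteq> 0"
    using e(2,3) by (intro AE_PiM_det_nonzero M Y nondeg) auto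
  \<comment> \<open>Dimension at least two enters here: the hyperplane contains a non-zero vector
    \<open>e i\<close>, and \<open>nondeg\<close> for it shows that \<open>Y v\<close> is almost
    surely non-zero.\<close>
  obtain i where "i \<noteq> j"
  proof (rule ccontr)
    assume "\<not> thesis"
    then have "(UNIV :: 'n set) = {j}" using that by auto
    then have "CARD('n) = card {j}" by (rule arg_cong)
    then show False using n by simp
  qed
  have "e i \<noteq> 0"
  proof
    assume "e i = 0"
    then have "row i (\<chi> i. e i) = 0" by (simp add: row_def vec_eq_iff)
    then show False using e(3) det_zero_row(1) by blast
  qed
  then have "AE v in M. e i \<bullet> Y v \<noteq> 0"
    using e(2)[OF \<open>i \<noteq> j\<close>] by (intro nondeg[of "e i"]) auto
  then have AE_nz: "AE v in M. Y v \<noteq> 0" by eventually_elim auto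
  have "(\<integral>\<^sup>+w. \<integral>\<^sup>+v. \<integral>\<^sup>+a. ?G1 w v a \<partial>?\<mu> \<partial>M \<partial>?P) \<le>
      (\<integral>\<^sup>+w. \<integral>\<^sup>+v. \<integral>\<^sup>+a. ?G2 w v a \<partial>?\<mu> \<partial>M \<partial>?P)"
  proof (rule nn_integral_mono_AE, use AE_det in eventually_elim)
    fix w assume w: "det (\<chi> i. if i \<in> ?I then Y (w i) else e i) \<noteq> 0"
    let ?z = "\<lambda>i. if i \<in> ?I then Y (w i) else e i"
    show "(\<integral>\<^sup>+v. \<integral>\<^sup>+a. ?G1 w v a \<partial>?\<mu> \<partial>M) \<le>
      (\<integral>\<^sup>+v. \<integral>\<^sup>+a. ?G2 w v a \<partial>?\<mu> \<partial>M)"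
    proof (rule nn_integral_mono_AE, use AE_nz in eventually_elim)
      fix v assume v: "Y v \<noteq> 0"
      have "(\<integral>\<^sup>+a. (\<Prod>i\<in>?I. indicator (Pair (w i) -` D) (a \<bullet> ?z i)) * indicator (Pair v -` D) (a \<bullet> Y v) \<partial>?\<mu>) \<le>
          (\<integral>\<^sup>+a. (\<Prod>i\<in>?I. indicator (?C (w i)) (a \<bullet> ?z i)) * indicator (?C v) (a \<bullet> Y v) \<partial>?\<mu>)"
        using w v e(1) perp by (intro hyperplane_rearrangement u D_w bd) auto
      then show "(\<integral>\<^sup>+a. ?G1 w v a \<partial>?\<mu>) \<le>
          (\<integral>\<^sup>+a. ?G2 w v a \<partial>?\<mu>)"
        by simp
    qed
  qed
  then show ?thesis
    using expand[OF F1] expand[OF F2] by simp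
qed

section \<open>Intersection bodies and Steiner symmetrization\<close>

text \<open>The graph is weighted by the measure of its shadow on the hyperplane orthogonal to
  \<open>u\<close>, not by its own Hausdorff measure. The omitted tilt is the factor
  \<open>\<bar>\<theta> \<bullet> u\<bar>\<close> in \<open>graph_integral_eq_radial\<close>. The
  value depends on \<open>a\<close> only modulo \<open>u\<close>, which is why any multiple of a
  normal vector may be inserted.\<close>

definition graph_integral :: "'a::euclidean_space \<Rightarrow> ('a \<Rightarrow> real) \<Rightarrow> 'a \<Rightarrow> ennreal" where
  "graph_integral u g a = (\<integral>\<^sup>+y. ennreal (g (y - (y \<bullet> a) *\<^sub>R u)) \<partial>hyperplane_measure u)"

lemma intersection_radial_hyperplane:
  fixes \<theta> :: "'a::euclidean_space"
  assumes [measurable]: "g \<in> borel_measurable borel" and g0: "\<And>x. 0 \<le> g x"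
  shows "intersection_radial g \<theta> = enn2real (\<integral>\<^sup>+y. ennreal (g y) \<partial>hyperplane_measure \<theta>)"
proof -
  have "intersection_radial g \<theta> =
      enn2real (\<integral>\<^sup>+y. ennreal (indicator ({\<theta>}\<^sup>\<bottom>) y * g y) \<partial>hausdorff_measure (DIM('a) - 1))"
    unfolding intersection_radial_def set_lebesgue_integral_def
    using g0 by (subst integral_eq_nn_integral) simp_all
  also have "(\<integral>\<^sup>+y. ennreal (indicator ({\<theta>}\<^sup>\<bottom>) y * g y) \<partial>hausdorff_measure (DIM('a) - 1)) =
      (\<integral>\<^sup>+y. ennreal (g y) \<partial>hyperplane_measure \<theta>)"
    unfolding hyperplane_measure_def
    by (subst nn_integral_density) (auto intro!: nn_integral_cong simp: indicator_def)
  finally show ?thesis .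
qed

lemma nn_integral_hyperplane_finite:
  fixes \<theta> :: "'a::euclidean_space"
  assumes \<theta>: "norm \<theta> = 1" and b: "\<And>x. g x \<le> b" and R: "\<And>x. g x \<noteq> 0 \<Longrightarrow> norm x \<le> R"
  shows "(\<integral>\<^sup>+y. ennreal (g y) \<partial>hyperplane_measure \<theta>) < \<infinity>"
proof -
  have "g x = 0" if "\<not> norm x \<le> R" for x using R that by blast
  then have "(\<integral>\<^sup>+y. ennreal (g y) \<partial>hyperplane_measure \<theta>) \<le> (\<integral>\<^sup>+y. ennreal b * indicator (cball 0 R) y \<partial>hyperplane_measure \<theta>)"
    using b by (intro nn_integral_mono) (auto simp: indicator_def intro: ennreal_leI)
  also have "\<dots> = ennreal b * emeasure (hyperplane_measure \<theta>) (cball 0 R)"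
    by (rule nn_integral_cmult_indicator) simp
  also have "\<dots> < \<infinity>"
    using emeasure_hyperplane_measure_cball[OF \<theta>, of R] by (auto simp: ennreal_mult_less_top)
  finally show ?thesis .
qed

text \<open>With slope \<open>a = \<theta> / (\<theta> \<bullet> u)\<close>, a point orthogonal to
  \<open>\<theta>\<close> is recovered from its projection \<open>p\<close> as
  \<open>p - (p \<bullet> a) u\<close>. The bounds on \<open>g\<close> make the integral finite, so
  passing to the real-valued radial function loses nothing.\<close>

lemma graph_integral_eq_radial:
  fixes u \<theta> :: "'a::euclidean_space"
  assumes u: "norm u = 1" and \<theta>: "norm \<theta> = 1" and ne: "\<theta> \<bullet> u \<noteq> 0"
    and g[measurable]: "g \<in> borel_measurable borel" and g0: "\<And>x. 0 \<le> g x"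
    and b: "\<And>x. g x \<le> b" and R: "\<And>x. g x \<noteq> 0 \<Longrightarrow> norm x \<le> R"
  shows "graph_integral u g ((1 / (\<theta> \<bullet> u)) *\<^sub>R \<theta>) = ennreal (\<bar>\<theta> \<bullet> u\<bar> * intersection_radial g \<theta>)"
proof -
  let ?a = "(1 / (\<theta> \<bullet> u)) *\<^sub>R \<theta>"
  have "(\<integral>\<^sup>+y. ennreal (g y) \<partial>hyperplane_measure \<theta>) =
      (\<integral>\<^sup>+y. ennreal (g (proj_perp u y - (proj_perp u y \<bullet> ?a) *\<^sub>R u)) \<partial>hyperplane_measure \<theta>)"
  proof (rule nn_integral_cong_AE, use AE_hyperplane_measure[of \<theta>] in eventually_elim)
    fix y assume y: "\<theta> \<bullet> y = 0"
    have "proj_perp u y \<bullet> ?a = - (y \<bullet> u)"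
    proof -
      have "y \<bullet> \<theta> = 0" "u \<bullet> \<theta> = \<theta> \<bullet> u" using y by (simp_all add: inner_commute)
      then show ?thesis using ne by (simp add: proj_perp_def inner_diff_left)
    qed
    then show "ennreal (g y) = ennreal (g (proj_perp u y - (proj_perp u y \<bullet> ?a) *\<^sub>R u))"
      by (simp add: proj_perp_def)
  qed
  also have "\<dots> = ennreal (1 / \<bar>\<theta> \<bullet> u\<bar>) * graph_integral u g ?a"
    unfolding graph_integral_def by (rule nn_integral_hyperplane_project[OF u \<theta> ne]) measurable
  finally have eq: "(\<integral>\<^sup>+y. ennreal (g y) \<partial>hyperplane_measure \<theta>) = ennreal (1 / \<bar>\<theta> \<bullet> u\<bar>) * graph_integral u g ?a" .
  have "ennreal (intersection_radial g \<theta>) = (\<integral>\<^sup>+y. ennreal (g y) \<partial>hyperplane_measure \<theta>)"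
    using nn_integral_hyperplane_finite[OF \<theta> b R] by (simp add: intersection_radial_hyperplane[OF g g0])
  then have "ennreal (\<bar>\<theta> \<bullet> u\<bar> * intersection_radial g \<theta>) = ennreal \<bar>\<theta> \<bullet> u\<bar> * (ennreal (1 / \<bar>\<theta> \<bullet> u\<bar>) * graph_integral u g ?a)"
    by (simp add: ennreal_mult' eq)
  also have "\<dots> = graph_integral u g ?a"
    using ne by (simp add: mult.assoc[symmetric] flip: ennreal_mult')
  finally show ?thesis ..
qed

text \<open>The radial inequality is multiplied by \<open>\<bar>\<theta> \<bullet> u\<bar>\<close>.
  The slope \<open>x / (x \<bullet> u)\<close> is unchanged when \<open>x\<close> is rescaled, so
  the direction need not be normalised.\<close>

lemma intersection_body_iff_graph_integral:
  fixes u x :: "'a::euclidean_space"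
  assumes u: "norm u = 1" and x: "x \<bullet> u \<noteq> 0"
    and g: "g \<in> borel_measurable borel" "\<And>x. 0 \<le> g x" "\<And>x. g x \<le> b" "\<And>x. g x \<noteq> 0 \<Longrightarrow> norm x \<le> R"
  shows "x \<in> intersection_body g \<longleftrightarrow> ennreal \<bar>x \<bullet> u\<bar> \<le> graph_integral u g ((1 / (x \<bullet> u)) *\<^sub>R x)"
proof -
  have nx: "norm x > 0" using x by auto
  define \<theta> where "\<theta> = (1 / norm x) *\<^sub>R x"
  have \<theta>: "norm \<theta> = 1" "\<theta> \<bullet> u = (x \<bullet> u) / norm x" "x = norm x *\<^sub>R \<theta>"
    using nx by (auto simp: \<theta>_def)
  have "x \<in> intersection_body g \<longleftrightarrow> norm x \<le> intersection_radial g \<theta>"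
  proof
    assume "x \<in> intersection_body g"
    then obtain r \<theta>' where r: "x = r *\<^sub>R \<theta>'" "norm \<theta>' = 1" "0 \<le> r" "r \<le> intersection_radial g \<theta>'"
      by (auto simp: intersection_body_def)
    then have "norm x = r" by simp
    moreover have "\<theta>' = \<theta>" using r nx \<open>norm x = r\<close> by (simp add: \<theta>_def)
    ultimately show "norm x \<le> intersection_radial g \<theta>" using r by simp
  next
    assume "norm x \<le> intersection_radial g \<theta>"
    then show "x \<in> intersection_body g"
      unfolding intersection_body_def using \<theta>(1,3) by (auto intro!: exI[of _ "norm x"] exI[of _ \<theta>])
  qed
  also have "\<dots> \<longleftrightarrow> \<bar>x \<bullet> u\<bar> \<le> \<bar>\<theta> \<bullet> u\<bar> * intersection_radial g \<theta>"
    using nx x by (simp add: \<theta>(2) abs_divide pos_le_divide_eq mult.commute[of "norm x"])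
  also have "\<dots> \<longleftrightarrow> ennreal \<bar>x \<bullet> u\<bar> \<le> ennreal (\<bar>\<theta> \<bullet> u\<bar> * intersection_radial g \<theta>)"
  proof -
    have "0 \<le> intersection_radial g \<theta>" by (simp add: intersection_radial_hyperplane[OF g(1,2)])
    then show ?thesis by (simp add: ennreal_le_iff)
  qed
  also have "ennreal (\<bar>\<theta> \<bullet> u\<bar> * intersection_radial g \<theta>) = graph_integral u g ((1 / (\<theta> \<bullet> u)) *\<^sub>R \<theta>)"
    using \<theta> x nx by (intro graph_integral_eq_radial[where b = b and R = R, symmetric] u g) auto
  also have "(1 / (\<theta> \<bullet> u)) *\<^sub>R \<theta> = (1 / (x \<bullet> u)) *\<^sub>R x"
    using nx by (simp add: \<theta>(2)) (simp add: \<theta>_def)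
  finally show ?thesis .
qed

text \<open>The intersection body without its points orthogonal to \<open>u\<close>, in a form whose
  measurability follows from that of \<open>graph_integral\<close>.\<close>

definition graph_body :: "'a::euclidean_space \<Rightarrow> ('a \<Rightarrow> real) \<Rightarrow> 'a set" where
  "graph_body u g = {x. x \<bullet> u \<noteq> 0 \<and> ennreal \<bar>x \<bullet> u\<bar> \<le> graph_integral u g ((1 / (x \<bullet> u)) *\<^sub>R x)}"

lemma borel_measurable_graph_integral [measurable]:
  assumes u: "norm u = 1" and [measurable]: "g \<in> borel_measurable borel"
  shows "graph_integral u g \<in> borel_measurable borel"
proof -
  interpret sigma_finite_measure "hyperplane_measure u" by (rule sigma_finite_hyperplane_measure[OF u])
  show ?thesis unfolding graph_integral_def[abs_def] by measurable
qed

lemma sets_graph_body: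
  assumes u: "norm u = 1" and [measurable]: "g \<in> borel_measurable borel"
  shows "graph_body u g \<in> sets borel"
proof -
  note [measurable] = borel_measurable_graph_integral[OF assms]
  show ?thesis unfolding graph_body_def by measurable
qed

text \<open>The body lies between the Borel set \<open>graph_body u g\<close> and the union of that
  set with a null hyperplane. Monotonicity of the outer measure then settles the matter without
  measurability of the body itself.\<close>

lemma hausdorff_outer_intersection_body:
  fixes u :: "'a::euclidean_space"
  assumes u: "norm u = 1"
    and g: "g \<in> borel_measurable borel" "\<And>x. 0 \<le> g x" "\<And>x. g x \<le> b" "\<And>x. g x \<noteq> 0 \<Longrightarrow> norm x \<le> R"
  shows "hausdorff_outer DIM('a) (intersection_body g) = hausdorff_outer DIM('a) (graph_body u g)"
proof (rule antisym)
  have sub: "graph_body u g \<subseteq> intersection_body g"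
    using intersection_body_iff_graph_integral[OF u _ g] by (auto simp: graph_body_def)
  then show "hausdorff_outer DIM('a) (graph_body u g) \<le> hausdorff_outer DIM('a) (intersection_body g)"
    by (rule hausdorff_outer_mono)
  obtain C where C: "\<And>E :: 'a set. E \<in> sets borel \<Longrightarrow> hausdorff_outer DIM('a) E = C * emeasure lborel E"
    using emeasure_hausdorff_DIM[where 'a='a] by metis
  have "negligible {x. u \<bullet> x = 0}" using u by (intro negligible_hyperplane) auto
  moreover have H: "{x. u \<bullet> x = 0} \<in> sets borel" by (simp add: borel_closed closed_hyperplane)
  ultimately have null: "{x. u \<bullet> x = 0} \<in> null_sets lborel"
    by (simp add: negligible_iff_null_sets null_sets_completion_iff)
  have G: "graph_body u g \<in> sets borel" using u g(1) by (rule sets_graph_body)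
  have "intersection_body g \<subseteq> graph_body u g \<union> {x. u \<bullet> x = 0}"
    using intersection_body_iff_graph_integral[OF u _ g] by (auto simp: graph_body_def inner_commute)
  then have "hausdorff_outer DIM('a) (intersection_body g) \<le> hausdorff_outer DIM('a) (graph_body u g \<union> {x. u \<bullet> x = 0})"
    by (rule hausdorff_outer_mono)
  also have "\<dots> = C * emeasure lborel (graph_body u g \<union> {x. u \<bullet> x = 0})"
    using G H by (intro C) auto
  also have "\<dots> = hausdorff_outer DIM('a) (graph_body u g)"
    using G null by (simp add: C emeasure_Un_null_set)
  finally show "hausdorff_outer DIM('a) (intersection_body g) \<le> hausdorff_outer DIM('a) (graph_body u g)" .
qed

text \<open>Rescaling reduces to \<open>r = 1\<close>, and the integral there, which is
  \<open>2 / (m + 1)\<close>, serves as the constant.\<close>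

lemma nn_integral_power_homogeneous:
  fixes m :: nat
  shows "\<exists>K. \<forall>r\<ge>0. (\<integral>\<^sup>+s. ennreal (\<bar>s\<bar> ^ m) * (if s \<noteq> 0 \<and> ennreal \<bar>s\<bar> \<le> ennreal r then 1 else 0) \<partial>lborel) = K * ennreal r ^ Suc m"
proof (intro exI allI impI)
  fix r :: real assume "r \<ge> 0"
  let ?W = "\<lambda>r. \<integral>\<^sup>+s. ennreal (\<bar>s\<bar> ^ m) * (if s \<noteq> 0 \<and> ennreal \<bar>s\<bar> \<le> ennreal r then 1 else 0) \<partial>lborel"
  show "?W r = ?W 1 * ennreal r ^ Suc m"
  proof (cases "r = 0")
    case True
    have "?W 0 = (\<integral>\<^sup>+s. 0 \<partial>(lborel :: real measure))"
      by (intro nn_integral_cong) auto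
    with True show ?thesis by simp
  next
    case False
    with \<open>r \<ge> 0\<close> have r: "r > 0" by simp
    have "?W r = ennreal r * (\<integral>\<^sup>+s. ennreal (\<bar>r * s\<bar> ^ m) * (if r * s \<noteq> 0 \<and> ennreal \<bar>r * s\<bar> \<le> ennreal r then 1 else 0) \<partial>lborel)"
      using nn_integral_real_affine[of "\<lambda>s. ennreal (\<bar>s\<bar> ^ m) * (if s \<noteq> 0 \<and> ennreal \<bar>s\<bar> \<le> ennreal r then 1 else 0)" r 0] r
      by simp
    also have "(\<integral>\<^sup>+s. ennreal (\<bar>r * s\<bar> ^ m) * (if r * s \<noteq> 0 \<and> ennreal \<bar>r * s\<bar> \<le> ennreal r then 1 else 0) \<partial>lborel) =
        (\<integral>\<^sup>+s. ennreal r ^ m * (ennreal (\<bar>s\<bar> ^ m) * (if s \<noteq> 0 \<and> ennreal \<bar>s\<bar> \<le> ennreal 1 then 1 else 0)) \<partial>lborel)"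
    proof (rule nn_integral_cong)
      fix s :: real
      have "ennreal \<bar>r * s\<bar> \<le> ennreal r \<longleftrightarrow> ennreal \<bar>s\<bar> \<le> ennreal 1" "r * s \<noteq> 0 \<longleftrightarrow> s \<noteq> 0"
        using r by (simp_all add: ennreal_le_iff abs_mult del: ennreal_1)
      moreover have "ennreal (\<bar>r * s\<bar> ^ m) = ennreal r ^ m * ennreal (\<bar>s\<bar> ^ m)"
        using r by (simp add: abs_mult power_mult_distrib ennreal_mult' ennreal_power)
      ultimately show "ennreal (\<bar>r * s\<bar> ^ m) * (if r * s \<noteq> 0 \<and> ennreal \<bar>r * s\<bar> \<le> ennreal r then 1 else 0) =
          ennreal r ^ m * (ennreal (\<bar>s\<bar> ^ m) * (if s \<noteq> 0 \<and> ennreal \<bar>s\<bar> \<le> ennreal 1 then 1 else 0))"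
        by (simp only: mult.assoc)
    qed
    also have "\<dots> = ennreal r ^ m * ?W 1"
      by (rule nn_integral_cmult) measurable
    finally show ?thesis by (simp add: mult_ac)
  qed
qed

lemma graph_integral_add_direction:
  assumes u: "norm u = 1"
  shows "graph_integral u g (a + s *\<^sub>R u) = graph_integral u g a"
  unfolding graph_integral_def
proof (rule nn_integral_cong_AE, use AE_hyperplane_measure[of u] in eventually_elim)
  fix y assume "u \<bullet> y = 0"
  then show "ennreal (g (y - (y \<bullet> (a + s *\<^sub>R u)) *\<^sub>R u)) = ennreal (g (y - (y \<bullet> a) *\<^sub>R u))"
    by (simp add: inner_add_right inner_commute)
qed

lemma graph_integral_finite:
  assumes u: "norm u = 1" and b: "\<And>x. g x \<le> b" and R: "\<And>x. g x \<noteq> 0 \<Longrightarrow> norm x \<le> R"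
  shows "graph_integral u g a < \<infinity>"
proof -
  \<comment> \<open>Off the hyperplane the integrand need not have bounded support, so it is
    replaced by 0 there. On it, Pythagoras bounds \<open>y\<close> by the norm of its lift to the
    graph.\<close>
  have "graph_integral u g a = (\<integral>\<^sup>+y. ennreal (if u \<bullet> y = 0 then g (y - (y \<bullet> a) *\<^sub>R u) else 0) \<partial>hyperplane_measure u)"
    unfolding graph_integral_def
    by (rule nn_integral_cong_AE, use AE_hyperplane_measure[of u] in eventually_elim) simp
  also have "\<dots> < \<infinity>"
  proof (rule nn_integral_hyperplane_finite[OF u])
    show "(if u \<bullet> y = 0 then g (y - (y \<bullet> a) *\<^sub>R u) else 0) \<le> max b 0" for y
      using b by (auto simp: max.coboundedI1)
    show "norm y \<le> R" if y: "(if u \<bullet> y = 0 then g (y - (y \<bullet> a) *\<^sub>R u) else 0) \<noteq> 0" for y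
    proof -
      have "u \<bullet> y = 0" "g (y - (y \<bullet> a) *\<^sub>R u) \<noteq> 0" using y by (auto split: if_splits)
      then have "norm (y - (y \<bullet> a) *\<^sub>R u) \<le> R" using R by blast
      moreover have "norm y \<le> norm (y - (y \<bullet> a) *\<^sub>R u)"
      proof -
        have "y \<bullet> u = 0" "u \<bullet> u = 1" using \<open>u \<bullet> y = 0\<close> u by (simp_all add: inner_commute dot_square_norm)
        then show ?thesis
          unfolding norm_eq_sqrt_inner using \<open>u \<bullet> y = 0\<close> by (simp add: inner_diff_left inner_diff_right)
      qed
      ultimately show ?thesis by linarith
    qed
  qed
  finally show ?thesis .
qed

text \<open>Here the Jacobians cancel. Points are written as \<open>y + s u\<close>, and the
  substitution \<open>y = s a\<close> on the hyperplane contributes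
  \<open>\<bar>s\<bar> ^ (DIM('a) - 1)\<close>. The integral over \<open>s\<close> then yields the
  full power of \<open>graph_integral u g a\<close>.\<close>

lemma emeasure_graph_body:
  fixes u :: "'a::euclidean_space"
  assumes u: "norm u = 1"
    and K: "\<And>r. r \<ge> 0 \<Longrightarrow> (\<integral>\<^sup>+s. ennreal (\<bar>s\<bar> ^ (DIM('a) - 1)) *
         (if s \<noteq> 0 \<and> ennreal \<bar>s\<bar> \<le> ennreal r then 1 else 0) \<partial>lborel) = K * ennreal r ^ DIM('a)"
    and g[measurable]: "g \<in> borel_measurable borel" and b: "\<And>x. g x \<le> b" and R: "\<And>x. g x \<noteq> 0 \<Longrightarrow> norm x \<le> R"
  shows "foliation_const TYPE('a) * emeasure lborel (graph_body u g) = K * (\<integral>\<^sup>+a. graph_integral u g a ^ DIM('a) \<partial>hyperplane_measure u)"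
proof -
  interpret sigma_finite_measure "hyperplane_measure u" by (rule sigma_finite_hyperplane_measure[OF u])
  interpret P: pair_sigma_finite "hyperplane_measure u" lborel ..
  let ?c = "foliation_const TYPE('a)"
  let ?\<Phi> = "graph_integral u g" and ?\<mu> = "hyperplane_measure u"
  note [measurable] = borel_measurable_graph_integral[OF u g] sets_graph_body[OF u g]
  define \<chi>' :: "real \<Rightarrow> ennreal \<Rightarrow> ennreal" where "\<chi>' s v = (if s \<noteq> 0 \<and> ennreal \<bar>s\<bar> \<le> v then 1 else 0)" for s v
  have [measurable]: "(\<lambda>x. \<chi>' (f x) (h x)) \<in> borel_measurable N"
    if [measurable]: "f \<in> borel_measurable N" "h \<in> borel_measurable N" for f h and N :: "'z measure"
    unfolding \<chi>'_def by measurable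
  have "?c * emeasure lborel (graph_body u g) = ?c * (\<integral>\<^sup>+x. indicator (graph_body u g) x \<partial>lborel)"
    by simp
  also have "\<dots> = (\<integral>\<^sup>+y. \<integral>\<^sup>+s. indicator (graph_body u g) (y + s *\<^sub>R u) \<partial>lborel \<partial>?\<mu>)"
    by (rule nn_integral_foliation[OF u, symmetric]) measurable
  also have "\<dots> = (\<integral>\<^sup>+y. \<integral>\<^sup>+s. \<chi>' s (?\<Phi> ((1 / s) *\<^sub>R y)) \<partial>lborel \<partial>?\<mu>)"
  proof (rule nn_integral_cong_AE, use AE_hyperplane_measure[of u] in eventually_elim, rule nn_integral_cong)
    fix y :: 'a and s :: real assume y: "u \<bullet> y = 0"
    have "y \<bullet> u = 0" using y by (simp add: inner_commute)
    then have yu: "(y + s *\<^sub>R u) \<bullet> u = s" using u by (simp add: inner_add_left dot_square_norm)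
    \<comment> \<open>Dividing \<open>y + s *\<^sub>R u\<close> by \<open>s\<close> adds exactly
      \<open>u\<close> to \<open>y / s\<close>, and \<open>graph_integral\<close> ignores multiples
      of \<open>u\<close>.\<close>
    have "?\<Phi> ((1 / s) *\<^sub>R (y + s *\<^sub>R u)) = ?\<Phi> ((1 / s) *\<^sub>R y)" if "s \<noteq> 0"
      using graph_integral_add_direction[OF u, of g "(1 / s) *\<^sub>R y" 1] that by (simp add: scaleR_add_right)
    then show "indicator (graph_body u g) (y + s *\<^sub>R u) = \<chi>' s (?\<Phi> ((1 / s) *\<^sub>R y))"
      by (auto simp: graph_body_def yu \<chi>'_def indicator_def)
  qed
  also have "\<dots> = (\<integral>\<^sup>+s. \<integral>\<^sup>+y. \<chi>' s (?\<Phi> ((1 / s) *\<^sub>R y)) \<partial>?\<mu> \<partial>lborel)"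
    by (rule P.Fubini'[symmetric]) measurable
  also have "\<dots> = (\<integral>\<^sup>+s. \<integral>\<^sup>+y. ennreal (\<bar>s\<bar> ^ (DIM('a) - 1)) * \<chi>' s (?\<Phi> y) \<partial>?\<mu> \<partial>lborel)"
  proof (rule nn_integral_cong)
    fix s :: real
    show "(\<integral>\<^sup>+y. \<chi>' s (?\<Phi> ((1 / s) *\<^sub>R y)) \<partial>?\<mu>) = (\<integral>\<^sup>+y. ennreal (\<bar>s\<bar> ^ (DIM('a) - 1)) * \<chi>' s (?\<Phi> y) \<partial>?\<mu>)"
    proof (cases "s = 0")
      case False
      then show ?thesis
        using nn_integral_hyperplane_scale[OF u False, of "\<lambda>y. \<chi>' s (?\<Phi> ((1 / s) *\<^sub>R y))"]
        by (simp add: nn_integral_cmult)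
    qed (simp add: \<chi>'_def)
  qed
  also have "\<dots> = (\<integral>\<^sup>+y. \<integral>\<^sup>+s. ennreal (\<bar>s\<bar> ^ (DIM('a) - 1)) * \<chi>' s (?\<Phi> y) \<partial>lborel \<partial>?\<mu>)"
    by (rule P.Fubini') measurable
  also have "\<dots> = (\<integral>\<^sup>+y. K * ?\<Phi> y ^ DIM('a) \<partial>?\<mu>)"
  proof (rule nn_integral_cong)
    fix y
    obtain r where "r \<ge> 0" "?\<Phi> y = ennreal r"
      using graph_integral_finite[where g = g and b = b and R = R, OF u b R, of y] by (cases "?\<Phi> y") auto
    then show "(\<integral>\<^sup>+s. ennreal (\<bar>s\<bar> ^ (DIM('a) - 1)) * \<chi>' s (?\<Phi> y) \<partial>lborel) = K * ?\<Phi> y ^ DIM('a)"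
      using K by (simp add: \<chi>'_def)
  qed
  also have "\<dots> = K * (\<integral>\<^sup>+y. ?\<Phi> y ^ DIM('a) \<partial>?\<mu>)"
    by (rule nn_integral_cmult) measurable
  finally show ?thesis .
qed

lemma hausdorff_outer_intersection_body_mono:
  fixes u :: "'a::euclidean_space"
  assumes u: "norm u = 1"
    and f: "f \<in> borel_measurable borel" "\<And>x. 0 \<le> f x" "\<And>x. f x \<le> b" "\<And>x. f x \<noteq> 0 \<Longrightarrow> norm x \<le> R"
    and g: "g \<in> borel_measurable borel" "\<And>x. 0 \<le> g x" "\<And>x. g x \<le> b'" "\<And>x. g x \<noteq> 0 \<Longrightarrow> norm x \<le> R'"
    and le: "(\<integral>\<^sup>+a. graph_integral u f a ^ DIM('a) \<partial>hyperplane_measure u) \<le>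
      (\<integral>\<^sup>+a. graph_integral u g a ^ DIM('a) \<partial>hyperplane_measure u)"
  shows "hausdorff_outer DIM('a) (intersection_body f) \<le> hausdorff_outer DIM('a) (intersection_body g)"
proof -
  let ?c = "foliation_const TYPE('a)"
  show ?thesis
  proof (cases "?c = 0")
    \<comment> \<open>If the constant were 0, all hyperplane measures would vanish, so both radial
      functions would be 0 on the sphere and the two bodies would coincide. Otherwise the constant
      can be cancelled.\<close>
    case True
    have "intersection_radial h \<theta> = 0" if \<theta>: "norm \<theta> = 1" and h: "h \<in> borel_measurable borel" "\<And>x. 0 \<le> h x" for \<theta> :: 'a and h
    proof -
      have "(\<integral>\<^sup>+y. \<integral>\<^sup>+s. (1 :: ennreal) \<partial>(lborel :: real measure) \<partial>hyperplane_measure \<theta>) = 0"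
        using nn_integral_foliation[OF \<theta>, of "\<lambda>_. 1"] True by simp
      then have "AE y in hyperplane_measure \<theta>. False"
        by (subst (asm) nn_integral_0_iff_AE) simp_all
      then have "(\<integral>\<^sup>+y. ennreal (h y) \<partial>hyperplane_measure \<theta>) = (\<integral>\<^sup>+y. 0 \<partial>hyperplane_measure \<theta>)"
        by (intro nn_integral_cong_AE) (auto elim: eventually_mono)
      then show ?thesis by (simp add: intersection_radial_hyperplane[OF h])
    qed
    then have "intersection_body h = {r *\<^sub>R \<theta> | r \<theta>. \<theta> \<in> sphere 0 1 \<and> 0 \<le> r \<and> r \<le> 0}"
      if "h \<in> borel_measurable borel" "\<And>x. 0 \<le> h x" for h :: "'a \<Rightarrow> real"
      unfolding intersection_body_def using that by (intro Collect_cong ex_cong1) auto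
    then show ?thesis using f(1,2) g(1,2) by simp
  next
    case False
    obtain K where K: "\<forall>r\<ge>0. (\<integral>\<^sup>+s. ennreal (\<bar>s\<bar> ^ (DIM('a) - 1)) *
         (if s \<noteq> 0 \<and> ennreal \<bar>s\<bar> \<le> ennreal r then 1 else 0) \<partial>lborel) = K * ennreal r ^ Suc (DIM('a) - 1)"
      using nn_integral_power_homogeneous by blast
    have "Suc (DIM('a) - 1) = DIM('a)" using DIM_positive[where 'a='a] by simp
    note K' = K[rule_format, unfolded this]
    have "?c * emeasure lborel (graph_body u f) \<le> ?c * emeasure lborel (graph_body u g)"
      using emeasure_graph_body[where b = b and R = R, OF u K' f(1,3,4)]
        emeasure_graph_body[where b = b' and R = R', OF u K' g(1,3,4)] le
      by (simp add: mult_left_mono)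
    then have "emeasure lborel (graph_body u f) \<le> emeasure lborel (graph_body u g)"
      using foliation_const_finite[where 'a = 'a] False by (simp add: ennreal_mult_le_mult_iff)
    moreover obtain C where C: "\<And>E :: 'a set. E \<in> sets borel \<Longrightarrow> hausdorff_outer DIM('a) E = C * emeasure lborel E"
      using emeasure_hausdorff_DIM[where 'a='a] by metis
    moreover have "hausdorff_outer DIM('a) (intersection_body f) = hausdorff_outer DIM('a) (graph_body u f)"
      by (rule hausdorff_outer_intersection_body[where b = b and R = R, OF u f])
    moreover have "hausdorff_outer DIM('a) (intersection_body g) = hausdorff_outer DIM('a) (graph_body u g)"
      by (rule hausdorff_outer_intersection_body[where b = b' and R = R', OF u g])
    ultimately show ?thesis
      by (simp add: C sets_graph_body[OF u f(1)] sets_graph_body[OF u g(1)] mult_left_mono)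
  qed
qed

section \<open>Measurability and bounds for Steiner symmetrals\<close>

text \<open>Membership is rewritten in terms of \<open>proj_perp u x\<close> and
  \<open>x \<bullet> u\<close>. What remains is that the projection of \<open>K\<close> is compact
  and that the length of a line section is a measurable function of its foot point.\<close>

lemma sets_steiner_set:
  fixes K :: "'a::euclidean_space set"
  assumes K: "compact K" and u: "norm u = 1"
  shows "steiner_set u K \<in> sets borel"
proof -
  have [measurable]: "K \<in> sets borel" using K by (simp add: compact_imp_closed borel_closed)
  have "continuous_on K (proj_perp u)"
    unfolding proj_perp_def[abs_def] by (intro continuous_intros)
  then have "compact (proj_perp u ` K)" using K by (rule compact_continuous_image)
  then have [measurable]: "proj_perp u ` K \<in> sets borel" by (simp add: compact_imp_closed borel_closed)
  have "steiner_set u K = {x. proj_perp u x \<in> proj_perp u ` K \<and>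
      \<bar>x \<bullet> u\<bar> \<le> measure lborel {s. proj_perp u x + s *\<^sub>R u \<in> K} / 2}"
  proof (intro set_eqI iffI)
    fix x assume "x \<in> steiner_set u K"
    then obtain y s where x: "x = y + s *\<^sub>R u" and y: "y \<in> proj_perp u ` K"
      and s: "\<bar>s\<bar> \<le> enn2real (hausdorff_outer 1 (K \<inter> line_in_direction u y)) / 2"
      unfolding steiner_set_def by blast
    have uy: "u \<bullet> y = 0" using y inner_proj_perp_self[OF u] by auto
    then have "proj_perp u x = y" unfolding x by (simp add: proj_perp_add_scaleR[OF u] proj_perp_orthogonal[OF u])
    moreover have "y \<bullet> u = 0" using uy by (simp add: inner_commute)
    then have "x \<bullet> u = s" using u by (simp add: x inner_add_left dot_square_norm)
    ultimately show "x \<in> {x. proj_perp u x \<in> proj_perp u ` K \<and>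
        \<bar>x \<bullet> u\<bar> \<le> measure lborel {s. proj_perp u x + s *\<^sub>R u \<in> K} / 2}"
      using y s by (simp add: hausdorff_outer_1_line[OF _ u, simplified] measure_def)
  next
    fix x assume x: "x \<in> {x. proj_perp u x \<in> proj_perp u ` K \<and>
        \<bar>x \<bullet> u\<bar> \<le> measure lborel {s. proj_perp u x + s *\<^sub>R u \<in> K} / 2}"
    have "x = proj_perp u x + (x \<bullet> u) *\<^sub>R u" by (simp add: proj_perp_def)
    then show "x \<in> steiner_set u K"
      unfolding steiner_set_def using x by (auto simp: hausdorff_outer_1_line[OF _ u, simplified] measure_def)
  qed
  moreover have "(\<lambda>x. measure lborel {s. proj_perp u x + s *\<^sub>R u \<in> K}) \<in> borel_measurable borel"
  proof -
    have Q: "{p :: 'a \<times> real. proj_perp u (fst p) + snd p *\<^sub>R u \<in> K} \<in> sets (borel \<Otimes>\<^sub>M lborel)"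
    proof -
      have "{p \<in> space (borel \<Otimes>\<^sub>M lborel). proj_perp u (fst p) + snd p *\<^sub>R u \<in> K} \<in> sets (borel \<Otimes>\<^sub>M lborel)"
        by measurable
      then show ?thesis by (simp add: space_pair_measure)
    qed
    show ?thesis
      unfolding measure_def using lborel.measurable_emeasure_Pair[OF Q] by (simp add: vimage_def)
  qed
  note [measurable] = this
  ultimately show ?thesis by simp
qed

lemma bounded_line_section:
  fixes L :: "'a::euclidean_space set"
  assumes L: "bounded L" and u: "norm u = 1"
  shows "bounded {s. y + s *\<^sub>R u \<in> L}"
proof -
  have "{s. y + s *\<^sub>R u \<in> L} \<subseteq> (\<lambda>x. (x - y) \<bullet> u) ` L"
  proof
    fix s assume "s \<in> {s. y + s *\<^sub>R u \<in> L}"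
    then show "s \<in> (\<lambda>x. (x - y) \<bullet> u) ` L"
      using u by (intro image_eqI[of _ _ "y + s *\<^sub>R u"]) (simp_all add: dot_square_norm)
  qed
  moreover have "bounded ((\<lambda>x. (x - y) \<bullet> u) ` L)"
  proof -
    have "bounded ((\<lambda>x. x \<bullet> u) ` ((\<lambda>x. - y + x) ` L))"
      by (intro bounded_linear_image bounded_translation L bounded_linear_inner_left)
    then show ?thesis by (simp add: image_image add.commute)
  qed
  ultimately show ?thesis using bounded_subset by blast
qed

lemma steiner_set_mono:
  fixes K :: "'a::euclidean_space set"
  assumes "K \<subseteq> L" "compact K" "compact L" and u: "norm u = 1"
  shows "steiner_set u K \<subseteq> steiner_set u L"
proof -
  have [measurable]: "K \<in> sets borel" "L \<in> sets borel"
    using assms by (simp_all add: compact_imp_closed borel_closed)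
  have "enn2real (hausdorff_outer 1 (K \<inter> line_in_direction u y)) \<le> enn2real (hausdorff_outer 1 (L \<inter> line_in_direction u y))" for y
  proof (rule enn2real_mono)
    show "hausdorff_outer 1 (K \<inter> line_in_direction u y) \<le> hausdorff_outer 1 (L \<inter> line_in_direction u y)"
      using assms(1) by (intro hausdorff_outer_mono) auto
    have "bounded {s. y + s *\<^sub>R u \<in> L}" by (rule bounded_line_section[OF compact_imp_bounded[OF assms(3)] u])
    then show "hausdorff_outer 1 (L \<inter> line_in_direction u y) < top"
      using emeasure_bounded_finite by (simp add: hausdorff_outer_1_line[OF _ u, simplified])
  qed
  then have "\<bar>s\<bar> \<le> enn2real (hausdorff_outer 1 (L \<inter> line_in_direction u y)) / 2"
    if "\<bar>s\<bar> \<le> enn2real (hausdorff_outer 1 (K \<inter> line_in_direction u y)) / 2" for s y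
    using that by (meson divide_right_mono order_trans zero_le_numeral)
  then show ?thesis unfolding steiner_set_def using assms(1) by blast
qed

text \<open>Both the projection and the half-length of a section are at most \<open>R\<close>; the
  triangle inequality adds the two bounds.\<close>

lemma steiner_set_subset_cball:
  fixes K :: "'a::euclidean_space set"
  assumes K: "compact K" "K \<subseteq> cball 0 R" and u: "norm u = 1"
  shows "steiner_set u K \<subseteq> cball 0 (2 * R)"
proof
  have [measurable]: "K \<in> sets borel" using K by (simp add: compact_imp_closed borel_closed)
  fix x assume "x \<in> steiner_set u K"
  then obtain k s where k: "k \<in> K" and x: "x = proj_perp u k + s *\<^sub>R u"
    and s: "\<bar>s\<bar> \<le> enn2real (hausdorff_outer 1 (K \<inter> line_in_direction u (proj_perp u k))) / 2"
    unfolding steiner_set_def by blast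
  let ?y = "proj_perp u k"
  have uy: "?y \<bullet> u = 0" "u \<bullet> ?y = 0" using inner_proj_perp_self[OF u] by (simp_all add: inner_commute)
  have kR: "norm k \<le> R" using k K by auto
  then have R0: "R \<ge> 0" using norm_ge_zero[of k] by linarith
  have "norm ?y \<le> norm (?y + (k \<bullet> u) *\<^sub>R u)"
  proof (rule power2_le_imp_le)
    have "(norm (?y + (k \<bullet> u) *\<^sub>R u))\<^sup>2 = (norm ?y)\<^sup>2 + (norm ((k \<bullet> u) *\<^sub>R u))\<^sup>2"
      by (rule norm_add_Pythagorean) (simp add: orthogonal_def uy)
    then show "(norm ?y)\<^sup>2 \<le> (norm (?y + (k \<bullet> u) *\<^sub>R u))\<^sup>2" by simp
  qed simp
  also have "?y + (k \<bullet> u) *\<^sub>R u = k" by (simp add: proj_perp_def)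
  finally have "norm ?y \<le> R" using kR by simp
  moreover have "\<bar>s\<bar> \<le> R"
  proof -
    have "{s. ?y + s *\<^sub>R u \<in> K} \<subseteq> {-R..R}"
    proof
      fix s assume "s \<in> {s. ?y + s *\<^sub>R u \<in> K}"
      then have "norm (?y + s *\<^sub>R u) \<le> R" using K by auto
      moreover have "\<bar>(?y + s *\<^sub>R u) \<bullet> u\<bar> \<le> norm (?y + s *\<^sub>R u)"
        using Cauchy_Schwarz_ineq2[of "?y + s *\<^sub>R u" u] u by simp
      ultimately show "s \<in> {-R..R}" using u uy by (auto simp: inner_add_left dot_square_norm)
    qed
    then have "emeasure lborel {s. ?y + s *\<^sub>R u \<in> K} \<le> emeasure lborel {-R..R}"
      by (rule emeasure_mono) simp
    also have "\<dots> = ennreal (2 * R)" using R0 by simp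
    finally have "enn2real (hausdorff_outer 1 (K \<inter> line_in_direction u ?y)) \<le> enn2real (ennreal (2 * R))"
      by (intro enn2real_mono) (simp_all add: hausdorff_outer_1_line[OF _ u, simplified])
    then show ?thesis using s R0 by simp
  qed
  ultimately show "x \<in> cball 0 (2 * R)"
    using norm_triangle_ineq[of ?y "s *\<^sub>R u"] u by (simp add: x)
qed

lemma steiner_set_empty [simp]: "steiner_set u {} = {}"
  by (simp add: steiner_set_def)

context
  fixes u :: "'a::euclidean_space" and f :: "'a \<Rightarrow> real" and b R :: real
  assumes u: "norm u = 1" and f0: "\<And>x. 0 \<le> f x" and fb: "\<And>x. f x \<le> b"
    and fR: "\<And>x. f x \<noteq> 0 \<Longrightarrow> norm x \<le> R"
    and superlevel: "\<And>t. 0 < t \<Longrightarrow> compact {x. f x \<ge> t}"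
begin

text \<open>Superlevel sets decrease with the level and symmetrization is monotone, so the positive
  levels whose symmetrized set contains \<open>x\<close> form an interval starting at 0. Its length
  \<open>T\<close> is the value of the layer-cake integral. Only membership at the end point
  \<open>T\<close> is left open, and it has measure zero.\<close>

lemma steiner_layers:
  obtains T where "0 \<le> T" "T \<le> max b 0" "steiner_fun u f x = T"
    "(\<integral>\<^sup>+t. indicator {t. 0 < t \<and> x \<in> steiner_set u {z. t \<le> f z}} t \<partial>lborel) = ennreal T"
    "\<And>t. 0 < t \<Longrightarrow> t < T \<Longrightarrow> x \<in> steiner_set u {z. t \<le> f z}"
    "\<And>t. T < t \<Longrightarrow> x \<notin> steiner_set u {z. t \<le> f z}"
proof -
  let ?S = "{t. 0 < t \<and> x \<in> steiner_set u {z. t \<le> f z}}"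
  have down: "s \<in> ?S" if "t \<in> ?S" "0 < s" "s \<le> t" for s t
  proof -
    have "{z. t \<le> f z} \<subseteq> {z. s \<le> f z}" using that by auto
    moreover have "0 < t" using that by simp
    ultimately show ?thesis
      using steiner_set_mono[of "{z. t \<le> f z}" "{z. s \<le> f z}" u] superlevel[of s] superlevel[of t] u that by blast
  qed
  have ub: "t \<le> max b 0" if "t \<in> ?S" for t
  proof (rule ccontr)
    assume "\<not> t \<le> max b 0"
    then have "{z. t \<le> f z} = {}" using fb by (auto simp: not_le) (meson less_le_trans not_less order.trans)
    then show False using that by simp
  qed
  \<comment> \<open>The supremum of the empty set is unspecified, so that case is set to 0 by
    hand.\<close>
  define T where "T = (if ?S = {} then 0 else Sup ?S)"
  have bdd: "bdd_above ?S" using ub by (intro bdd_aboveI) auto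
  have T: "0 \<le> T" "T \<le> max b 0"
  proof -
    show "0 \<le> T"
      using cSup_upper[OF _ bdd] by (auto simp: T_def) (meson less_imp_le order_trans)
    show "T \<le> max b 0" using ub by (auto simp: T_def intro!: cSup_least)
  qed
  have in_S: "t \<in> ?S" if "0 < t" "t < T" for t
  proof -
    have "?S \<noteq> {}" "t < Sup ?S" using that by (auto simp: T_def split: if_splits)
    then obtain t' where "t' \<in> ?S" "t < t'" using less_cSup_iff[OF _ bdd] by blast
    then show ?thesis using down[of t' t] that by simp
  qed
  have le_T: "t \<le> T" if "t \<in> ?S" for t
    using that cSup_upper[OF that bdd] by (auto simp: T_def)
  have "AE t in lborel. (indicator ?S t :: ennreal) = indicator {0<..<T} t"
    using AE_lborel_singleton[of T]
  proof eventually_elim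
    case (elim t)
    then show ?case using in_S[of t] le_T[of t] by (auto simp: indicator_def)
  qed
  then have 1: "(\<integral>\<^sup>+t. indicator ?S t \<partial>lborel) = ennreal T"
    using T by (subst nn_integral_cong_AE) auto
  have "?S = {0<..<T} \<union> {T} \<or> ?S = {0<..<T}"
  proof (cases "T \<in> ?S")
    case True
    then have "t \<in> ?S \<longleftrightarrow> t \<in> {0<..<T} \<union> {T}" for t
      using in_S[of t] le_T[of t] by (cases "t = T") auto
    then show ?thesis by blast
  next
    case False
    then have "t \<in> ?S \<longleftrightarrow> t \<in> {0<..<T}" for t
      using in_S[of t] le_T[of t] by (cases "t = T") auto
    then show ?thesis by blast
  qed
  then have S_meas: "?S \<in> sets borel"
  proof
    assume e: "?S = {0<..<T} \<union> {T}"
    show ?thesis by (subst e) simp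
  next
    assume e: "?S = {0<..<T}"
    show ?thesis by (subst e) simp
  qed
  have "steiner_fun u f x = (LINT t|lborel. indicator ?S t)"
    unfolding steiner_fun_def set_lebesgue_integral_def
    by (intro Bochner_Integration.integral_cong) (auto simp: indicator_def)
  also have "\<dots> = measure lborel ?S" using S_meas by simp
  also have "\<dots> = T" using 1 S_meas T by (simp add: measure_def)
  finally show ?thesis
    using that[OF T _ 1] in_S le_T T by (metis (mono_tags, lifting) mem_Collect_eq le_less_trans not_less)
qed

lemma steiner_fun_nonneg: "0 \<le> steiner_fun u f x"
  by (rule steiner_layers[of x]) simp

lemma steiner_fun_le: "steiner_fun u f x \<le> max b 0"
  by (rule steiner_layers[of x]) simp

lemma ennreal_steiner_fun:
  "ennreal (steiner_fun u f x) = (\<integral>\<^sup>+t. indicator {t. 0 < t \<and> x \<in> steiner_set u {z. t \<le> f z}} t \<partial>lborel)"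
  by (rule steiner_layers[of x]) simp

lemma steiner_fun_support:
  assumes "steiner_fun u f x \<noteq> 0"
  shows "norm x \<le> 2 * R"
proof -
  obtain t where t: "0 < t" "x \<in> steiner_set u {z. t \<le> f z}"
  proof (rule steiner_layers[of x])
    fix T assume "0 \<le> T" "steiner_fun u f x = T" and lt: "\<And>t. 0 < t \<Longrightarrow> t < T \<Longrightarrow> x \<in> steiner_set u {z. t \<le> f z}"
    with assms have "0 < T / 2" "T / 2 < T" by simp_all
    then show ?thesis using that lt by metis
  qed
  have "{z. t \<le> f z} \<subseteq> cball 0 R" using fR t by force
  then show ?thesis
    using steiner_set_subset_cball[OF superlevel[OF t(1)] _ u] t by fastforce
qed

text \<open>Since the layers are nested, a strict superlevel set at \<open>\<tau> \<ge> 0\<close> is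
  the union of the symmetrized sets over the rational levels above \<open>\<tau>\<close>, a
  countable union of Borel sets.\<close>

lemma borel_measurable_steiner_fun: "steiner_fun u f \<in> borel_measurable borel"
proof (rule borel_measurableI_greater)
  fix \<tau> :: real
  show "{x \<in> space borel. \<tau> < steiner_fun u f x} \<in> sets borel"
  proof (cases "\<tau> < 0")
    case True
    then have "{x. \<tau> < steiner_fun u f x} = UNIV" using steiner_fun_nonneg by (auto intro: less_le_trans)
    then show ?thesis by simp
  next
    case False
    have "\<tau> < steiner_fun u f x \<longleftrightarrow> (\<exists>q\<in>\<rat> \<inter> {\<tau><..}. x \<in> steiner_set u {z. q \<le> f z})" for x
    proof (rule steiner_layers[of x])
      fix T assume T: "0 \<le> T" "steiner_fun u f x = T"
        and lt: "\<And>t. 0 < t \<Longrightarrow> t < T \<Longrightarrow> x \<in> steiner_set u {z. t \<le> f z}"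
        and gt: "\<And>t. T < t \<Longrightarrow> x \<notin> steiner_set u {z. t \<le> f z}"
      show ?thesis
      proof
        assume "\<tau> < steiner_fun u f x"
        then obtain q where "q \<in> \<rat>" "\<tau> < q" "q < T" using Rats_dense_in_real[of \<tau> T] T by auto
        then show "\<exists>q\<in>\<rat> \<inter> {\<tau><..}. x \<in> steiner_set u {z. q \<le> f z}"
          using lt[of q] False by auto
      next
        assume "\<exists>q\<in>\<rat> \<inter> {\<tau><..}. x \<in> steiner_set u {z. q \<le> f z}"
        then obtain q where "\<tau> < q" "x \<in> steiner_set u {z. q \<le> f z}" by auto
        then show "\<tau> < steiner_fun u f x" using gt[of q] T by force
      qed
    qed
    then have "{x \<in> space borel. \<tau> < steiner_fun u f x} = (\<Union>q\<in>\<rat> \<inter> {\<tau><..}. steiner_set u {z. q \<le> f z})"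
      by auto
    also have "\<dots> \<in> sets borel"
      using False by (intro sets.countable_UN'' countable_Int1 countable_rat sets_steiner_set superlevel u) auto
    finally show ?thesis .
  qed
qed

end

section \<open>The inequality for functions with compact superlevel sets\<close>

context
  fixes u :: "real ^ 'n" and f :: "real ^ 'n \<Rightarrow> real" and b R :: real
  assumes n: "CARD('n) \<ge> 2"
    and u: "norm u = 1" and f0: "\<And>x. 0 \<le> f x" and fb: "\<And>x. f x \<le> b"
    and fR: "\<And>x. f x \<noteq> 0 \<Longrightarrow> norm x \<le> R"
    and superlevel: "\<And>t. 0 < t \<Longrightarrow> compact {x. f x \<ge> t}"
    and f_meas[measurable]: "f \<in> borel_measurable borel"
begin

text \<open>The parameter space pairs a foot point \<open>y\<close> with a level \<open>t\<close>,
  so that \<open>graph_integral\<close> becomes an integral of indicators of line sections evaluated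
  at \<open>a \<bullet> y\<close>. The power rearrangement then applies with \<open>Y\<close>
  reading off the foot point.\<close>

lemma graph_integral_power_steiner_fun:
  "(\<integral>\<^sup>+a. graph_integral u f a ^ CARD('n) \<partial>hyperplane_measure u) \<le>
    (\<integral>\<^sup>+a. graph_integral u (steiner_fun u f) a ^ CARD('n) \<partial>hyperplane_measure u)"
proof -
  let ?\<mu> = "hyperplane_measure u"
  interpret \<mu>: sigma_finite_measure ?\<mu> by (rule sigma_finite_hyperplane_measure[OF u])
  interpret P: pair_sigma_finite ?\<mu> lborel ..
  let ?M = "?\<mu> \<Otimes>\<^sub>M (lborel :: real measure)"
  \<comment> \<open>Projecting makes \<open>Y w\<close> orthogonal to \<open>u\<close> for every
    \<open>w\<close>, not just almost every one, and leaves the integrals unchanged.\<close>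
  define Y where "Y w = proj_perp u (fst w)" for w :: "(real ^ 'n) \<times> real"
  have Y[measurable]: "Y \<in> borel_measurable ?M" unfolding Y_def by measurable
  \<comment> \<open>The minus sign matches the graph \<open>y - (y \<bullet> a) u\<close>, so the
    fibre of \<open>D\<close> is the reflected line section of the superlevel set.\<close>
  define D where "D = {p \<in> space (?M \<Otimes>\<^sub>M (borel :: real measure)). 0 < snd (fst p) \<and> snd (fst p) \<le> f (Y (fst p) - snd p *\<^sub>R u)}"
  have D[measurable]: "D \<in> sets (?M \<Otimes>\<^sub>M borel)" unfolding D_def by measurable
  have D_w: "Pair w -` D = {s. 0 < snd w \<and> snd w \<le> f (Y w - s *\<^sub>R u)}" for w
    by (auto simp: D_def space_pair_measure)
  have M: "sigma_finite_measure ?M" ..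
  have perp: "u \<bullet> Y w = 0" for w by (simp add: Y_def inner_proj_perp_self[OF u])
  have bd: "bounded (Pair w -` D)" for w
  proof (cases "0 < snd w")
    case True
    have "bounded {s. Y w + s *\<^sub>R (- u) \<in> {x. snd w \<le> f x}}"
      using u True by (intro bounded_line_section compact_imp_bounded superlevel) simp_all
    then show ?thesis by (rule bounded_subset) (auto simp: D_w)
  qed (simp add: D_w)
  have nondeg: "AE w in ?M. v \<bullet> Y w \<noteq> 0" if "u \<bullet> e = 0" "v \<bullet> e \<noteq> 0" for v e
  proof (rule P.AE_pair_measure)
    show "{w \<in> space ?M. v \<bullet> Y w \<noteq> 0} \<in> sets ?M" by measurable
    have "AE y in ?\<mu>. v \<bullet> proj_perp u y \<noteq> 0"
      using AE_hyperplane_inner_nonzero[OF u that] AE_hyperplane_measure[of u]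
      by eventually_elim (simp add: proj_perp_orthogonal[OF u])
    then show "AE y in ?\<mu>. AE t in lborel. v \<bullet> Y (y, t) \<noteq> 0"
      by eventually_elim (simp add: Y_def)
  qed
  have layers: "(\<integral>\<^sup>+w. indicator (Pair w -` D) (a \<bullet> Y w) \<partial>?M) = graph_integral u f a" for a
  proof -
    have "(\<integral>\<^sup>+w. indicator (Pair w -` D) (a \<bullet> Y w) \<partial>?M) =
        (\<integral>\<^sup>+w. indicator {0<..f (Y w - (a \<bullet> Y w) *\<^sub>R u)} (snd w) \<partial>?M)"
      by (intro nn_integral_cong) (simp add: D_w indicator_def)
    also have "\<dots> = (\<integral>\<^sup>+y. \<integral>\<^sup>+t. indicator {0<..f (proj_perp u y - (a \<bullet> proj_perp u y) *\<^sub>R u)} t \<partial>lborel \<partial>?\<mu>)"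
    proof -
      have "{w \<in> space ?M. 0 < snd w \<and> snd w \<le> f (Y w - (a \<bullet> Y w) *\<^sub>R u)} \<in> sets ?M" by measurable
      then have "(indicator {w \<in> space ?M. 0 < snd w \<and> snd w \<le> f (Y w - (a \<bullet> Y w) *\<^sub>R u)} :: _ \<Rightarrow> ennreal) \<in> borel_measurable ?M"
        by (rule borel_measurable_indicator)
      then have "(\<lambda>w. indicator {0<..f (Y w - (a \<bullet> Y w) *\<^sub>R u)} (snd w) :: ennreal) \<in> borel_measurable ?M"
        by (rule measurable_cong[THEN iffD1, rotated]) (auto simp: indicator_def)
      from lborel.nn_integral_fst[OF this] show ?thesis by (simp add: Y_def)
    qed
    also have "\<dots> = (\<integral>\<^sup>+y. ennreal (f (proj_perp u y - (proj_perp u y \<bullet> a) *\<^sub>R u)) \<partial>?\<mu>)"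
      using f0 by (simp add: inner_commute)
    also have "\<dots> = graph_integral u f a"
      unfolding graph_integral_def by (rule nn_integral_hyperplane_proj_perp[OF u])
    finally show ?thesis .
  qed
  \<comment> \<open>Only an inequality is claimed: the open centered interval lies in the closed
    segment of the symmetral.\<close>
  have steiner: "(\<integral>\<^sup>+w. indicator (centered_interval (measure lborel (Pair w -` D))) (a \<bullet> Y w) \<partial>?M) \<le>
      graph_integral u (steiner_fun u f) a" for a
  proof -
    let ?C = "\<lambda>w. centered_interval (measure lborel (Pair w -` D))"
    have C: "indicator (?C (y, t)) (a \<bullet> Y (y, t)) \<le>
        (indicator {t. 0 < t \<and> proj_perp u y - (proj_perp u y \<bullet> a) *\<^sub>R u \<in> steiner_set u {z. t \<le> f z}} t :: ennreal)" for y t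
    proof (cases "a \<bullet> Y (y, t) \<in> ?C (y, t)")
      case True
      let ?y = "proj_perp u y" and ?K = "{z. t \<le> f z}"
      let ?m = "measure lborel {s. ?y + s *\<^sub>R u \<in> ?K}"
      have lt: "\<bar>?y \<bullet> a\<bar> < measure lborel (Pair (y, t) -` D) / 2"
        using True by (simp add: mem_centered_interval Y_def inner_commute)
      \<comment> \<open>A strict bound by half the measure forces the section to be non-empty. This
        gives \<open>t > 0\<close> and puts the foot point into the projection of the superlevel
        set, as \<open>steiner_set\<close> requires.\<close>
      then have "Pair (y, t) -` D \<noteq> {}" by auto
      then obtain s where "t > 0" "t \<le> f (?y - s *\<^sub>R u)" by (auto simp: D_w Y_def)
      have K: "?K \<in> sets borel" using superlevel[OF \<open>t > 0\<close>] by (simp add: compact_imp_closed borel_closed)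
      have "Pair (y, t) -` D = uminus -` {s. ?y + s *\<^sub>R u \<in> ?K}"
        using \<open>t > 0\<close> by (auto simp: D_w Y_def)
      moreover have "{s. ?y + s *\<^sub>R u \<in> ?K} \<in> sets borel" by measurable
      ultimately have "measure lborel (Pair (y, t) -` D) = ?m"
        by (simp only: measure_lborel_uminus_vimage)
      with lt have "\<bar>- (?y \<bullet> a)\<bar> \<le> enn2real (hausdorff_outer 1 (?K \<inter> line_in_direction u ?y)) / 2"
        by (simp add: hausdorff_outer_1_line[OF K u, simplified] measure_def)
      moreover have "?y = proj_perp u (?y - s *\<^sub>R u)"
        using proj_perp_add_scaleR[OF u, of ?y "- s"] proj_perp_orthogonal[OF u inner_proj_perp_self[OF u]] by simp
      then have "?y \<in> proj_perp u ` ?K" using \<open>t \<le> f (?y - s *\<^sub>R u)\<close> by blast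
      ultimately have "?y + (- (?y \<bullet> a)) *\<^sub>R u \<in> steiner_set u ?K"
        unfolding steiner_set_def by blast
      then show ?thesis using \<open>t > 0\<close> True by simp
    qed simp
    have "(\<integral>\<^sup>+w. indicator (?C w) (a \<bullet> Y w) \<partial>?M) = (\<integral>\<^sup>+y. \<integral>\<^sup>+t. indicator (?C (y, t)) (a \<bullet> Y (y, t)) \<partial>lborel \<partial>?\<mu>)"
    proof -
      have [measurable]: "(\<lambda>w. measure lborel (Pair w -` D)) \<in> borel_measurable ?M"
      proof -
        have "sets (?M \<Otimes>\<^sub>M (borel :: real measure)) = sets (?M \<Otimes>\<^sub>M lborel)"
          by (rule sets_pair_measure_cong) simp_all
        then have "(\<lambda>w. emeasure lborel (Pair w -` D)) \<in> borel_measurable ?M"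
          using D by (intro lborel.measurable_emeasure_Pair) simp
        then show ?thesis unfolding measure_def by measurable
      qed
      have "{w \<in> space ?M. \<bar>a \<bullet> Y w\<bar> < measure lborel (Pair w -` D) / 2} \<in> sets ?M" by measurable
      then have "(indicator {w \<in> space ?M. \<bar>a \<bullet> Y w\<bar> < measure lborel (Pair w -` D) / 2} :: _ \<Rightarrow> ennreal) \<in> borel_measurable ?M"
        by (rule borel_measurable_indicator)
      then have "(\<lambda>w. indicator (?C w) (a \<bullet> Y w) :: ennreal) \<in> borel_measurable ?M"
        by (rule measurable_cong[THEN iffD1, rotated]) (auto simp: indicator_def mem_centered_interval)
      from lborel.nn_integral_fst[OF this] show ?thesis by simp
    qed
    also have "\<dots> \<le> (\<integral>\<^sup>+y. \<integral>\<^sup>+t. indicator {t. 0 < t \<and> proj_perp u y - (proj_perp u y \<bullet> a) *\<^sub>R u \<in> steiner_set u {z. t \<le> f z}} t \<partial>lborel \<partial>?\<mu>)"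
      by (intro nn_integral_mono C)
    also have "\<dots> = (\<integral>\<^sup>+y. ennreal (steiner_fun u f (proj_perp u y - (proj_perp u y \<bullet> a) *\<^sub>R u)) \<partial>?\<mu>)"
      using ennreal_steiner_fun[where f = f and b = b and R = R, OF u f0 fb fR superlevel]
      by (intro nn_integral_cong_AE AE_I2) simp
    also have "\<dots> = graph_integral u (steiner_fun u f) a"
      unfolding graph_integral_def by (rule nn_integral_hyperplane_proj_perp[OF u])
    finally show ?thesis .
  qed
  have "(\<integral>\<^sup>+a. graph_integral u f a ^ CARD('n) \<partial>?\<mu>) =
      (\<integral>\<^sup>+a. (\<integral>\<^sup>+w. indicator (Pair w -` D) (a \<bullet> Y w) \<partial>?M) ^ CARD('n) \<partial>?\<mu>)"
    by (simp only: layers)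
  also have "\<dots> \<le> (\<integral>\<^sup>+a. (\<integral>\<^sup>+w. indicator (centered_interval (measure lborel (Pair w -` D))) (a \<bullet> Y w) \<partial>?M) ^ CARD('n) \<partial>?\<mu>)"
    by (rule nn_integral_hyperplane_power_rearrangement[OF n u M Y perp nondeg D bd])
  also have "\<dots> \<le> (\<integral>\<^sup>+a. graph_integral u (steiner_fun u f) a ^ CARD('n) \<partial>?\<mu>)"
    by (intro nn_integral_mono power_mono steiner) simp
  finally show ?thesis .
qed

lemma hausdorff_outer_intersection_body_steiner_fun:
  "hausdorff_outer CARD('n) (intersection_body f) \<le> hausdorff_outer CARD('n) (intersection_body (steiner_fun u f))"
proof -
  note S = u f0 fb fR superlevel
  have "hausdorff_outer DIM(real ^ 'n) (intersection_body f) \<le>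
      hausdorff_outer DIM(real ^ 'n) (intersection_body (steiner_fun u f))"
    using graph_integral_power_steiner_fun
    by (intro hausdorff_outer_intersection_body_mono[where b = b and R = R and b' = "max b 0" and R' = "2 * R"]
        u f_meas f0 fb fR borel_measurable_steiner_fun[where f = f and b = b and R = R, OF S]
        steiner_fun_nonneg[where f = f and b = b and R = R, OF S] steiner_fun_le[where f = f and b = b and R = R, OF S]
        steiner_fun_support[where f = f and b = b and R = R, OF S]) (simp_all add: u)
  then show ?thesis by simp
qed

end

section \<open>The two inequalities of the theorem\<close>

text \<open>The positive levels up to 1 all give \<open>K\<close> and the levels above 1 the empty
  set. Hence the inequality for sets is the one for functions applied to an indicator.\<close>

lemma steiner_fun_indicator: "steiner_fun u (indicator K) = indicator (steiner_set u K)"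
proof
  fix x
  have "steiner_fun u (indicator K) x = (LINT t|lborel. indicator {0<..1::real} t *\<^sub>R indicator (steiner_set u K) x)"
    unfolding steiner_fun_def set_lebesgue_integral_def
  proof (intro Bochner_Integration.integral_cong refl)
    fix t :: real
    have "{z. t \<le> indicator K z} = (if t \<le> 1 then K else {})" if "0 < t"
      using that by (auto simp: indicator_def)
    then show "indicator {0<..} t *\<^sub>R indicator (steiner_set u {z. t \<le> indicator K z}) x =
        (indicator {0<..1} t *\<^sub>R indicator (steiner_set u K) x :: real)"
      by (cases "0 < t") (auto simp: indicator_def)
  qed
  then show "steiner_fun u (indicator K) x = indicator (steiner_set u K) x" by simp
qed

theorem corollary1p10:
  fixes f :: "real ^ 'n \<Rightarrow> real" and K :: "(real ^ 'n) set" and u :: "real ^ 'n"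
  assumes "CARD('n) \<ge> 2"
    and "continuous_on UNIV f" and "\<And>x. f x \<ge> 0" and "compact (closure {x. f x \<noteq> 0})"
    and "compact K"
    and "u \<in> sphere 0 1"
  shows "hausdorff_outer CARD('n) (intersection_body f)
           \<le> hausdorff_outer CARD('n) (intersection_body (steiner_fun u f))
       \<and> hausdorff_outer CARD('n) (intersection_body (indicator K))
           \<le> hausdorff_outer CARD('n) (intersection_body (indicator (steiner_set u K)))"
proof
  have u: "norm u = 1" using assms(6) by simp
  let ?S = "closure {x. f x \<noteq> 0}"
  have S: "x \<in> ?S" if "f x \<noteq> 0" for x using that closure_subset[of "{x. f x \<noteq> 0}"] by auto
  obtain R where R: "\<And>x. x \<in> ?S \<Longrightarrow> norm x \<le> R"
    using compact_imp_bounded[OF assms(4)] by (auto simp: bounded_iff)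
  have "compact (f ` ?S)"
    using assms(2,4) by (intro compact_continuous_image) (auto intro: continuous_on_subset)
  then obtain b where b: "\<And>x. x \<in> ?S \<Longrightarrow> \<bar>f x\<bar> \<le> b"
    using compact_imp_bounded by (fastforce simp: bounded_iff)
  show "hausdorff_outer CARD('n) (intersection_body f) \<le> hausdorff_outer CARD('n) (intersection_body (steiner_fun u f))"
  proof (rule hausdorff_outer_intersection_body_steiner_fun[where b = "max b 0" and R = R])
    show "f x \<le> max b 0" for x using S[of x] b[of x] by (cases "f x = 0") auto
    show "norm x \<le> R" if "f x \<noteq> 0" for x using R S that by blast
    show "compact {x. t \<le> f x}" if "0 < t" for t
    proof -
      have "closed {x. t \<le> f x}" using assms(2) by (intro closed_Collect_le) auto
      \<comment> \<open>Positivity of \<open>t\<close> places the superlevel set inside the compact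
        support.\<close>
      moreover have "{x. t \<le> f x} \<subseteq> ?S" using S that by force
      ultimately have "compact (?S \<inter> {x. t \<le> f x})" "?S \<inter> {x. t \<le> f x} = {x. t \<le> f x}"
        using compact_Int_closed[OF assms(4)] by blast+
      then show ?thesis by simp
    qed
    show "f \<in> borel_measurable borel" using assms(2) by (rule borel_measurable_continuous_onI)
  qed (use assms u in auto)
  obtain R' where R': "\<And>x. x \<in> K \<Longrightarrow> norm x \<le> R'"
    using compact_imp_bounded[OF assms(5)] by (auto simp: bounded_iff)
  have "hausdorff_outer CARD('n) (intersection_body (indicator K)) \<le>
      hausdorff_outer CARD('n) (intersection_body (steiner_fun u (indicator K)))"
  proof (rule hausdorff_outer_intersection_body_steiner_fun[where b = 1 and R = R'])
    show "compact {x. t \<le> indicator K x}" if "0 < t" for t :: real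
    proof -
      have "{x. t \<le> indicator K x} = (if t \<le> 1 then K else {})" using that by (auto simp: indicator_def)
      then show ?thesis using assms(5) by simp
    qed
    show "norm x \<le> R'" if "(indicator K x :: real) \<noteq> 0" for x using R' that by (auto simp: indicator_def split: if_splits)
    show "indicator K \<in> borel_measurable borel" using assms(5) by (simp add: compact_imp_closed borel_closed)
  qed (use assms u in \<open>auto simp: indicator_def\<close>)
  then show "hausdorff_outer CARD('n) (intersection_body (indicator K))
           \<le> hausdorff_outer CARD('n) (intersection_body (indicator (steiner_set u K)))"
    by (simp add: steiner_fun_indicator)
qed

end
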